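(* Let $(V,\delta_0,\{,\})$ be a dg (left) Leibniz algebra over a field $\mathbb{K}$ of characteristic zero. Let $\delta_t=\sum_{i\ge0}t^i\delta_i$ be a formal deformation of $\delta_0$, let $\xi_t=t\xi_1+t^2\xi_2+\cdots$ be a derivation of degree $0$ on $V[[t]]$ (with $\xi_i\in\mathrm{Der}(V)$ of degree $0$), and let $\delta'_t=\sum_{i\ge 0}t^i\delta'_i$ be the deformation of $\delta_0$ related to $\delta_t$ by the gauge transformation $$\delta'_t=\exp(X_{\xi_t})(\delta_t),\qquad X_{\xi_t}:=[\,\cdot\,,\xi_t].$$ Let $\partial=\sum_{i\ge1}\partial_i$ and $\partial'=\sum_{i\ge1}\partial'_i$ be the codifferentials on $\bar{T}V$ corresponding to the sh Leibniz algebra structures on $sV$ given by the higher derived brackets of $\delta_t$ and $\delta'_t$ respectively, and put $$\Xi:=N_2^c\xi_1+N_3^c\xi_2+\cdots+N_{i+1}^c\xi_i+\cdots\in\mathrm{Coder}(\bar{T}V).$$ (I) The two induced sh Leibniz algebra structures are equivalent, in the sense that $$\partial'=\exp(X_{\Xi})(\partial),\qquad X_\Xi:=[\,\cdot\,,\Xi].$$ (II) The exponential $e^{\Xi}:=1+\Xi+\frac{1}{2!}\Xi^2+\cdots$ is a dg coalgebra isomorphism between $(\bar{T}V,\partial)$ and $(\bar{T}V,\partial')$; namely, $e^\Xi$ is an isomorphism on $\bar TV$ satisfying $$\partial'=e^{-\Xi}\cdot\partial\cdot e^{\Xi},\qquad \Delta e^{\Xi}=(e^{\Xi}\otimes e^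{\Xi})\Delta.$$
   Context: All vector spaces are graded, over a field $\mathbb{K}$ of characteristic zero; $(-1)^{x}$ means $(-1)^{|x|}$, and the Koszul sign convention $(f\otimes g)(x\otimes y)=(-1)^{|g||x|}f(x)\otimes g(y)$ is used. The operator $s$ raises degree by $1$ and $s^{-1}$, its inverse, lowers it by $1$ (also subject to the Koszul convention). $sV$ is the shifted space. $[\cdot,\cdot]$ denotes graded commutators. A dg (left) Leibniz algebra $(V,d,\{,\})$ is a graded vector space with a linear map $d$ of degree $+1$, $d^2=0$, and a bilinear bracket of degree $0$ such that $d\{x,y\}=\{dx,y\}+(-1)^{|x|}\{x,dy\}$ and $\{x,\{y,z\}\}=\{\{x,y\},z\}+(-1)^{|x||y|}\{y,\{x,z\}\}$. $\mathrm{Der}(V)$ is the space of derivations of the bracket: $D\{x,y\}=\{Dx,y\}+(-1)^{|D||x|}\{x,Dy\}$. $V[[t]]$ is the Leibniz algebra of formal power series with coefficients in $V$, bracket extended $t$-linearly. A formal deformation of $\delta_0$ is $\delta_t=\sum_{i\ge0}t^i\delta_i$ with $\delta_i\in\mathrm{Der}(V)$ of degree $+1$ and $\delta_t^2=0$, i.e. $\sum_{i+j=m}\delta_i\delta_j=0$ for all $m$. Coalgebra: $\bar{T}V=V\oplus V^{\otimes2}\oplus V^{\otimes3}\oplus\cdots$, with comultiplication $\Delta:\bar TV\to\bar TV\otimes\bar TV$ given by $\Delta(V)=0$ and, for $n\ge1$, $$\Delta(x_1,\dots,x_{n+1})=\sum_{i=1}^{n}\sum_\sigma\epsilon(\sigma)(x_{\sigma(1)},\dots,x_{\sigma(i)})\otimes(x_{\sigma(i+1)},\dots,x_{\sigma(n)},x_{n+1}),$$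 $\sigma\in S_n$ running over $(i,n-i)$-unshuffles ($\sigma(1)<\cdots<\sigma(i)$, $\sigma(i+1)<\cdots<\sigma(n)$), $\epsilon(\sigma)$ the Koszul sign. $\mathrm{Coder}(\bar TV)$ is the space of maps $D^c$ with $\Delta D^c=(D^c\otimes1)\Delta+(1\otimes D^c)\Delta$. Each $i$-ary linear map $f:V^{\otimes i}\to V$ determines a coderivation $f^c$ by $f^c(V^{\otimes n})=0$ for $n<i$ and, for $n\ge i$, $$f^c(x_1,\dots,x_n)=\sum_{k=i}^n\sum_\sigma\epsilon(\sigma)(-1)^{|f|(x_{\sigma(1)}+\cdots+x_{\sigma(k-i)})}(x_{\sigma(1)},\dots,x_{\sigma(k-i)},f(x_{\sigma(k+1-i)},\dots,x_{\sigma(k-1)},x_k),x_{k+1},\dots,x_n),$$ $\sigma\in S_{k-1}$ running over $(k-i,i-1)$-unshuffles. For $D\in\mathrm{Der}(V)$ and $i\ge1$, $N_iD:V^{\otimes i}\to V$ is $N_iD(x_1,\dots,x_i)=\{\dots\{\{Dx_1,x_2\},x_3\},\dots,x_i\}$ (with $N_1D=D$), and $N_i^cD:=(N_iD)^c$. Higher derived brackets of $\delta_t$: $l_i:=(-1)^{\frac{(i-1)(i-2)}{2}}s\circ N_i\circ(s^{-1})^{\otimes i}\circ(s\delta_{i-1}s^{-1}\otimes1^{\otimes(i-1)})$ on $sV$, where $N_i(x_1,\dots,x_i)=\{\dots\{\{x_1,x_2\},x_3\},\dots,x_i\}$. The associated coderivations of $\bar TV$ are $\partial_i:=(s^{-1}\circ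 l_i\circ s^{\otimes i})^c$, of degree $+1$, and $\partial=\sum_{i\ge1}\partial_i$ (so that the sh Leibniz identities for $(sV,l_1,l_2,\dots)$ are equivalent to $\partial\partial=0$). $\partial'_i,\partial'$ are defined in the same way from $\delta'_t$. *)

theory Defs
  imports Complex_Main "HOL-Library.Poly_Mapping" "HOL-Combinatorics.Permutations"
begin

section \<open>Graded vector spaces\<close>

definition homogeneous_decomposition ::
  "(int \<Rightarrow> 'v::ab_group_add set) \<Rightarrow> 'v \<Rightarrow> (int \<Rightarrow> 'v) \<Rightarrow> bool" where
  "homogeneous_decomposition G v c \<longleftrightarrow>
     (\<forall>n. c n \<in> G n) \<and> finite {n. c n \<noteq> 0} \<and> (\<Sum>n | c n \<noteq> 0. c n) = v"

locale graded_vector_space = vector_space scale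
  for scale :: "'k::field_char_0 \<Rightarrow> 'v::ab_group_add \<Rightarrow> 'v" +
  fixes G :: "int \<Rightarrow> 'v set"
  assumes subspace_G: "subspace (G n)"
    and direct_sum: "\<exists>!c. homogeneous_decomposition G v c"

text \<open>\<open>deg G x\<close> is meaningful for homogeneous \<open>x \<noteq> 0\<close> only.\<close>

definition deg :: "(int \<Rightarrow> 'v::ab_group_add set) \<Rightarrow> 'v \<Rightarrow> int" where
  "deg G x = (THE n. x \<in> G n)"

text \<open>The set of nonzero homogeneous components of a vector; distinct degrees give distinct
  components, so \<open>x\<close> is the sum of the elements of \<open>hcomponents G x\<close>.\<close>

definition hcomponents :: "(int \<Rightarrow> 'v::ab_group_add set) \<Rightarrow> 'v \<Rightarrow> 'v set" where
  "hcomponents G x = range (THE c. homogeneous_decomposition G x c) - {0}"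

text \<open>Formulas with Koszul signs are written for homogeneous arguments; \<open>hextend G\<close> extends them to
  arbitrary arguments \<open>x\<^sub>1, \<dots>, x\<^sub>n\<close> by summing over all choices of one component of each \<open>x\<^sub>j\<close>.\<close>

definition hextend ::
  "(int \<Rightarrow> 'v::ab_group_add set) \<Rightarrow> ('v list \<Rightarrow> 'z::comm_monoid_add) \<Rightarrow> 'v list \<Rightarrow> 'z" where
  "hextend G \<phi> xs = (\<Sum>ys \<in> listset (map (hcomponents G) xs). \<phi> ys)"

definition graded_linear ::
  "('k::field_char_0 \<Rightarrow> 'v::ab_group_add \<Rightarrow> 'v) \<Rightarrow> (int \<Rightarrow> 'v set) \<Rightarrow> int \<Rightarrow> ('v \<Rightarrow> 'v) \<Rightarrow> bool" where
  "graded_linear scale G p f \<longleftrightarrow>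
     Vector_Spaces.linear scale scale f \<and> (\<forall>n. f ` G n \<subseteq> G (n + p))"

section \<open>Leibniz algebras, derivations and deformations\<close>

locale leibniz_algebra = graded_vector_space scale G
  for scale :: "'k::field_char_0 \<Rightarrow> 'v::ab_group_add \<Rightarrow> 'v" and G :: "int \<Rightarrow> 'v set" +
  fixes br :: "'v \<Rightarrow> 'v \<Rightarrow> 'v"
  assumes linear_right: "Vector_Spaces.linear scale scale (\<lambda>y. br x y)"
    and linear_left: "Vector_Spaces.linear scale scale (\<lambda>x. br x y)"
    and degree_br: "x \<in> G m \<Longrightarrow> y \<in> G n \<Longrightarrow> br x y \<in> G (m + n)"
    and leibniz: "x \<in> G m \<Longrightarrow> y \<in> G n \<Longrightarrow>
      br x (br y z) = br (br x y) z + scale ((-1) powi (m * n)) (br y (br x z))"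

definition derivation ::
  "('k::field_char_0 \<Rightarrow> 'v::ab_group_add \<Rightarrow> 'v) \<Rightarrow> (int \<Rightarrow> 'v set) \<Rightarrow> ('v \<Rightarrow> 'v \<Rightarrow> 'v)
    \<Rightarrow> int \<Rightarrow> ('v \<Rightarrow> 'v) \<Rightarrow> bool" where
  "derivation scale G br p D \<longleftrightarrow> graded_linear scale G p D \<and>
     (\<forall>n. \<forall>x\<in>G n. \<forall>y. D (br x y) = br (D x) y + scale ((-1) powi (p * n)) (br x (D y)))"

locale dg_leibniz_algebra = leibniz_algebra scale G br
  for scale :: "'k::field_char_0 \<Rightarrow> 'v::ab_group_add \<Rightarrow> 'v" and G :: "int \<Rightarrow> 'v set"
    and br :: "'v \<Rightarrow> 'v \<Rightarrow> 'v" +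
  fixes d :: "'v \<Rightarrow> 'v"
  assumes derivation_d: "derivation scale G br 1 d"
    and square_zero: "d (d x) = 0"

text \<open>A \<open>t\<close>-linear operator \<open>\<Sum>\<^sub>i t\<^sup>i A\<^sub>i\<close> on \<open>V[[t]]\<close> is given by its sequence of coefficients
  \<open>A :: nat \<Rightarrow> 'v \<Rightarrow> 'v\<close>.\<close>

definition formal_deformation ::
  "('k::field_char_0 \<Rightarrow> 'v::ab_group_add \<Rightarrow> 'v) \<Rightarrow> (int \<Rightarrow> 'v set) \<Rightarrow> ('v \<Rightarrow> 'v \<Rightarrow> 'v)
    \<Rightarrow> ('v \<Rightarrow> 'v) \<Rightarrow> (nat \<Rightarrow> 'v \<Rightarrow> 'v) \<Rightarrow> bool" where
  "formal_deformation scale G br d \<delta> \<longleftrightarrow>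
     \<delta> 0 = d \<and> (\<forall>i. derivation scale G br 1 (\<delta> i)) \<and>
     (\<forall>m x. (\<Sum>i\<le>m. \<delta> i (\<delta> (m - i) x)) = 0)"

text \<open>\<open>X\<^sub>\<xi> = [\<cdot>, \<xi>\<^sub>t]\<close>. As \<open>\<xi>\<^sub>t\<close> has degree 0, the graded commutator carries no sign.\<close>

definition series_ad ::
  "(nat \<Rightarrow> 'v::ab_group_add \<Rightarrow> 'v) \<Rightarrow> (nat \<Rightarrow> 'v \<Rightarrow> 'v) \<Rightarrow> (nat \<Rightarrow> 'v \<Rightarrow> 'v)" where
  "series_ad \<xi> A = (\<lambda>m x. \<Sum>i\<le>m. A i (\<xi> (m - i) x) - \<xi> (m - i) (A i x))"

text \<open>\<open>exp(X\<^sub>\<xi>)(A)\<close>, coefficient by coefficient. Here and below, \<open>Sum_any\<close> renders infinite sums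
  that are finite at every argument: if \<open>\<xi>\<^sub>0 = 0\<close>, then \<open>X\<^sub>\<xi>\<^sup>n(A)\<close> has no coefficients below \<open>t\<^sup>n\<close>.\<close>

definition series_exp_ad ::
  "('k::field_char_0 \<Rightarrow> 'v::ab_group_add \<Rightarrow> 'v) \<Rightarrow> (nat \<Rightarrow> 'v \<Rightarrow> 'v)
    \<Rightarrow> (nat \<Rightarrow> 'v \<Rightarrow> 'v) \<Rightarrow> (nat \<Rightarrow> 'v \<Rightarrow> 'v)" where
  "series_exp_ad scale \<xi> A =
     (\<lambda>m x. Sum_any (\<lambda>n. scale (1 / fact n) ((series_ad \<xi> ^^ n) A m x)))"

section \<open>Free vector spaces and quotients\<close>

definition smul :: "'k::field \<Rightarrow> ('x \<Rightarrow>\<^sub>0 'k) \<Rightarrow> ('x \<Rightarrow>\<^sub>0 'k)" where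
  "smul c z = Poly_Mapping.map ((*) c) z"

lemma lookup_smul [simp]: "Poly_Mapping.lookup (smul c z) x = c * Poly_Mapping.lookup z x"
  by (simp add: smul_def Poly_Mapping.map.rep_eq Poly_Mapping.when_def)

global_interpretation free: vector_space "smul :: 'k::field \<Rightarrow> ('x \<Rightarrow>\<^sub>0 'k) \<Rightarrow> ('x \<Rightarrow>\<^sub>0 'k)"
  by standard (auto intro!: poly_mapping_eqI simp: lookup_add algebra_simps)

abbreviation gen :: "'x \<Rightarrow> ('x \<Rightarrow>\<^sub>0 'k::field)" where
  "gen x \<equiv> Poly_Mapping.single x 1"

definition linear_extension ::
  "('x \<Rightarrow> ('y \<Rightarrow>\<^sub>0 'k::field)) \<Rightarrow> ('x \<Rightarrow>\<^sub>0 'k) \<Rightarrow> ('y \<Rightarrow>\<^sub>0 'k)" where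
  "linear_extension \<phi> z = (\<Sum>x \<in> Poly_Mapping.keys z. smul (Poly_Mapping.lookup z x) (\<phi> x))"

text \<open>\<open>F / R\<close> is \<open>F // modulo F R\<close>. A map between quotients is given by a map between the spaces of
  representatives that descends; \<open>qmap\<close> is then the induced map on classes, with \<open>r\<close> the equivalence
  relation of the target.\<close>

definition modulo :: "('x \<Rightarrow>\<^sub>0 'k::field) set \<Rightarrow> ('x \<Rightarrow>\<^sub>0 'k) set \<Rightarrow> ('x \<Rightarrow>\<^sub>0 'k) rel" where
  "modulo F R = {(x, y). x \<in> F \<and> y \<in> F \<and> x - y \<in> R}"

definition descends ::
  "('x \<Rightarrow>\<^sub>0 'k::field) set \<Rightarrow> ('x \<Rightarrow>\<^sub>0 'k) set \<Rightarrow> ('y \<Rightarrow>\<^sub>0 'k) set \<Rightarrow> ('y \<Rightarrow>\<^sub>0 'k) set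
    \<Rightarrow> (('x \<Rightarrow>\<^sub>0 'k) \<Rightarrow> ('y \<Rightarrow>\<^sub>0 'k)) \<Rightarrow> bool" where
  "descends F R F' R' f \<longleftrightarrow>
     Vector_Spaces.linear smul smul f \<and> f ` F \<subseteq> F' \<and> f ` R \<subseteq> R'"

definition qmap :: "'b rel \<Rightarrow> ('a \<Rightarrow> 'b) \<Rightarrow> 'a set \<Rightarrow> 'b set" where
  "qmap r f X = r `` (f ` X)"

section \<open>The tensor coalgebra\<close>

text \<open>\<open>V \<oplus> V\<^sup>\<otimes>\<^sup>2 \<oplus> V\<^sup>\<otimes>\<^sup>3 \<oplus> \<dots>\<close> is the free vector space on the nonempty lists over \<open>V\<close> modulo the
  relations of multilinearity; \<open>gen [x\<^sub>1, \<dots>, x\<^sub>n]\<close> represents \<open>x\<^sub>1 \<otimes> \<dots> \<otimes> x\<^sub>n\<close>.\<close>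

definition words :: "('v list \<Rightarrow>\<^sub>0 'k::field) set" where
  "words = {z. [] \<notin> Poly_Mapping.keys z}"

definition tensor_relations ::
  "('k::field \<Rightarrow> 'v::ab_group_add \<Rightarrow> 'v) \<Rightarrow> ('v list \<Rightarrow>\<^sub>0 'k) set" where
  "tensor_relations scale = free.span
     ({gen (us @ (x + y) # vs) - gen (us @ x # vs) - gen (us @ y # vs) | us x y vs. True} \<union>
      {gen (us @ scale c x # vs) - smul c (gen (us @ x # vs)) | us c x vs. True})"

definition tensor_rel ::
  "('k::field \<Rightarrow> 'v::ab_group_add \<Rightarrow> 'v) \<Rightarrow> ('v list \<Rightarrow>\<^sub>0 'k) rel" where
  "tensor_rel scale = modulo words (tensor_relations scale)"

definition tensor_space ::
  "('k::field \<Rightarrow> 'v::ab_group_add \<Rightarrow> 'v) \<Rightarrow> ('v list \<Rightarrow>\<^sub>0 'k) set set" where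
  "tensor_space scale = words // tensor_rel scale"

definition tensor_space_grade ::
  "('k::field \<Rightarrow> 'v::ab_group_add \<Rightarrow> 'v) \<Rightarrow> (int \<Rightarrow> 'v set) \<Rightarrow> int \<Rightarrow> ('v list \<Rightarrow>\<^sub>0 'k) set set" where
  "tensor_space_grade scale G n =
     (\<lambda>z. tensor_rel scale `` {z}) `
       free.span {gen xs | xs ds. xs \<noteq> [] \<and> list_all2 (\<lambda>x d. x \<in> G d) xs ds \<and> sum_list ds = n}"

text \<open>With \<open>F = words\<close> and \<open>R = tensor_relations scale\<close>, the space \<open>F/R \<otimes> F/R\<close> is
  \<open>F \<otimes> F / (R \<otimes> F + F \<otimes> R)\<close>, where \<open>F \<otimes> F\<close> is free on the pairs of nonempty lists.\<close>

definition tensor ::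
  "('x \<Rightarrow>\<^sub>0 'k::field) \<Rightarrow> ('y \<Rightarrow>\<^sub>0 'k) \<Rightarrow> ('x \<times> 'y \<Rightarrow>\<^sub>0 'k)" where
  "tensor u w = (\<Sum>a \<in> Poly_Mapping.keys u. \<Sum>b \<in> Poly_Mapping.keys w.
     Poly_Mapping.single (a, b) (Poly_Mapping.lookup u a * Poly_Mapping.lookup w b))"

definition words2 :: "('v list \<times> 'v list \<Rightarrow>\<^sub>0 'k::field) set" where
  "words2 = {z. \<forall>(a, b) \<in> Poly_Mapping.keys z. a \<noteq> [] \<and> b \<noteq> []}"

definition tensor_relations2 ::
  "('k::field \<Rightarrow> 'v::ab_group_add \<Rightarrow> 'v) \<Rightarrow> ('v list \<times> 'v list \<Rightarrow>\<^sub>0 'k) set" where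
  "tensor_relations2 scale = free.span
     ({tensor u w | u w. u \<in> tensor_relations scale \<and> w \<in> words} \<union>
      {tensor u w | u w. u \<in> words \<and> w \<in> tensor_relations scale})"

definition tensor_rel2 ::
  "('k::field \<Rightarrow> 'v::ab_group_add \<Rightarrow> 'v) \<Rightarrow> ('v list \<times> 'v list \<Rightarrow>\<^sub>0 'k) rel" where
  "tensor_rel2 scale = modulo words2 (tensor_relations2 scale)"

text \<open>\<open>f \<otimes> g\<close> for \<open>g\<close> of degree \<open>q\<close>, with the Koszul sign \<open>(f \<otimes> g)(a \<otimes> b) = (-1)\<^bsup>q|a|\<^esup> f(a) \<otimes> g(b)\<close>.\<close>

definition op_tensor ::
  "(int \<Rightarrow> 'v::ab_group_add set) \<Rightarrow> int \<Rightarrow> (('v list \<Rightarrow>\<^sub>0 'k::field) \<Rightarrow> ('v list \<Rightarrow>\<^sub>0 'k))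
    \<Rightarrow> (('v list \<Rightarrow>\<^sub>0 'k) \<Rightarrow> ('v list \<Rightarrow>\<^sub>0 'k))
    \<Rightarrow> ('v list \<times> 'v list \<Rightarrow>\<^sub>0 'k) \<Rightarrow> ('v list \<times> 'v list \<Rightarrow>\<^sub>0 'k)" where
  "op_tensor G q f g = linear_extension (\<lambda>(a, b).
     hextend G (\<lambda>ys. smul ((-1) powi (q * (\<Sum>y\<leftarrow>ys. deg G y))) (tensor (f (gen ys)) (g (gen b)))) a)"

text \<open>Positions are counted from 0.\<close>

definition unshuffles :: "nat \<Rightarrow> nat \<Rightarrow> (nat \<Rightarrow> nat) set" where
  "unshuffles p q = {\<sigma>. \<sigma> permutes {..<p + q} \<and> strict_mono_on {..<p} \<sigma> \<and>
     strict_mono_on {p..<p + q} \<sigma>}"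

text \<open>The sign of \<open>x\<^sub>0 \<dots> x\<^sub>n\<^sub>-\<^sub>1 \<mapsto> x\<^bsub>\<sigma>(0)\<^esub> \<dots> x\<^bsub>\<sigma>(n-1)\<^esub>\<close>: one factor \<open>(-1)\<^bsup>|x||y|\<^esup>\<close> for each pair
  \<open>x, y\<close> whose order is reversed.\<close>

definition koszul_sign ::
  "(int \<Rightarrow> 'v::ab_group_add set) \<Rightarrow> nat \<Rightarrow> (nat \<Rightarrow> nat) \<Rightarrow> 'v list \<Rightarrow> 'k::field" where
  "koszul_sign G n \<sigma> xs = (\<Prod>(i, j) \<in> {(i, j). i < j \<and> j < n \<and> \<sigma> j < \<sigma> i}.
     (-1) powi (deg G (xs ! \<sigma> i) * deg G (xs ! \<sigma> j)))"

definition comult_word ::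
  "(int \<Rightarrow> 'v::ab_group_add set) \<Rightarrow> 'v list \<Rightarrow> ('v list \<times> 'v list \<Rightarrow>\<^sub>0 'k::field)" where
  "comult_word G xs = (let n = length xs - 1 in
     \<Sum>i = 1..n. \<Sum>\<sigma> \<in> unshuffles i (n - i).
       Poly_Mapping.single
         (map (\<lambda>j. xs ! \<sigma> j) [0..<i], map (\<lambda>j. xs ! \<sigma> j) [i..<n] @ [xs ! n])
         (koszul_sign G n \<sigma> xs))"

definition comult ::
  "(int \<Rightarrow> 'v::ab_group_add set) \<Rightarrow> ('v list \<Rightarrow>\<^sub>0 'k::field) \<Rightarrow> ('v list \<times> 'v list \<Rightarrow>\<^sub>0 'k)" where
  "comult G = linear_extension (hextend G (comult_word G))"

text \<open>The coderivation \<open>f\<^sup>c\<close> of an \<open>i\<close>-ary map \<open>f\<close> of degree \<open>p\<close>, where \<open>i \<ge> 1\<close>; \<open>f\<close> is only applied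
  to lists of length \<open>i\<close>.\<close>

definition coder_word ::
  "(int \<Rightarrow> 'v::ab_group_add set) \<Rightarrow> nat \<Rightarrow> int \<Rightarrow> ('v list \<Rightarrow> 'v) \<Rightarrow> 'v list
    \<Rightarrow> ('v list \<Rightarrow>\<^sub>0 'k::field)" where
  "coder_word G i p f xs =
     (\<Sum>k = i..length xs. \<Sum>\<sigma> \<in> unshuffles (k - i) (i - 1).
       Poly_Mapping.single
         (map (\<lambda>j. xs ! \<sigma> j) [0..<k - i]
            @ f (map (\<lambda>j. xs ! \<sigma> j) [k - i..<k - 1] @ [xs ! (k - 1)])
            # drop k xs)
         (koszul_sign G (k - 1) \<sigma> xs * (-1) powi (p * (\<Sum>j<k - i. deg G (xs ! \<sigma> j)))))"

definition coder ::
  "(int \<Rightarrow> 'v::ab_group_add set) \<Rightarrow> nat \<Rightarrow> int \<Rightarrow> ('v list \<Rightarrow> 'v)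
    \<Rightarrow> ('v list \<Rightarrow>\<^sub>0 'k::field) \<Rightarrow> ('v list \<Rightarrow>\<^sub>0 'k)" where
  "coder G i p f = linear_extension (hextend G (coder_word G i p f))"

definition coderivation ::
  "('k::field \<Rightarrow> 'v::ab_group_add \<Rightarrow> 'v) \<Rightarrow> (int \<Rightarrow> 'v set) \<Rightarrow> int
    \<Rightarrow> (('v list \<Rightarrow>\<^sub>0 'k) \<Rightarrow> ('v list \<Rightarrow>\<^sub>0 'k)) \<Rightarrow> bool" where
  "coderivation scale G p D \<longleftrightarrow> (\<forall>X \<in> tensor_space scale.
     qmap (tensor_rel2 scale) (\<lambda>z. comult G (D z)) X =
     qmap (tensor_rel2 scale)
       (\<lambda>z. op_tensor G 0 D id (comult G z) + op_tensor G p id D (comult G z)) X)"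

section \<open>Higher derived brackets and their codifferential\<close>

text \<open>\<open>N\<^sub>i(x\<^sub>1, \<dots>, x\<^sub>i)\<close>, where \<open>i\<close> is the length of the list.\<close>

definition nested :: "('v \<Rightarrow> 'v \<Rightarrow> 'v) \<Rightarrow> 'v list \<Rightarrow> 'v" where
  "nested br xs = foldl br (hd xs) (tl xs)"

definition nested_op :: "('v \<Rightarrow> 'v \<Rightarrow> 'v) \<Rightarrow> ('v \<Rightarrow> 'v) \<Rightarrow> 'v list \<Rightarrow> 'v" where
  "nested_op br D xs = nested br (D (hd xs) # tl xs)"

text \<open>\<open>sV\<close> has the same underlying space as \<open>V\<close> and the grading \<open>(sV)\<^sub>n = V\<^sub>n\<^sub>-\<^sub>1\<close>, so that
  \<open>s\<close> and \<open>s\<^sup>-\<^sup>1\<close> are the identity on vectors and appear through degrees and signs only.\<close>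

definition susp :: "(int \<Rightarrow> 'v set) \<Rightarrow> int \<Rightarrow> 'v set" where
  "susp G n = G (n - 1)"

text \<open>The sign in
  \<open>(f\<^sub>0 \<otimes> \<dots> \<otimes> f\<^sub>n\<^sub>-\<^sub>1)(x\<^sub>0, \<dots>, x\<^sub>n\<^sub>-\<^sub>1) = \<plusminus> (f\<^sub>0(x\<^sub>0), \<dots>, f\<^sub>n\<^sub>-\<^sub>1(x\<^sub>n\<^sub>-\<^sub>1))\<close>, where \<open>ps\<close> lists the degrees of the \<open>f\<^sub>k\<close>.\<close>

definition apply_sign ::
  "(int \<Rightarrow> 'v::ab_group_add set) \<Rightarrow> int list \<Rightarrow> 'v list \<Rightarrow> 'k::field" where
  "apply_sign G ps xs = (\<Prod>k<length xs. \<Prod>j<k. (-1) powi (ps ! k * deg G (xs ! j)))"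

text \<open>\<open>l\<^sub>i = (-1)\<^bsup>(i-1)(i-2)/2\<^esup> s \<circ> N\<^sub>i \<circ> (s\<^sup>-\<^sup>1)\<^sup>\<otimes>\<^sup>i \<circ> (s \<delta>\<^sub>i\<^sub>-\<^sub>1 s\<^sup>-\<^sup>1 \<otimes> 1\<^sup>\<otimes>\<^sup>(\<^sup>i\<^sup>-\<^sup>1\<^sup>))\<close> for \<open>i \<ge> 1\<close>.\<close>

definition higher_derived_bracket ::
  "('k::field_char_0 \<Rightarrow> 'v::ab_group_add \<Rightarrow> 'v) \<Rightarrow> (int \<Rightarrow> 'v set) \<Rightarrow> ('v \<Rightarrow> 'v \<Rightarrow> 'v)
    \<Rightarrow> (nat \<Rightarrow> 'v \<Rightarrow> 'v) \<Rightarrow> nat \<Rightarrow> 'v list \<Rightarrow> 'v" where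
  "higher_derived_bracket scale G br \<delta> i = hextend (susp G) (\<lambda>ys.
     let zs = \<delta> (i - 1) (hd ys) # tl ys in
     scale ((-1) ^ ((i - 1) * (i - 2) div 2)
            * apply_sign (susp G) (replicate i (-1)) zs
            * apply_sign (susp G) (1 # replicate (i - 1) 0) ys)
       (nested br zs))"

text \<open>\<open>s\<^sup>-\<^sup>1 \<circ> l\<^sub>i \<circ> s\<^sup>\<otimes>\<^sup>i\<close>\<close>

definition desuspended_bracket ::
  "('k::field_char_0 \<Rightarrow> 'v::ab_group_add \<Rightarrow> 'v) \<Rightarrow> (int \<Rightarrow> 'v set) \<Rightarrow> ('v \<Rightarrow> 'v \<Rightarrow> 'v)
    \<Rightarrow> (nat \<Rightarrow> 'v \<Rightarrow> 'v) \<Rightarrow> nat \<Rightarrow> 'v list \<Rightarrow> 'v" where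
  "desuspended_bracket scale G br \<delta> i = hextend G (\<lambda>xs.
     scale (apply_sign G (replicate i 1) xs) (higher_derived_bracket scale G br \<delta> i xs))"

definition codifferential ::
  "('k::field_char_0 \<Rightarrow> 'v::ab_group_add \<Rightarrow> 'v) \<Rightarrow> (int \<Rightarrow> 'v set) \<Rightarrow> ('v \<Rightarrow> 'v \<Rightarrow> 'v)
    \<Rightarrow> (nat \<Rightarrow> 'v \<Rightarrow> 'v) \<Rightarrow> ('v list \<Rightarrow>\<^sub>0 'k) \<Rightarrow> ('v list \<Rightarrow>\<^sub>0 'k)" where
  "codifferential scale G br \<delta> z =
     Sum_any (\<lambda>i. coder G (i + 1) 1 (desuspended_bracket scale G br \<delta> (i + 1)) z)"

text \<open>\<open>N\<^sub>2\<^sup>c \<xi>\<^sub>1 + N\<^sub>3\<^sup>c \<xi>\<^sub>2 + \<dots>\<close>; only \<open>\<xi>\<^sub>i\<close> with \<open>i \<ge> 1\<close> enter.\<close>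

definition gauge_coder ::
  "(int \<Rightarrow> 'v::ab_group_add set) \<Rightarrow> ('v \<Rightarrow> 'v \<Rightarrow> 'v) \<Rightarrow> (nat \<Rightarrow> 'v \<Rightarrow> 'v)
    \<Rightarrow> ('v list \<Rightarrow>\<^sub>0 'k::field) \<Rightarrow> ('v list \<Rightarrow>\<^sub>0 'k)" where
  "gauge_coder G br \<xi> z = Sum_any (\<lambda>i. coder G (i + 2) 0 (nested_op br (\<xi> (i + 1))) z)"

text \<open>For operators \<open>\<Xi>\<close> that lower the length of words, the sums below are finite at every argument.
  \<open>\<Xi>\<close> has degree 0, so the graded commutator \<open>[A, \<Xi>]\<close> carries no sign.\<close>

definition op_exp ::
  "(('x \<Rightarrow>\<^sub>0 'k::field_char_0) \<Rightarrow> ('x \<Rightarrow>\<^sub>0 'k)) \<Rightarrow> ('x \<Rightarrow>\<^sub>0 'k) \<Rightarrow> ('x \<Rightarrow>\<^sub>0 'k)" where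
  "op_exp \<Xi> z = Sum_any (\<lambda>n. smul (1 / fact n) ((\<Xi> ^^ n) z))"

definition op_ad ::
  "(('x \<Rightarrow>\<^sub>0 'k::field_char_0) \<Rightarrow> ('x \<Rightarrow>\<^sub>0 'k)) \<Rightarrow> (('x \<Rightarrow>\<^sub>0 'k) \<Rightarrow> ('x \<Rightarrow>\<^sub>0 'k))
    \<Rightarrow> ('x \<Rightarrow>\<^sub>0 'k) \<Rightarrow> ('x \<Rightarrow>\<^sub>0 'k)" where
  "op_ad \<Xi> A z = A (\<Xi> z) - \<Xi> (A z)"

definition op_exp_ad ::
  "(('x \<Rightarrow>\<^sub>0 'k::field_char_0) \<Rightarrow> ('x \<Rightarrow>\<^sub>0 'k)) \<Rightarrow> (('x \<Rightarrow>\<^sub>0 'k) \<Rightarrow> ('x \<Rightarrow>\<^sub>0 'k))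
    \<Rightarrow> ('x \<Rightarrow>\<^sub>0 'k) \<Rightarrow> ('x \<Rightarrow>\<^sub>0 'k)" where
  "op_exp_ad \<Xi> A z = Sum_any (\<lambda>n. smul (1 / fact n) ((op_ad \<Xi> ^^ n) A z))"

abbreviation tensor_operator ::
  "('k::field \<Rightarrow> 'v::ab_group_add \<Rightarrow> 'v) \<Rightarrow> (('v list \<Rightarrow>\<^sub>0 'k) \<Rightarrow> ('v list \<Rightarrow>\<^sub>0 'k)) \<Rightarrow> bool" where
  "tensor_operator scale \<equiv>
     descends words (tensor_relations scale) words (tensor_relations scale)"

end

theory Submission
  imports Defs
begin

text \<open>By the Leibniz rule, \<open>{\<dots>{Dy, x\<^sub>2}, \<dots>, x\<^sub>i}\<close> is the nested bracket \<open>N\<^sub>i\<^sub>-\<^sub>1\<close> of the inner derivation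
  \<open>ad(Dy) = {Dy, \<cdot>}\<close>. Hence, for a derivation \<open>D\<close> of degree \<open>p\<close>, a letter \<open>y\<close> of degree \<open>m\<close> and a word \<open>w\<close>,
  \<open>N\<^sub>i\<^sup>cD(yw) = (-1)\<^bsup>pm\<^esup> y N\<^sub>i\<^sup>cD(w) + N\<^sub>i\<^sub>-\<^sub>1\<^sup>c(ad(Dy))(w)\<close>, where the last summand is \<open>(Dy)w\<close> if \<open>i = 1\<close>.
  Induction on words with this recursion yields \<open>[N\<^sub>i\<^sup>cA, N\<^sub>j\<^sup>cB] = N\<^sub>i\<^sub>+\<^sub>j\<^sub>-\<^sub>1\<^sup>c[A, B]\<close>: the assignment
  \<open>t\<^sup>iD \<mapsto> N\<^sub>i\<^sub>+\<^sub>1\<^sup>cD\<close> is a homomorphism of Lie algebras. The signs in the higher derived brackets cancel, so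
  that it maps \<open>\<delta>\<^sub>t\<close> to \<open>\<partial>\<close> and \<open>\<xi>\<^sub>t\<close> to \<open>\<Xi>\<close>, which gives (I). The shuffle coproduct satisfies a similar recursion,
  from which \<open>f\<^sup>c\<close> is seen to be a coderivation. As \<open>\<Xi>\<close> shortens words, all exponentials are
  finite sums at every argument, and (II) follows from \<open>exp(A + B) = exp A exp B\<close> for commuting operators.\<close>

section \<open>Linear maps between free vector spaces\<close>

text \<open>The obstacle is that a tensor is a class of formal combinations of words, while signs
  make sense only for homogeneous nonzero letters, so every operator first splits letters into
  components. Identities that look exact then hold only modulo multilinearity; a word with a zero
  letter, for instance, is not the zero vector of the free space. The remedy is the linear map
  \<open>reduce\<close>, which turns congruences into equations between its values. The sums over
  unshuffles serve only to extract recursions along the first letter. When an (i+1)-ary map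
  \<open>f\<close> of degree p absorbs a letter y of degree m, what remains is the i-ary map f(y,
  ...) of degree p + m. Inductions on words must therefore treat all arities, degrees and maps (or
  derivations) at once. The sign for passing a whole block is carried by the operator
  \<open>parity\<close> acting on that block, which keeps the coproduct computations linear. One
  binomial identity for families indexed by three exponents gives all facts about exponentials: the
  inverse (from -X and X), the conjugation formula (from multiplication by -X on the left and by X
  on the right) and compatibility with the coproduct (from X \<otimes> 1 and 1 \<otimes> X).\<close>

abbreviation lin :: "(('x \<Rightarrow>\<^sub>0 'k::field) \<Rightarrow> ('y \<Rightarrow>\<^sub>0 'k)) \<Rightarrow> bool" where
  "lin f \<equiv> Vector_Spaces.linear smul smul f"

lemma linI:
  assumes "\<And>x y. f (x + y) = f x + f y" "\<And>c x. f (smul c x) = smul c (f x)"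
  shows "lin f"
  by (simp add: Vector_Spaces.linear_iff assms free.vector_space_axioms)

lemma
  assumes "lin f"
  shows lin_add: "f (x + y) = f x + f y"
    and lin_smul: "f (smul c x) = smul c (f x)"
    and lin_0: "f 0 = 0"
    and lin_diff: "f (x - y) = f x - f y"
    and lin_minus: "f (- x) = - f x"
    and lin_sum: "f (sum g A) = (\<Sum>a\<in>A. f (g a))"
proof -
  interpret Vector_Spaces.linear smul smul f by fact
  show "f (x + y) = f x + f y" "f (smul c x) = smul c (f x)" "f 0 = 0" "f (x - y) = f x - f y"
    "f (- x) = - f x" "f (sum g A) = (\<Sum>a\<in>A. f (g a))"
    by (rule add scale zero diff neg sum)+
qed

lemmas lin_simps = lin_add lin_smul lin_0 lin_diff lin_minus lin_sum

lemma lin_compose: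
  assumes "lin f" "lin g"
  shows "lin (\<lambda>z. f (g z))"
  by (rule linI) (simp_all add: lin_simps[OF assms(1)] lin_simps[OF assms(2)])

lemma lin_plus: "lin f \<Longrightarrow> lin g \<Longrightarrow> lin (\<lambda>z. f z + g z)"
  by (rule linI) (simp_all add: lin_simps free.scale_right_distrib)

lemma lin_uminus: "lin f \<Longrightarrow> lin (\<lambda>z. - f z)"
  by (rule linI) (simp_all add: lin_simps)

lemma lin_minus_op: "lin f \<Longrightarrow> lin g \<Longrightarrow> lin (\<lambda>z. f z - g z)"
  by (rule linI) (simp_all add: lin_simps free.scale_right_diff_distrib)

lemma lin_smul_op: "lin f \<Longrightarrow> lin (\<lambda>z. smul c (f z))"
  by (rule linI) (simp_all add: lin_simps free.scale_right_distrib mult.commute)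

lemma lin_sum_op: "(\<And>a. a \<in> A \<Longrightarrow> lin (f a)) \<Longrightarrow> lin (\<lambda>z. \<Sum>a\<in>A. f a z)"
  by (rule linI) (simp_all add: lin_simps sum.distrib free.scale_sum_right)

lemma lin_ident: "lin (\<lambda>z. z)"
  by (rule linI) simp_all

lemma lin_zero_op: "lin (\<lambda>z. 0)"
  by (rule linI) simp_all

lemma lin_funpow:
  fixes f :: "('x \<Rightarrow>\<^sub>0 'k::field) \<Rightarrow> ('x \<Rightarrow>\<^sub>0 'k)"
  assumes "lin f"
  shows "lin (f ^^ n)"
proof (induction n)
  case 0
  show ?case by (simp add: lin_ident id_def)
next
  case (Suc n)
  then show ?case using lin_compose[OF assms Suc] by (simp add: comp_def)
qed

lemma single_conv_gen: "Poly_Mapping.single x a = smul a (gen x)"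
  by (rule poly_mapping_eqI) (simp add: lookup_single when_def)

lemma gen_decomp:
  "z = (\<Sum>x\<in>Poly_Mapping.keys z. smul (Poly_Mapping.lookup z x) (gen x))"
  by (rule poly_mapping_eqI)
    (auto simp: lookup_sum lookup_single when_def sum.If_cases in_keys_iff
      if_distrib[of "\<lambda>y. _ * y"] cong: if_cong)

lemma linear_extension_superset:
  assumes "finite S" "Poly_Mapping.keys z \<subseteq> S"
  shows "linear_extension \<phi> z = (\<Sum>x\<in>S. smul (Poly_Mapping.lookup z x) (\<phi> x))"
  unfolding linear_extension_def
  by (rule sum.mono_neutral_left) (use assms in \<open>auto simp: in_keys_iff\<close>)

lemma lin_linear_extension:
  fixes \<phi> :: "'a \<Rightarrow> ('b \<Rightarrow>\<^sub>0 'c::field)"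
  shows "lin (linear_extension \<phi>)"
proof (rule linI)
  fix x y :: "'a \<Rightarrow>\<^sub>0 'c::field" and c
  let ?S = "Poly_Mapping.keys x \<union> Poly_Mapping.keys y \<union> Poly_Mapping.keys (x + y)
    \<union> Poly_Mapping.keys (smul c x)"
  note * = linear_extension_superset[of ?S]
  show "linear_extension \<phi> (x + y) = linear_extension \<phi> x + linear_extension \<phi> y"
    by (subst (1 2 3) *) (auto simp: lookup_add free.scale_left_distrib sum.distrib)
  show "linear_extension \<phi> (smul c x) = smul c (linear_extension \<phi> x)"
    by (subst (1 2) *) (auto simp: free.scale_sum_right)
qed

lemma linear_extension_gen [simp]: "linear_extension \<phi> (gen x) = \<phi> x"
  by (simp add: linear_extension_def)

lemma lin_mem_keys:
  assumes "lin f" "free.subspace S" "\<And>x. x \<in> Poly_Mapping.keys z \<Longrightarrow> f (gen x) \<in> S"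
  shows "f z \<in> S"
proof -
  have "f z = f (\<Sum>x\<in>Poly_Mapping.keys z. smul (Poly_Mapping.lookup z x) (gen x))"
    by (rule arg_cong[OF gen_decomp])
  also have "\<dots> \<in> S"
    by (auto simp: lin_sum[OF assms(1)] lin_smul[OF assms(1)]
        intro!: free.subspace_sum free.subspace_scale assms(2,3))
  finally show ?thesis .
qed

lemma lin_eq_keys:
  assumes "lin f" "lin g" "\<And>x. x \<in> Poly_Mapping.keys z \<Longrightarrow> f (gen x) = g (gen x)"
  shows "f z = g z"
proof -
  have "f z - g z \<in> {0}"
    by (rule lin_mem_keys[OF lin_minus_op[OF assms(1,2)]]) (simp_all add: assms(3))
  then show ?thesis by simp
qed

lemma lin_eqI: "lin f \<Longrightarrow> lin g \<Longrightarrow> (\<And>x. f (gen x) = g (gen x)) \<Longrightarrow> f z = g z"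
  by (rule lin_eq_keys)

lemma subspace_vimage: "lin f \<Longrightarrow> free.subspace S \<Longrightarrow> free.subspace {z. f z \<in> S}"
  by (simp add: free.subspace_def lin_simps)

lemma lin_image_span:
  assumes "lin f" "free.subspace S" "\<And>z. z \<in> B \<Longrightarrow> f z \<in> S" "z \<in> free.span B"
  shows "f z \<in> S"
  using free.span_minimal[of B "{z. f z \<in> S}"] subspace_vimage[OF assms(1,2)] assms(3,4) by auto

text \<open>A linear map with kernel \<open>S\<close>, so that congruences modulo \<open>S\<close> become equations.\<close>

definition reduce :: "('x \<Rightarrow>\<^sub>0 'k::field) set \<Rightarrow> ('x \<Rightarrow>\<^sub>0 'k) \<Rightarrow> ('x \<Rightarrow>\<^sub>0 'k)" where
  "reduce S = (SOME Q. lin Q \<and> (\<forall>z. Q z = 0 \<longleftrightarrow> z \<in> S))"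

text \<open>A basis B of S extends to a basis C of the whole space. The map that kills B and fixes
  the rest of C vanishes on S, and z - Q z always lies in S, so that Q z = 0 conversely forces z
  into S.\<close>

lemma ex_reduce:
  fixes S :: "('x \<Rightarrow>\<^sub>0 'k::field) set"
  assumes "free.subspace S"
  shows "\<exists>Q :: ('x \<Rightarrow>\<^sub>0 'k) \<Rightarrow> ('x \<Rightarrow>\<^sub>0 'k). lin Q \<and> (\<forall>z. Q z = 0 \<longleftrightarrow> z \<in> S)"
proof -
  interpret vs: vector_space_pair "smul :: 'k \<Rightarrow> ('x \<Rightarrow>\<^sub>0 'k) \<Rightarrow> ('x \<Rightarrow>\<^sub>0 'k)"
    "smul :: 'k \<Rightarrow> ('x \<Rightarrow>\<^sub>0 'k) \<Rightarrow> ('x \<Rightarrow>\<^sub>0 'k)" ..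
  obtain B where B: "B \<subseteq> S" "free.independent B" "S \<subseteq> free.span B"
    by (rule free.maximal_independent_subset)
  define C where "C = free.extend_basis B"
  have C: "B \<subseteq> C" "free.independent C" "free.span C = UNIV"
    unfolding C_def using B(2)
    by (rule free.extend_basis_superset free.independent_extend_basis free.span_extend_basis)+
  define Q where "Q = vs.construct C (\<lambda>b. if b \<in> B then 0 else b)"
  have Q: "lin Q"
    unfolding Q_def by (rule vs.linear_construct[OF C(2)])
  have QC: "Q b = (if b \<in> B then 0 else b)" if "b \<in> C" for b
    unfolding Q_def using vs.construct_basis[OF C(2) that] by simp
  have 0: "Q z = 0" if "z \<in> S" for z
    using lin_image_span[OF Q free.subspace_single_0, of B z] subsetD[OF B(3) that] subsetD[OF C(1)] QC by simp
  have 1: "z - Q z \<in> S" for z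
  proof -
    have "lin (\<lambda>z. z - Q z)" using Q by (intro lin_minus_op lin_ident)
    then show ?thesis
      by (rule lin_image_span[OF _ assms, of _ C])
        (use QC B(1) assms C(3) in \<open>auto simp: free.subspace_0\<close>)
  qed
  have "z \<in> S" if "Q z = 0" for z
    using 1[of z] that by simp
  with Q 0 show ?thesis by blast
qed

lemma
  assumes "free.subspace S"
  shows lin_reduce: "lin (reduce S)"
    and reduce_eq_0_iff: "reduce S z = 0 \<longleftrightarrow> z \<in> S"
    and reduce_eq_iff: "reduce S x = reduce S y \<longleftrightarrow> x - y \<in> S"
proof -
  have *: "lin (reduce S) \<and> (\<forall>z. reduce S z = 0 \<longleftrightarrow> z \<in> S)"
    unfolding reduce_def by (rule someI_ex[OF ex_reduce[OF assms]])
  then show "lin (reduce S)" "reduce S z = 0 \<longleftrightarrow> z \<in> S" by auto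
  show "reduce S x = reduce S y \<longleftrightarrow> x - y \<in> S"
    using * spec[OF conjunct2[OF *], of "x - y"] by (simp add: lin_diff)
qed

text \<open>Well-definedness on quotients in the form of a congruence rule; the rules named
  \<open>..._cong\<close> for the individual operators are instances.\<close>

lemma reduce_cong:
  assumes "free.subspace S" "free.subspace S'" "lin f" "\<And>z. z \<in> S \<Longrightarrow> f z \<in> S'"
    and "reduce S x = reduce S y"
  shows "reduce S' (f x) = reduce S' (f y)"
  using assms(4)[of "x - y"] assms(5)
  by (simp add: reduce_eq_iff assms(1,2) lin_diff[OF assms(3)])

section \<open>Prepending a letter, and tensors of generators\<close>

definition cons :: "'v \<Rightarrow> ('v list \<Rightarrow>\<^sub>0 'k::field) \<Rightarrow> ('v list \<Rightarrow>\<^sub>0 'k)" where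
  "cons x = linear_extension (\<lambda>w. gen (x # w))"

lemma lin_cons: "lin (cons x)"
  by (simp add: cons_def lin_linear_extension)

lemma cons_gen [simp]: "cons x (gen w) = gen (x # w)"
  by (simp add: cons_def)

lemma tensor_conv:
  "tensor u w = linear_extension (\<lambda>a. linear_extension (\<lambda>b. gen (a, b)) w) u"
  unfolding tensor_def linear_extension_def
  by (subst single_conv_gen) (simp add: free.scale_sum_right)

lemma lin_tensor_left: "lin (\<lambda>u. tensor u w)"
  unfolding tensor_conv by (rule lin_linear_extension)

lemma lin_tensor_right: "lin (\<lambda>w. tensor u w)"
proof -
  have "lin (\<lambda>w. \<Sum>x\<in>Poly_Mapping.keys u. smul (Poly_Mapping.lookup u x)
     (linear_extension (\<lambda>b. gen (x, b)) w))"
    by (intro lin_sum_op lin_smul_op lin_linear_extension)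
  then show ?thesis
    unfolding tensor_conv by (simp add: linear_extension_def)
qed

lemmas tensor_simps = lin_simps[OF lin_tensor_left] lin_simps[OF lin_tensor_right]

lemma tensor_gen [simp]: "tensor (gen a) (gen b) = gen (a, b)"
  by (simp add: tensor_conv)

text \<open>The generator of a pair is presented as a tensor of generators so that rules stated for
  \<open>tensor u v\<close> apply to it.\<close>

lemma lin_eq_tensorI:
  assumes "lin f" "lin g"
    and "\<And>a b. (a, b) \<in> Poly_Mapping.keys z \<Longrightarrow> f (tensor (gen a) (gen b)) = g (tensor (gen a) (gen b))"
  shows "f z = g z"
proof (rule lin_eq_keys[OF assms(1,2)])
  fix x assume "x \<in> Poly_Mapping.keys z"
  then show "f (gen x) = g (gen x)"
    using assms(3)[of "fst x" "snd x"] by simp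
qed

section \<open>Unshuffles\<close>

text \<open>The common shape of the coproduct and of the coderivations: \<open>\<Phi>\<close>
  receives the two unshuffled blocks. The recursion along the first letter is thus proved once for
  both.\<close>

definition unshuffle_sum ::
  "(int \<Rightarrow> 'v::ab_group_add set) \<Rightarrow> nat \<Rightarrow> nat \<Rightarrow> 'v list \<Rightarrow> ('v list \<Rightarrow> 'v list \<Rightarrow> ('x \<Rightarrow>\<^sub>0 'k::field))
    \<Rightarrow> ('x \<Rightarrow>\<^sub>0 'k)" where
  "unshuffle_sum G r q xs \<Phi> = (\<Sum>\<sigma>\<in>unshuffles r q. smul (koszul_sign G (r + q) \<sigma> xs)
     (\<Phi> (map (\<lambda>j. xs ! \<sigma> j) [0..<r]) (map (\<lambda>j. xs ! \<sigma> j) [r..<r + q])))"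

text \<open>The Koszul sign of the unshuffle that moves the letters at the positions in A to the
  front: each of them jumps over the earlier letters outside A.\<close>

definition subset_sign :: "(int \<Rightarrow> 'v::ab_group_add set) \<Rightarrow> nat set \<Rightarrow> 'v list \<Rightarrow> 'k::field" where
  "subset_sign G A xs = (\<Prod>i\<in>A. \<Prod>j\<in>{..<i} - A. (-1) powi (deg G (xs ! i) * deg G (xs ! j)))"

lemma nths_conv_filter: "nths xs A = map ((!) xs) (filter (\<lambda>i. i \<in> A) [0..<length xs])"
proof -
  have "zip xs [0..<length xs] = map (\<lambda>i. (xs ! i, i)) [0..<length xs]"
    by (rule nth_equalityI) simp_all
  then show ?thesis
    by (simp add: nths_def filter_map comp_def)
qed

text \<open>A finite set of numbers has only one increasing enumeration.\<close>

lemma strict_mono_on_map_eq_filter: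
  fixes \<sigma> :: "nat \<Rightarrow> nat"
  assumes "strict_mono_on {a..<b} \<sigma>" "\<sigma> ` {a..<b} = {i. i \<in> A \<and> i < n}"
  shows "map \<sigma> [a..<b] = filter (\<lambda>i. i \<in> A) [0..<n]"
proof (rule sorted_distinct_set_unique)
  show "sorted (map \<sigma> [a..<b])"
    using assms(1) by (auto simp: sorted_iff_nth_mono_less intro!: less_imp_le elim!: strict_mono_onD)
  show "distinct (map \<sigma> [a..<b])"
    using assms(1) by (simp add: distinct_map strict_mono_on_imp_inj_on)
  show "set (map \<sigma> [a..<b]) = set (filter (\<lambda>i. i \<in> A) [0..<n])"
    using assms(2) by auto
qed (simp_all add: sorted_wrt_filter)

lemma unshuffles_image:
  assumes "\<sigma> \<in> unshuffles r q" "A = \<sigma> ` {..<r}"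
  shows "A \<subseteq> {..<r + q}" "card A = r" "\<sigma> ` {r..<r + q} = {i. i \<in> - A \<and> i < r + q}"
    "map \<sigma> [0..<r] = filter (\<lambda>i. i \<in> A) [0..<r + q]"
    "map \<sigma> [r..<r + q] = filter (\<lambda>i. i \<in> - A) [0..<r + q]"
proof -
  have perm: "\<sigma> permutes {..<r + q}" and m: "strict_mono_on {..<r} \<sigma>" "strict_mono_on {r..<r + q} \<sigma>"
    using assms by (auto simp: unshuffles_def)
  have inj: "inj \<sigma>" using perm by (rule permutes_inj)
  have img: "\<sigma> ` {..<r + q} = {..<r + q}" using perm by (rule permutes_image)
  show 1: "A \<subseteq> {..<r + q}" 
    using image_mono[of "{..<r}" "{..<r + q}" \<sigma>] img assms(2) by simp
  show "card A = r" using assms(2) inj by (simp add: card_image inj_on_subset)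
  have "{r..<r + q} = {..<r + q} - {..<r}" by auto
  then have "\<sigma> ` {r..<r + q} = {..<r + q} - A"
    using image_set_diff[OF inj, of "{..<r + q}" "{..<r}"] img assms(2) by simp
  then show 2: "\<sigma> ` {r..<r + q} = {i. i \<in> - A \<and> i < r + q}" by auto
  show "map \<sigma> [0..<r] = filter (\<lambda>i. i \<in> A) [0..<r + q]"
    by (rule strict_mono_on_map_eq_filter) (use m 1 assms(2) in \<open>auto simp: atLeast0LessThan\<close>)
  show "map \<sigma> [r..<r + q] = filter (\<lambda>i. i \<in> - A) [0..<r + q]"
    by (rule strict_mono_on_map_eq_filter) (use m 2 in auto)
qed

lemma inj_on_unshuffles_image: "inj_on (\<lambda>\<sigma>. \<sigma> ` {..<r}) (unshuffles r q)"
proof (rule inj_onI)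
  fix \<sigma> \<tau> assume \<sigma>: "\<sigma> \<in> unshuffles r q" and \<tau>: "\<tau> \<in> unshuffles r q"
    and eq: "\<sigma> ` {..<r} = \<tau> ` {..<r}"
  have "map \<sigma> [0..<r] = map \<tau> [0..<r]" "map \<sigma> [r..<r + q] = map \<tau> [r..<r + q]"
    using unshuffles_image(4,5)[OF \<sigma> eq[symmetric]] unshuffles_image(4,5)[OF \<tau> refl] by simp_all
  then have "\<sigma> i = \<tau> i" if "i < r + q" for i
    using that by (cases "i < r") auto
  moreover have "\<sigma> i = \<tau> i" if "\<not> i < r + q" for i
    using that \<sigma> \<tau> by (simp add: unshuffles_def permutes_def)
  ultimately show "\<sigma> = \<tau>" by blast
qed

lemma unshuffles_image_surj:
  assumes "A \<subseteq> {..<r + q}" "card A = r"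
  shows "\<exists>\<sigma>\<in>unshuffles r q. \<sigma> ` {..<r} = A"
proof -
  define as where "as = filter (\<lambda>i. i \<in> A) [0..<r + q]"
  define bs where "bs = filter (\<lambda>i. i \<in> - A) [0..<r + q]"
  \<comment> \<open>Enumerate A increasingly, then its complement; \<open>permutes\<close> forces
    the identity elsewhere.\<close>
  define \<sigma> where "\<sigma> i = (if i < r + q then (as @ bs) ! i else i)" for i
  have set: "set as = A" "set bs = {..<r + q} - A"
    using assms by (auto simp: as_def bs_def)
  have sorted: "sorted_wrt (<) as" "sorted_wrt (<) bs"
    unfolding as_def bs_def by (rule sorted_wrt_filter, simp)+
  have dist: "distinct as" "distinct bs" by (auto simp: as_def bs_def)
  have len: "length as = r" "length bs = q"
    using set dist assms finite_subset[OF assms(1)]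
    by (auto simp: card_Diff_subset simp flip: distinct_card)
  have "bij_betw ((!) (as @ bs)) {..<r + q} {..<r + q}"
    by (rule bij_betw_nth) (use set dist len assms(1) in auto)
  then have "bij_betw \<sigma> {..<r + q} {..<r + q}"
    by (rule bij_betw_cong[THEN iffD1, rotated]) (simp add: \<sigma>_def)
  then have "\<sigma> permutes {..<r + q}"
    by (rule bij_imp_permutes) (simp add: \<sigma>_def)
  moreover have "strict_mono_on {..<r} \<sigma>"
    by (rule strict_mono_onI)
      (use len sorted in \<open>auto simp: \<sigma>_def nth_append sorted_wrt_iff_nth_less\<close>)
  moreover have "strict_mono_on {r..<r + q} \<sigma>"
    by (rule strict_mono_onI)
      (use len sorted in \<open>auto simp: \<sigma>_def nth_append sorted_wrt_iff_nth_less\<close>)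
  moreover have "\<sigma> ` {..<r} = A"
  proof -
    have "\<sigma> ` {..<r} = (!) as ` {..<length as}"
      using len by (intro image_cong) (auto simp: \<sigma>_def nth_append)
    also have "\<dots> = A" using set by (auto simp: set_conv_nth)
    finally show ?thesis .
  qed
  ultimately show ?thesis by (auto simp: unshuffles_def)
qed

text \<open>As \<open>\<sigma>\<close> increases on each block, an inversion pairs a position of the
  first block with one of the second. Applying \<open>\<sigma>\<close> to both entries turns the
  inversions into the pairs of some a in A and some smaller b outside A.\<close>

lemma koszul_sign_unshuffle:
  assumes "\<sigma> \<in> unshuffles r q"
  shows "koszul_sign G (r + q) \<sigma> xs = subset_sign G (\<sigma> ` {..<r}) xs"
proof -
  define A where "A = \<sigma> ` {..<r}"
  note im = unshuffles_image[OF assms A_def]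
  have perm: "\<sigma> permutes {..<r + q}" and m: "strict_mono_on {..<r} \<sigma>" "strict_mono_on {r..<r + q} \<sigma>"
    using assms by (auto simp: unshuffles_def)
  have inj: "inj \<sigma>" using perm by (rule permutes_inj)
  have finA: "finite A" by (simp add: A_def)
  let ?I = "{(i, j). i < j \<and> j < r + q \<and> \<sigma> j < \<sigma> i}"
  have I: "i < r \<and> r \<le> j" if "(i, j) \<in> ?I" for i j
  proof (rule ccontr)
    assume "\<not> ?thesis"
    then have "j < r \<or> r \<le> i" using that by auto
    then have "\<sigma> i < \<sigma> j"
      using that strict_mono_onD[OF m(1), of i j] strict_mono_onD[OF m(2), of i j] by auto
    then show False using that by auto
  qed
  have img: "map_prod \<sigma> \<sigma> ` ?I = Sigma A (\<lambda>i. {..<i} - A)"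
  proof (intro equalityI subsetI)
    fix p assume "p \<in> map_prod \<sigma> \<sigma> ` ?I"
    then obtain i j where p: "p = (\<sigma> i, \<sigma> j)" and ij: "(i, j) \<in> ?I" by auto
    have "\<sigma> j \<notin> A" using I[OF ij] injD[OF inj, of _ j] by (auto simp: A_def)
    then show "p \<in> Sigma A (\<lambda>i. {..<i} - A)"
      using p ij I[OF ij] by (auto simp: A_def)
  next
    fix p assume "p \<in> Sigma A (\<lambda>i. {..<i} - A)"
    then obtain a b where p: "p = (a, b)" "a \<in> A" "b < a" "b \<notin> A" by auto
    then obtain i where i: "i < r" "a = \<sigma> i" by (auto simp: A_def)
    have "b < r + q" using im(1) p by auto
    then have "b \<in> \<sigma> ` {r..<r + q}" using p by (simp add: im(3))
    then obtain j where j: "r \<le> j" "j < r + q" "b = \<sigma> j" by auto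
    then have "(i, j) \<in> ?I" using i p by auto
    then show "p \<in> map_prod \<sigma> \<sigma> ` ?I" using p i j by force
  qed
  have "koszul_sign G (r + q) \<sigma> xs
      = (\<Prod>(a, b)\<in>map_prod \<sigma> \<sigma> ` ?I. (-1) powi (deg G (xs ! a) * deg G (xs ! b)))"
    unfolding koszul_sign_def
    by (subst prod.reindex)
      (auto intro: inj_on_subset[OF prod.inj_map[OF inj inj]] simp: case_prod_unfold)
  also have "\<dots> = subset_sign G A xs"
    unfolding img subset_sign_def by (rule prod.Sigma[symmetric]) (auto simp: finA)
  finally show ?thesis by (simp add: A_def)
qed

text \<open>An unshuffle is determined by the set of its first \<open>r\<close> values.\<close>

lemma unshuffle_sum_conv_subsets:
  assumes "length xs = r + q"
  shows "unshuffle_sum G r q xs \<Phi> = (\<Sum>A | A \<subseteq> {..<r + q} \<and> card A = r.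
    smul (subset_sign G A xs) (\<Phi> (nths xs A) (nths xs (- A))))"
proof -
  have bij: "bij_betw (\<lambda>\<sigma>. \<sigma> ` {..<r}) (unshuffles r q) {A. A \<subseteq> {..<r + q} \<and> card A = r}"
    unfolding bij_betw_def
  proof (intro conjI inj_on_unshuffles_image equalityI subsetI)
    fix A assume "A \<in> (\<lambda>\<sigma>. \<sigma> ` {..<r}) ` unshuffles r q"
    then show "A \<in> {A. A \<subseteq> {..<r + q} \<and> card A = r}"
      using unshuffles_image(1,2)[OF _ refl] by blast
  next
    fix A assume "A \<in> {A. A \<subseteq> {..<r + q} \<and> card A = r}"
    then show "A \<in> (\<lambda>\<sigma>. \<sigma> ` {..<r}) ` unshuffles r q"
      using unshuffles_image_surj[of A r q] by blast
  qed
  show ?thesis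
    unfolding unshuffle_sum_def
  proof (subst sum.reindex_bij_betw[OF bij, symmetric], intro sum.cong refl)
    fix \<sigma> assume \<sigma>: "\<sigma> \<in> unshuffles r q"
    have "map (\<lambda>j. xs ! \<sigma> j) [0..<r] = nths xs (\<sigma> ` {..<r})"
      "map (\<lambda>j. xs ! \<sigma> j) [r..<r + q] = nths xs (- \<sigma> ` {..<r})"
      using unshuffles_image(4,5)[OF \<sigma> refl, THEN arg_cong, of "map ((!) xs)"] assms
      by (simp_all add: nths_conv_filter comp_def)
    then show "smul (koszul_sign G (r + q) \<sigma> xs)
        (\<Phi> (map (\<lambda>j. xs ! \<sigma> j) [0..<r]) (map (\<lambda>j. xs ! \<sigma> j) [r..<r + q])) =
      smul (subset_sign G (\<sigma> ` {..<r}) xs)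
        (\<Phi> (nths xs (\<sigma> ` {..<r})) (nths xs (- \<sigma> ` {..<r})))"
      by (simp add: koszul_sign_unshuffle[OF \<sigma>])
  qed
qed

lemma minus_one_powi_add: "(-1 :: 'k::field) powi (m + n) = (-1) powi m * (-1) powi n"
  by (rule power_int_add) simp

lemma minus_one_powi_sum: "(\<Prod>i\<in>A. (-1 :: 'k::field) powi f i) = (-1) powi (\<Sum>i\<in>A. f i)"
  by (induction A rule: infinite_finite_induct) (simp_all add: minus_one_powi_add)

lemma sum_list_nths:
  fixes f :: "'v \<Rightarrow> int"
  assumes "A \<subseteq> {..<length xs}"
  shows "(\<Sum>y\<leftarrow>nths xs A. f y) = (\<Sum>i\<in>A. f (xs ! i))"
proof -
  have "(\<Sum>y\<leftarrow>nths xs A. f y) = (\<Sum>i\<leftarrow>filter (\<lambda>i. i \<in> A) [0..<length xs]. f (xs ! i))"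
    by (simp add: nths_conv_filter comp_def)
  also have "\<dots> = (\<Sum>i\<in>set (filter (\<lambda>i. i \<in> A) [0..<length xs]). f (xs ! i))"
    by (rule sum_list_distinct_conv_sum_set) simp
  also have "set (filter (\<lambda>i. i \<in> A) [0..<length xs]) = A"
    using assms by auto
  finally show ?thesis .
qed

text \<open>A first letter that stays in front jumps over nothing, and no selected letter jumps over
  it.\<close>

lemma subset_sign_insert_0:
  "subset_sign G (insert 0 (Suc ` A)) (x # xs) = subset_sign G A xs"
proof (cases "finite A")
  case True
  have *: "{..<Suc i} - insert 0 (Suc ` A) = Suc ` ({..<i} - A)" for i
    by (auto simp: lessThan_Suc_eq_insert_0)
  show ?thesis
    unfolding subset_sign_def using True
    by (simp add: prod.reindex * comp_def)
next
  \<comment> \<open>Products over infinite sets are 1 by convention, so both signs are 1.\<close>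
  case False
  then have "infinite (insert 0 (Suc ` A))" by (simp add: finite_image_iff)
  with False show ?thesis by (simp add: subset_sign_def)
qed

text \<open>If the first letter is not selected, every selected letter jumps over it, which costs
  the sign of \<open>x\<close> against the total degree of the selected block.\<close>

lemma subset_sign_Suc:
  assumes "A \<subseteq> {..<length xs}"
  shows "subset_sign G (Suc ` A) (x # xs)
    = (-1) powi (deg G x * (\<Sum>y\<leftarrow>nths xs A. deg G y)) * subset_sign G A xs"
proof -
  have *: "{..<Suc i} - Suc ` A = insert 0 (Suc ` ({..<i} - A))" for i
    by (auto simp: lessThan_Suc_eq_insert_0)
  have "subset_sign G (Suc ` A) (x # xs)
    = (\<Prod>i\<in>A. (-1) powi (deg G (xs ! i) * deg G x)) * (subset_sign G A xs :: 'b)"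
    by (simp add: subset_sign_def prod.reindex * comp_def prod.distrib)
  also have "(\<Prod>i\<in>A. (-1) powi (deg G (xs ! i) * deg G x) :: 'b)
      = (-1) powi (deg G x * (\<Sum>y\<leftarrow>nths xs A. deg G y))"
    by (simp add: sum_list_nths[OF assms] minus_one_powi_sum sum_distrib_left mult.commute)
  finally show ?thesis .
qed

lemma subsets_lessThan_Suc:
  "{A. A \<subseteq> {..<Suc n} \<and> card A = r} =
    (if r = 0 then {} else (\<lambda>B. insert 0 (Suc ` B)) ` {B. B \<subseteq> {..<n} \<and> card B = r - 1}) \<union>
    (\<lambda>B. Suc ` B) ` {B. B \<subseteq> {..<n} \<and> card B = r}" (is "?L = ?R")
proof (intro equalityI subsetI)
  fix A assume "A \<in> ?L"
  then have A: "A \<subseteq> {..<Suc n}" "card A = r" by auto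
  define B where "B = {i. Suc i \<in> A}"
  have B: "B \<subseteq> {..<n}" using A(1) by (auto simp: B_def)
  then have fin: "finite B" by (rule finite_subset) simp
  have AB: "A = (if 0 \<in> A then insert 0 (Suc ` B) else Suc ` B)"
  proof -
    have "i \<in> A \<longleftrightarrow> i \<in> (if 0 \<in> A then insert 0 (Suc ` B) else Suc ` B)" for i
      by (cases i) (auto simp: B_def)
    then show ?thesis by blast
  qed
  show "A \<in> ?R"
  proof (cases "0 \<in> A")
    case True
    then have *: "A = insert 0 (Suc ` B)" using AB by simp
    have "card A = Suc (card B)" using fin by (subst *) (simp add: card_image)
    with A B show ?thesis by (subst *) auto
  next
    case False
    then have *: "A = Suc ` B" using AB by simp
    have "card A = card B" by (subst *) (simp add: card_image)
    with A B show ?thesis by (subst *) auto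
  qed
next
  fix A assume "A \<in> ?R"
  then show "A \<in> ?L"
    by (auto simp: card_image card_insert_if finite_subset[of _ "{..<n}"] split: if_splits)
qed

lemma sum_subsets_lessThan_Suc:
  fixes g :: "nat set \<Rightarrow> 'z::comm_monoid_add"
  shows "(\<Sum>A | A \<subseteq> {..<Suc n} \<and> card A = r. g A) =
    (if r = 0 then 0 else (\<Sum>B | B \<subseteq> {..<n} \<and> card B = r - 1. g (insert 0 (Suc ` B)))) +
    (\<Sum>B | B \<subseteq> {..<n} \<and> card B = r. g (Suc ` B))"
proof -
  have inj1: "inj_on (\<lambda>B. insert 0 (Suc ` B)) X" for X
  proof (rule inj_onI)
    fix B C assume "insert 0 (Suc ` B) = insert 0 (Suc ` C)"
    then have "i \<in> B \<longleftrightarrow> i \<in> C" for i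
      by (metis Suc_neq_Zero image_iff inj_Suc inj_image_mem_iff insert_iff)
    then show "B = C" by blast
  qed
  have inj2: "inj_on (\<lambda>B. Suc ` B) X" for X
    by (meson inj_Suc inj_image_eq_iff inj_onI)
  show ?thesis
  proof (cases "r = 0")
    case True
    then show ?thesis
      unfolding subsets_lessThan_Suc by (simp add: sum.reindex[OF inj2] comp_def)
  next
    case False
    then show ?thesis
      unfolding subsets_lessThan_Suc
      by (subst sum.union_disjoint)
        (auto simp: sum.reindex[OF inj1] sum.reindex[OF inj2] comp_def)
  qed
qed

text \<open>The first letter opens the first block at no cost, or it opens the second block after
  the whole first block has passed over it.\<close>

lemma unshuffle_sum_Cons:
  fixes \<Phi> :: "'v::ab_group_add list \<Rightarrow> 'v list \<Rightarrow> ('x \<Rightarrow>\<^sub>0 'k::field)"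
  assumes "Suc (length xs) = r + q"
  shows "unshuffle_sum G r q (x # xs) \<Phi> =
    (if r = 0 then 0 else unshuffle_sum G (r - 1) q xs (\<lambda>a b. \<Phi> (x # a) b)) +
    (if q = 0 then 0 else unshuffle_sum G r (q - 1) xs
      (\<lambda>a b. smul ((-1) powi (deg G x * (\<Sum>y\<leftarrow>a. deg G y))) (\<Phi> a (x # b))))"
proof -
  let ?n = "length xs"
  have nths: "nths (x # xs) (insert 0 (Suc ` A)) = x # nths xs A"
    "nths (x # xs) (- insert 0 (Suc ` A)) = nths xs (- A)"
    "nths (x # xs) (Suc ` A) = nths xs A" "nths (x # xs) (- Suc ` A) = x # nths xs (- A)" for A
    by (auto simp: nths_Cons intro!: arg_cong[of _ _ "nths xs"])
  let ?t = "\<lambda>A. smul (subset_sign G A (x # xs) :: 'k) (\<Phi> (nths (x # xs) A) (nths (x # xs) (- A)))"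
  have "unshuffle_sum G r q (x # xs) \<Phi> = (\<Sum>A | A \<subseteq> {..<Suc ?n} \<and> card A = r. ?t A)"
    using assms by (subst unshuffle_sum_conv_subsets) auto
  also have "\<dots> = (if r = 0 then 0 else (\<Sum>B | B \<subseteq> {..<?n} \<and> card B = r - 1. ?t (insert 0 (Suc ` B)))) +
    (\<Sum>B | B \<subseteq> {..<?n} \<and> card B = r. ?t (Suc ` B))"
    by (rule sum_subsets_lessThan_Suc)
  also have "(if r = 0 then 0 else (\<Sum>B | B \<subseteq> {..<?n} \<and> card B = r - 1. ?t (insert 0 (Suc ` B))))
    = (if r = 0 then 0 else unshuffle_sum G (r - 1) q xs (\<lambda>a b. \<Phi> (x # a) b))"
  proof (cases "r = 0")
    case False
    then have *: "length xs = r - 1 + q" using assms by simp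
    show ?thesis
      using False by (simp only: unshuffle_sum_conv_subsets[OF *] *[symmetric] nths
          subset_sign_insert_0 if_False)
  qed simp
  also have "(\<Sum>B | B \<subseteq> {..<?n} \<and> card B = r. ?t (Suc ` B)) =
    (if q = 0 then 0 else unshuffle_sum G r (q - 1) xs
      (\<lambda>a b. smul ((-1) powi (deg G x * (\<Sum>y\<leftarrow>a. deg G y))) (\<Phi> a (x # b))))"
  proof (cases "q = 0")
    case True
    \<comment> \<open>With an empty second block r exceeds the length of \<open>xs\<close>, so no
      choice can omit the first letter.\<close>
    then have "card B \<noteq> r" if "B \<subseteq> {..<?n}" for B
      using card_mono[OF _ that] assms by auto
    then have "{B. B \<subseteq> {..<?n} \<and> card B = r} = {}" by blast
    then show ?thesis using True by (simp only: sum.empty if_True simp_thms)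
  next
    case False
    then have *: "length xs = r + (q - 1)" using assms by simp
    show ?thesis
      unfolding unshuffle_sum_conv_subsets[OF *] nths using False
      by (auto simp: * subset_sign_Suc mult.commute intro!: sum.cong)
  qed
  finally show ?thesis .
qed

lemma unshuffle_sum_Nil: "unshuffle_sum G 0 0 [] \<Phi> = \<Phi> [] []"
proof -
  have "{A :: nat set. A \<subseteq> {..<0} \<and> card A = 0} = {{}}" by auto
  then show ?thesis
    by (subst unshuffle_sum_conv_subsets) (simp_all add: subset_sign_def)
qed

lemma unshuffle_sum_0: "unshuffle_sum G 0 (length xs) xs \<Phi> = \<Phi> [] xs"
  by (induction xs arbitrary: \<Phi>) (simp_all add: unshuffle_sum_Nil unshuffle_sum_Cons)

lemma lin_unshuffle_sum:
  "lin h \<Longrightarrow> h (unshuffle_sum G r q xs \<Phi>) = unshuffle_sum G r q xs (\<lambda>a b. h (\<Phi> a b))"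
  by (simp add: unshuffle_sum_def lin_simps)

lemma unshuffle_sum_smul:
  "unshuffle_sum G r q xs (\<lambda>a b. smul c (\<Phi> a b)) = smul c (unshuffle_sum G r q xs \<Phi>)"
  by (simp add: unshuffle_sum_def free.scale_sum_right mult.commute)

lemma koszul_sign_cong:
  assumes "\<sigma> permutes {..<n}" "\<And>i. i < n \<Longrightarrow> xs ! i = ys ! i"
  shows "koszul_sign G n \<sigma> xs = koszul_sign G n \<sigma> ys"
proof -
  have "\<sigma> i < n" if "i < n" for i using permutes_in_image[OF assms(1)] that by auto
  then show ?thesis
    unfolding koszul_sign_def using assms(2) by (intro prod.cong) auto
qed

text \<open>Here m = k - 1 is the position, counted from 0, of the last argument of
  \<open>f\<close>. Only the letters before it are unshuffled, and the extra sign is that of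
  \<open>f\<close> passing the block \<open>a\<close>.\<close>

lemma coder_word_conv:
  fixes f :: "'v::ab_group_add list \<Rightarrow> 'v"
  shows "(coder_word G (Suc i) p f xs :: 'v list \<Rightarrow>\<^sub>0 'k::field) =
    (\<Sum>m = i..<length xs. unshuffle_sum G (m - i) i (take m xs)
      (\<lambda>a b. smul ((-1) powi (p * (\<Sum>y\<leftarrow>a. deg G y)))
        (gen (a @ f (b @ [xs ! m]) # drop (Suc m) xs))))"
proof -
  let ?t = "\<lambda>k \<sigma>. Poly_Mapping.single
         (map (\<lambda>j. xs ! \<sigma> j) [0..<k - Suc i]
            @ f (map (\<lambda>j. xs ! \<sigma> j) [k - Suc i..<k - 1] @ [xs ! (k - 1)])
            # drop k xs)
         (koszul_sign G (k - 1) \<sigma> xs * (-1) powi (p * (\<Sum>j<k - Suc i. deg G (xs ! \<sigma> j))) :: 'k)"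
  have "coder_word G (Suc i) p f xs = (\<Sum>k = Suc i..length xs. \<Sum>\<sigma>\<in>unshuffles (k - Suc i) i. ?t k \<sigma>)"
    by (simp add: coder_word_def)
  also have "\<dots> = (\<Sum>m = i..<length xs. \<Sum>\<sigma>\<in>unshuffles (Suc m - Suc i) i. ?t (Suc m) \<sigma>)"
    unfolding atLeastLessThanSuc_atLeastAtMost[symmetric] by (rule sum.shift_bounds_Suc_ivl)
  also have "\<dots> = (\<Sum>m = i..<length xs. unshuffle_sum G (m - i) i (take m xs)
      (\<lambda>a b. smul ((-1) powi (p * (\<Sum>y\<leftarrow>a. deg G y)))
        (gen (a @ f (b @ [xs ! m]) # drop (Suc m) xs))))"
    unfolding unshuffle_sum_def diff_Suc_Suc[of _ i]
  proof (intro sum.cong refl)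
    fix m \<sigma> assume m: "m \<in> {i..<length xs}" and \<sigma>: "\<sigma> \<in> unshuffles (m - i) i"
    then have perm: "\<sigma> permutes {..<m}" by (simp add: unshuffles_def)
    have less: "\<sigma> j < m" if "j < m" for j using permutes_in_image[OF perm] that by auto
    have 1: "map (\<lambda>j. take m xs ! \<sigma> j) [0..<m - i] = map (\<lambda>j. xs ! \<sigma> j) [0..<m - i]"
      "map (\<lambda>j. take m xs ! \<sigma> j) [m - i..<m] = map (\<lambda>j. xs ! \<sigma> j) [m - i..<m]"
      using less m by auto
    have 2: "koszul_sign G m \<sigma> (take m xs) = (koszul_sign G m \<sigma> xs :: 'k)"
      by (rule koszul_sign_cong[OF perm]) simp
    have 3: "(\<Sum>j<m - i. deg G (xs ! \<sigma> j)) = (\<Sum>y\<leftarrow>map (\<lambda>j. xs ! \<sigma> j) [0..<m - i]. deg G y)"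
      by (simp add: comp_def interv_sum_list_conv_sum_set_nat atLeast0LessThan)
    show "Poly_Mapping.single
         (map (\<lambda>j. xs ! \<sigma> j) [0..<m - i]
            @ f (map (\<lambda>j. xs ! \<sigma> j) [m - i..<Suc m - 1] @ [xs ! (Suc m - 1)])
            # drop (Suc m) xs)
         (koszul_sign G (Suc m - 1) \<sigma> xs * (-1) powi (p * (\<Sum>j<m - i. deg G (xs ! \<sigma> j))) :: 'k) = smul (koszul_sign G (m - i + i) \<sigma> (take m xs))
       (smul ((-1) powi (p * (\<Sum>y\<leftarrow>map (\<lambda>j. take m xs ! \<sigma> j) [0..<m - i]. deg G y)))
         (gen (map (\<lambda>j. take m xs ! \<sigma> j) [0..<m - i] @
           f (map (\<lambda>j. take m xs ! \<sigma> j) [m - i..<m - i + i] @ [xs ! m]) # drop (Suc m) xs)))"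
      using m by (simp only: 1 2 3 le_add_diff_inverse2 atLeastLessThan_iff diff_Suc_1)
        (simp only: single_conv_gen[of _ "koszul_sign _ _ _ _ * _"] free.scale_scale)
  qed
  finally show ?thesis .
qed

lemma coder_word_Nil [simp]: "coder_word G (Suc i) p f [] = 0"
  by (simp add: coder_word_conv)

text \<open>Either \<open>x\<close> stays in front and \<open>f\<close> passes it, or
  \<open>x\<close> becomes the first argument of \<open>f\<close>. In the second case the letters
  left in front of \<open>f\<close> have jumped over \<open>x\<close> as well, which is why the
  remaining map counts with degree p + |x|.\<close>

lemma coder_word_Cons:
  fixes f :: "'v::ab_group_add list \<Rightarrow> 'v"
  shows "(coder_word G (Suc i) p f (x # xs) :: 'v list \<Rightarrow>\<^sub>0 'k::field) =
    (if i = 0 then gen (f [x] # xs) else coder_word G i (p + deg G x) (\<lambda>ys. f (x # ys)) xs) +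
    smul ((-1) powi (p * deg G x)) (cons x (coder_word G (Suc i) p f xs))"
proof -
  let ?\<Phi> = "\<lambda>xs m a b. smul ((-1) powi (p * (\<Sum>y\<leftarrow>a. deg G y)))
        (gen (a @ f (b @ [xs ! m]) # drop (Suc m) xs) :: 'v list \<Rightarrow>\<^sub>0 'k)"
  let ?t = "\<lambda>m. unshuffle_sum G (m - i) i (take m (x # xs)) (?\<Phi> (x # xs) m)"
  let ?c = "(-1) powi (p * deg G x) :: 'k"
  have \<Phi>: "?\<Phi> (x # xs) (Suc m) (x # a) b = smul ?c (cons x (?\<Phi> xs m a b))" for m a b
    by (simp add: lin_smul[OF lin_cons] distrib_left minus_one_powi_add)
  have L: "coder_word G (Suc i) p f (x # xs) = (\<Sum>m = i..<Suc (length xs). ?t m)"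
    by (simp add: coder_word_conv)
  have R: "smul ?c (cons x (coder_word G (Suc i) p f xs)) =
    (\<Sum>m = i..<length xs. unshuffle_sum G (m - i) i (take m xs) (\<lambda>a b. ?\<Phi> (x # xs) (Suc m) (x # a) b))"
    unfolding coder_word_conv \<Phi>
    by (simp only: unshuffle_sum_smul lin_sum[OF lin_cons] free.scale_sum_right
        lin_unshuffle_sum[OF lin_cons])
  show ?thesis
  proof (cases i)
    case 0
    have "coder_word G (Suc i) p f (x # xs) = ?t 0 + (\<Sum>m = 0..<length xs. ?t (Suc m))"
      unfolding L using 0 by (simp only: sum.atLeast0_lessThan_Suc_shift comp_def)
    also have "?t 0 = gen (f [x] # xs)"
      using 0 by (simp add: unshuffle_sum_Nil)
    also have "(\<Sum>m = 0..<length xs. ?t (Suc m)) = smul ?c (cons x (coder_word G (Suc i) p f xs))"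
      unfolding 0 unfolding R[unfolded 0]
    proof (intro sum.cong refl)
      fix m assume "m \<in> {0..<length xs}"
      then show "unshuffle_sum G (Suc m - 0) 0 (take (Suc m) (x # xs)) (?\<Phi> (x # xs) (Suc m)) =
        unshuffle_sum G (m - 0) 0 (take m xs) (\<lambda>a b. ?\<Phi> (x # xs) (Suc m) (x # a) b)"
        unfolding take_Suc_Cons by (subst unshuffle_sum_Cons) simp_all
    qed
    finally show ?thesis using 0 by simp
  next
    case (Suc j)
    let ?A = "\<lambda>m. unshuffle_sum G (m - i) i (take m xs) (\<lambda>a b. ?\<Phi> (x # xs) (Suc m) (x # a) b)"
    let ?B = "\<lambda>m. unshuffle_sum G (m - j) j (take m xs)
      (\<lambda>a b. smul ((-1) powi ((p + deg G x) * (\<Sum>y\<leftarrow>a. deg G y)))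
        (gen (a @ f (x # b @ [xs ! m]) # drop (Suc m) xs) :: 'v list \<Rightarrow>\<^sub>0 'k))"
    \<comment> \<open>For m = j all letters up to the last argument are consumed by
      \<open>f\<close>, so \<open>x\<close> cannot stay in front and the first summand is
      absent.\<close>
    have t: "?t (Suc m) = (if m = j then 0 else ?A m) + ?B m" if "m \<in> {j..<length xs}" for m
    proof -
      have *: "Suc (length (take m xs)) = (m - j) + Suc j" using that by simp
      have "?t (Suc m) = unshuffle_sum G (m - j) (Suc j) (x # take m xs) (?\<Phi> (x # xs) (Suc m))"
        by (simp add: Suc)
      also have "\<dots> = (if m = j then 0 else ?A m) + ?B m"
        unfolding unshuffle_sum_Cons[OF *] using that
        by (auto simp: Suc minus_one_powi_add distrib_right mult.commute)
      finally show ?thesis .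
    qed
    have "coder_word G (Suc i) p f (x # xs) = (\<Sum>m = j..<length xs. ?t (Suc m))"
      unfolding L unfolding Suc by (rule sum.shift_bounds_Suc_ivl)
    also have "\<dots> = (\<Sum>m = j..<length xs. if m = j then 0 else ?A m) + (\<Sum>m = j..<length xs. ?B m)"
      by (simp only: t sum.distrib[symmetric] cong: sum.cong)
    also have "(\<Sum>m = j..<length xs. if m = j then 0 else ?A m) = (\<Sum>m = i..<length xs. ?A m)"
      by (rule sum.mono_neutral_cong_right) (auto simp: Suc)
    also have "(\<Sum>m = j..<length xs. ?B m) = coder_word G i (p + deg G x) (\<lambda>ys. f (x # ys)) xs"
      unfolding Suc coder_word_conv by simp
    finally show ?thesis unfolding R using Suc by (simp add: add.commute)
  qed
qed

lemma comult_word_conv: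
  "(comult_word G (ys @ [l]) :: _ \<Rightarrow>\<^sub>0 'k::field) = (\<Sum>i = 1..length ys.
     unshuffle_sum G i (length ys - i) ys (\<lambda>a b. gen (a, b @ [l])))"
proof -
  have *: "koszul_sign G n \<sigma> (ys @ [l]) = (koszul_sign G n \<sigma> ys :: 'k) \<and>
      map (\<lambda>j. (ys @ [l]) ! \<sigma> j) [0..<i] = map (\<lambda>j. ys ! \<sigma> j) [0..<i] \<and>
      map (\<lambda>j. (ys @ [l]) ! \<sigma> j) [i..<n] = map (\<lambda>j. ys ! \<sigma> j) [i..<n]"
    if "n = length ys" "i \<le> n" "\<sigma> \<in> unshuffles i (n - i)" for n i \<sigma>
  proof -
    have perm: "\<sigma> permutes {..<n}" using that by (simp add: unshuffles_def)
    have less: "\<sigma> j < n" if "j < n" for j using permutes_in_image[OF perm] that by auto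
    have "koszul_sign G n \<sigma> (ys @ [l]) = (koszul_sign G n \<sigma> ys :: 'k)"
      by (rule koszul_sign_cong[OF perm]) (use that in \<open>simp add: nth_append\<close>)
    then show ?thesis
      using less that by (simp add: nth_append)
  qed
  have len: "length (ys @ [l]) - 1 = length ys" by simp
  show ?thesis
    unfolding comult_word_def unshuffle_sum_def Let_def len
  proof (intro sum.cong refl)
    fix i \<sigma> assume i: "i \<in> {1..length ys}" and \<sigma>: "\<sigma> \<in> unshuffles i (length ys - i)"
    then have "i \<le> length ys" by simp
    note 1 = *[OF refl this \<sigma>]
    have 2: "i + (length ys - i) = length ys" using i by simp
    show "Poly_Mapping.single (map (\<lambda>j. (ys @ [l]) ! \<sigma> j) [0..<i],
           map (\<lambda>j. (ys @ [l]) ! \<sigma> j) [i..<length ys] @ [(ys @ [l]) ! length ys])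
          (koszul_sign G (length ys) \<sigma> (ys @ [l]) :: 'k) =
       smul (koszul_sign G (i + (length ys - i)) \<sigma> ys)
         (gen (map (\<lambda>j. ys ! \<sigma> j) [0..<i], map (\<lambda>j. ys ! \<sigma> j) [i..<i + (length ys - i)] @ [l]))"
      unfolding 2 nth_append_length
      by (simp only: 1) (simp only: single_conv_gen[of _ "koszul_sign _ _ _ _"])
  qed
qed

lemma comult_word_singleton [simp]: "comult_word G [x] = 0"
  using comult_word_conv[of G "[]" x] by simp

lemma comult_word_Nil [simp]: "comult_word G [] = 0"
  by (simp add: comult_word_def)

text \<open>The letter \<open>x\<close> joins the left factor, or it joins the right factor after
  being passed by the left one. The separate first term arises from an empty left factor, which the
  coproduct of \<open>xs\<close> omits but which \<open>x\<close> alone makes nonempty.\<close>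

lemma comult_word_Cons:
  assumes "xs \<noteq> []"
  shows "(comult_word G (x # xs) :: _ \<Rightarrow>\<^sub>0 'k::field) = gen ([x], xs) +
    linear_extension (\<lambda>(a, b). gen (x # a, b) +
      smul ((-1) powi (deg G x * (\<Sum>y\<leftarrow>a. deg G y))) (gen (a, x # b))) (comult_word G xs)"
proof -
  obtain ys l where xs: "xs = ys @ [l]" using assms by (cases xs rule: rev_cases) auto
  let ?n = "length ys"
  let ?\<Phi> = "\<lambda>a b. gen (a, b @ [l]) :: _ \<Rightarrow>\<^sub>0 'k"
  let ?A = "\<lambda>i. unshuffle_sum G i (?n - i) ys (\<lambda>a b. ?\<Phi> (x # a) b)"
  let ?B = "\<lambda>i. unshuffle_sum G i (?n - i) ys
      (\<lambda>a b. smul ((-1) powi (deg G x * (\<Sum>y\<leftarrow>a. deg G y))) (?\<Phi> a (x # b)))"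
  have "comult_word G (x # xs) = (\<Sum>i = 1..Suc ?n. unshuffle_sum G i (Suc ?n - i) (x # ys) ?\<Phi>)"
    using comult_word_conv[of G "x # ys" l] by (simp add: xs)
  also have "\<dots> = (\<Sum>i = 0..?n. unshuffle_sum G (Suc i) (?n - i) (x # ys) ?\<Phi>)"
    by (simp only: One_nat_def sum.shift_bounds_cl_Suc_ivl diff_Suc_Suc)
  also have "\<dots> = (\<Sum>i = 0..?n. ?A i + (if i = ?n then 0 else ?B (Suc i)))"
    by (intro sum.cong refl, subst unshuffle_sum_Cons) (auto simp: Suc_diff_Suc)
  also have "\<dots> = (\<Sum>i = 0..?n. ?A i) + (\<Sum>i = 0..?n. if i = ?n then 0 else ?B (Suc i))"
    by (rule sum.distrib)
  also have "(\<Sum>i = 0..?n. if i = ?n then 0 else ?B (Suc i)) = (\<Sum>i = 0..<?n. ?B (Suc i))"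
    by (rule sum.mono_neutral_cong_right) auto
  also have "\<dots> = (\<Sum>i = 1..?n. ?B i)"
    unfolding atLeastLessThanSuc_atLeastAtMost[symmetric] One_nat_def
    by (rule sum.shift_bounds_Suc_ivl[symmetric])
  also have "(\<Sum>i = 0..?n. ?A i) = ?A 0 + (\<Sum>i = 1..?n. ?A i)"
    by (simp only: sum.atLeast_Suc_atMost[of 0] One_nat_def)
  also have "?A 0 = gen ([x], xs)"
    by (simp add: unshuffle_sum_0 xs)
  finally have 1: "comult_word G (x # xs) = gen ([x], xs) + (\<Sum>i = 1..?n. ?A i) + (\<Sum>i = 1..?n. ?B i)" .
  have 2: "(\<Sum>i = 1..?n. ?A i) + (\<Sum>i = 1..?n. ?B i) =
    linear_extension (\<lambda>(a, b). gen (x # a, b) +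
      smul ((-1) powi (deg G x * (\<Sum>y\<leftarrow>a. deg G y))) (gen (a, x # b))) (comult_word G xs)"
    unfolding xs comult_word_conv
    by (simp add: lin_simps[OF lin_linear_extension] lin_unshuffle_sum[OF lin_linear_extension]
        sum.distrib[symmetric])
      (simp add: unshuffle_sum_def sum.distrib[symmetric] free.scale_right_distrib)
  show ?thesis unfolding 1 by (simp only: add.assoc 2)
qed

section \<open>Recursion along the first letter\<close>

lemma sum_set_Cons:
  fixes \<phi> :: "'a list \<Rightarrow> 'z::comm_monoid_add"
  shows "(\<Sum>ys\<in>set_Cons A XS. \<phi> ys) = (\<Sum>y\<in>A. \<Sum>ys\<in>XS. \<phi> (y # ys))"
proof -
  have "set_Cons A XS = (\<lambda>(y, ys). y # ys) ` (A \<times> XS)"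
    by (auto simp: set_Cons_def)
  then have "(\<Sum>ys\<in>set_Cons A XS. \<phi> ys) = (\<Sum>(y, ys)\<in>A \<times> XS. \<phi> (y # ys))"
    by (simp add: sum.reindex inj_on_def case_prod_unfold)
  then show ?thesis by (simp add: sum.cartesian_product)
qed

lemma hextend_Nil [simp]: "hextend G \<phi> [] = \<phi> []"
  by (simp add: hextend_def)

lemma hextend_Cons:
  "hextend G \<phi> (x # xs) = (\<Sum>y\<in>hcomponents G x. hextend G (\<lambda>ys. \<phi> (y # ys)) xs)"
  by (simp add: hextend_def sum_set_Cons)

lemma lin_hextend: "lin h \<Longrightarrow> h (hextend G \<phi> xs) = hextend G (\<lambda>ys. h (\<phi> ys)) xs"
  by (simp add: hextend_def lin_sum)

abbreviation word_op ::
  "(int \<Rightarrow> 'v::ab_group_add set) \<Rightarrow> ('v list \<Rightarrow> ('y \<Rightarrow>\<^sub>0 'k::field)) \<Rightarrow> ('v list \<Rightarrow>\<^sub>0 'k) \<Rightarrow> ('y \<Rightarrow>\<^sub>0 'k)" where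
  "word_op G \<phi> \<equiv> linear_extension (hextend G \<phi>)"

lemma lin_word_op: "lin h \<Longrightarrow> h (word_op G \<phi> z) = word_op G (\<lambda>ys. h (\<phi> ys)) z"
  by (rule lin_eqI[OF lin_compose[OF _ lin_linear_extension] lin_linear_extension])
    (simp_all add: lin_hextend)

lemma word_op_add: "word_op G (\<lambda>ys. \<phi> ys + \<psi> ys) z = word_op G \<phi> z + word_op G \<psi> z"
  by (rule lin_eqI[OF lin_linear_extension lin_plus[OF lin_linear_extension lin_linear_extension]])
    (simp add: hextend_def sum.distrib)

lemma word_op_smul: "word_op G (\<lambda>ys. smul c (\<phi> ys)) z = smul c (word_op G \<phi> z)"
  by (rule lin_eqI[OF lin_linear_extension lin_smul_op[OF lin_linear_extension]])
    (simp add: hextend_def free.scale_sum_right)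

lemma word_op_cons_sum:
  "word_op G \<phi> (cons x z) = (\<Sum>y\<in>hcomponents G x. word_op G (\<lambda>ys. \<phi> (y # ys)) z)"
  by (rule lin_eqI[OF lin_compose[OF lin_linear_extension lin_cons]
        lin_sum_op[OF lin_linear_extension]])
    (simp add: hextend_Cons)

text \<open>\<open>w \<mapsto> (-1)\<^bsup>q|w|\<^esup> w\<close>. Even for \<open>q = 0\<close> this is the identity only modulo the relations of
  multilinearity, as it splits each letter into homogeneous components.\<close>

definition parity :: "(int \<Rightarrow> 'v::ab_group_add set) \<Rightarrow> int \<Rightarrow> ('v list \<Rightarrow>\<^sub>0 'k::field) \<Rightarrow> ('v list \<Rightarrow>\<^sub>0 'k)" where
  "parity G q = word_op G (\<lambda>ys. smul ((-1) powi (q * (\<Sum>y\<leftarrow>ys. deg G y))) (gen ys))"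

text \<open>The coproduct of a single letter \<open>x\<close> lacks the term \<open>x \<otimes> ()\<close>.\<close>

definition drop_Nil :: "('v list \<Rightarrow>\<^sub>0 'k::field) \<Rightarrow> ('v list \<Rightarrow>\<^sub>0 'k)" where
  "drop_Nil = linear_extension (\<lambda>w. if w = [] then 0 else gen w)"

text \<open>Multiplication of a tensor by the letter \<open>x\<close> of degree \<open>m\<close> for the shuffle product.\<close>

definition cons2 ::
  "(int \<Rightarrow> 'v::ab_group_add set) \<Rightarrow> int \<Rightarrow> 'v \<Rightarrow> ('v list \<times> 'v list \<Rightarrow>\<^sub>0 'k::field) \<Rightarrow> ('v list \<times> 'v list \<Rightarrow>\<^sub>0 'k)" where
  "cons2 G m x = linear_extension (\<lambda>(a, b). gen (x # a, b) + tensor (parity G m (gen a)) (gen (x # b)))"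

lemma lin_parity: "lin (parity G q)" and lin_drop_Nil: "lin drop_Nil" and lin_cons2: "lin (cons2 G m x)"
  and lin_coder: "lin (coder G i p f)" and lin_comult: "lin (comult G)"
  and lin_op_tensor: "lin (op_tensor G q g h)"
  by (simp_all add: parity_def drop_Nil_def cons2_def coder_def comult_def op_tensor_def lin_linear_extension)

lemma cons2_tensor:
  "cons2 G m x (tensor u v) = tensor (cons x u) v + tensor (parity G m u) (cons x v)"
proof -
  have "cons2 G m x (tensor (gen a) v) = tensor (cons x (gen a)) v + tensor (parity G m (gen a)) (cons x v)" for a
  proof (rule lin_eqI[of _ _ v])
    show "lin (\<lambda>v. cons2 G m x (tensor (gen a) v))"
      by (rule lin_compose[OF lin_cons2 lin_tensor_right])
    show "lin (\<lambda>v. tensor (cons x (gen a)) v + tensor (parity G m (gen a)) (cons x v))"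
      by (intro lin_plus lin_tensor_right lin_compose[OF lin_tensor_right lin_cons])
  qed (simp add: cons2_def)
  then show ?thesis
    by (intro lin_eqI[of _ _ u, OF lin_compose[OF lin_cons2 lin_tensor_left]
          lin_plus[OF lin_compose[OF lin_tensor_left lin_cons] lin_compose[OF lin_tensor_left lin_parity]]])
qed

text \<open>The Koszul sign becomes the linear operator \<open>parity\<close> on the left argument,
  so \<open>u\<close> and \<open>v\<close> may be arbitrary instead of homogeneous words.\<close>

lemma op_tensor_tensor:
  assumes "lin g" "lin h"
  shows "op_tensor G q g h (tensor u v) = tensor (g (parity G q u)) (h v)"
proof -
  have "op_tensor G q g h (tensor (gen a) (gen b)) = tensor (g (parity G q (gen a))) (h (gen b))" for a b
    by (simp add: op_tensor_def parity_def lin_hextend[OF assms(1)] lin_smul[OF assms(1)]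
        lin_hextend[OF lin_tensor_left] lin_smul[OF lin_tensor_left])
  then have "op_tensor G q g h (tensor (gen a) v) = tensor (g (parity G q (gen a))) (h v)" for a
    by (rule lin_eqI[of _ _ v, OF lin_compose[OF lin_op_tensor lin_tensor_right]
          lin_compose[OF lin_tensor_right assms(2)]])
  then show ?thesis
    by (rule lin_eqI[of _ _ u, OF lin_compose[OF lin_op_tensor lin_tensor_left]
          lin_compose[OF lin_tensor_left lin_compose[OF assms(1) lin_parity]]])
qed

lemma subspace_keys: "free.subspace {z :: 'x \<Rightarrow>\<^sub>0 'k::field. Poly_Mapping.keys z \<subseteq> K}"
proof (rule free.subspaceI)
  fix x y :: "'x \<Rightarrow>\<^sub>0 'k" and c
  assume x: "x \<in> {z. Poly_Mapping.keys z \<subseteq> K}"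
  show "smul c x \<in> {z. Poly_Mapping.keys z \<subseteq> K}"
    using x by (auto simp: in_keys_iff)
  assume "y \<in> {z. Poly_Mapping.keys z \<subseteq> K}"
  with x show "x + y \<in> {z. Poly_Mapping.keys z \<subseteq> K}"
    using Poly_Mapping.keys_add[of x y] by auto
qed simp

text \<open>The factors are made of letters of \<open>xs\<close> and hence inherit homogeneity,
  which is what lets \<open>parity\<close> act on the left factor by a plain sign.\<close>

lemma keys_comult_word:
  "Poly_Mapping.keys (comult_word G xs :: _ \<Rightarrow>\<^sub>0 'k::field)
    \<subseteq> {(a, b). a \<noteq> [] \<and> b \<noteq> [] \<and> set a \<subseteq> set xs \<and> set b \<subseteq> set xs}"
proof (induction xs)
  case (Cons x xs)
  let ?K = "\<lambda>xs. {(a, b). a \<noteq> [] \<and> b \<noteq> [] \<and> set a \<subseteq> set xs \<and> set b \<subseteq> set xs}"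
  let ?S = "{z :: _ \<Rightarrow>\<^sub>0 'k. Poly_Mapping.keys z \<subseteq> ?K (x # xs)}"
  show ?case
  proof (cases "xs = []")
    case False
    have "linear_extension (\<lambda>(a, b). gen (x # a, b) +
      smul ((-1) powi (deg G x * (\<Sum>y\<leftarrow>a. deg G y))) (gen (a, x # b))) (comult_word G xs) \<in> ?S"
    proof (rule lin_mem_keys[OF lin_linear_extension subspace_keys])
      fix t assume "t \<in> Poly_Mapping.keys (comult_word G xs :: _ \<Rightarrow>\<^sub>0 'k)"
      moreover obtain a b where t: "t = (a, b)" by (cases t)
      ultimately have "(a, b) \<in> ?K xs" using Cons.IH by blast
      then have "gen (x # a, b) \<in> ?S" "gen (a, x # b) \<in> ?S" by auto
      then show "linear_extension (\<lambda>(a, b). gen (x # a, b) +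
          smul ((-1) powi (deg G x * (\<Sum>y\<leftarrow>a. deg G y))) (gen (a, x # b))) (gen t) \<in> ?S"
        unfolding t linear_extension_gen prod.case
        by (intro free.subspace_add[OF subspace_keys] free.subspace_scale[OF subspace_keys])
    qed
    moreover have "gen ([x], xs) \<in> ?S" using False by auto
    ultimately show ?thesis
      unfolding comult_word_Cons[OF False]
      using free.subspace_add[OF subspace_keys] by blast
  qed simp
qed simp

section \<open>Homogeneous components and recursions for homogeneous letters\<close>

context graded_vector_space
begin

text \<open>In contrast to the set \<open>hcomponents\<close>, these projections are linear in the
  vector.\<close>

definition component :: "int \<Rightarrow> 'v \<Rightarrow> 'v" where
  "component n x = (THE c. homogeneous_decomposition G x c) n"

lemma homogeneous_decomposition_component: "homogeneous_decomposition G x (\<lambda>n. component n x)"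
  unfolding component_def by (rule theI'[OF direct_sum])

lemma component_eqI: "homogeneous_decomposition G x c \<Longrightarrow> component n x = c n"
  unfolding component_def using the1_equality[OF direct_sum, of x c] by simp

lemma component_in: "component n x \<in> G n"
  and finite_components: "finite {n. component n x \<noteq> 0}"
  and sum_components: "(\<Sum>n | component n x \<noteq> 0. component n x) = x"
  using homogeneous_decomposition_component[of x] by (auto simp: homogeneous_decomposition_def)

lemma sum_components_superset:
  assumes "finite N" "{n. component n x \<noteq> 0} \<subseteq> N"
  shows "(\<Sum>n\<in>N. component n x) = x"
  using sum.mono_neutral_left[OF assms, of "\<lambda>n. component n x"] sum_components[of x] by simp

lemma homogeneous_decompositionI:
  assumes "\<And>n. c n \<in> G n" "finite N" "\<And>n. n \<notin> N \<Longrightarrow> c n = 0" "(\<Sum>n\<in>N. c n) = x"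
  shows "homogeneous_decomposition G x c"
proof -
  have *: "{n. c n \<noteq> 0} \<subseteq> N" using assms(3) by blast
  moreover have "(\<Sum>n | c n \<noteq> 0. c n) = (\<Sum>n\<in>N. c n)"
    by (rule sum.mono_neutral_left) (use assms(2) * in auto)
  ultimately show ?thesis
    using assms finite_subset[OF *] by (simp add: homogeneous_decomposition_def)
qed

lemma component_add: "component n (x + y) = component n x + component n y"
proof (rule component_eqI[where c = "\<lambda>n. component n x + component n y"],
    rule homogeneous_decompositionI)
  let ?N = "{n. component n x \<noteq> 0} \<union> {n. component n y \<noteq> 0}"
  show "finite ?N" by (simp add: finite_components)
  show "(\<Sum>n\<in>?N. component n x + component n y) = x + y"
    by (simp add: sum.distrib sum_components_superset finite_components)
qed (auto intro: subspace_add subspace_G component_in)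

lemma component_scale: "component n (scale c x) = scale c (component n x)"
proof (rule component_eqI[where c = "\<lambda>n. scale c (component n x)"], rule homogeneous_decompositionI)
  let ?N = "{n. component n x \<noteq> 0}"
  show "finite ?N" by (simp add: finite_components)
  show "(\<Sum>n\<in>?N. scale c (component n x)) = scale c x"
    by (simp add: scale_sum_right[symmetric] sum_components)
qed (auto intro: subspace_scale subspace_G component_in)

lemma component_homogeneous:
  assumes "x \<in> G m"
  shows "component n x = (if n = m then x else 0)"
  by (rule component_eqI[where c = "\<lambda>n. if n = m then x else 0"],
      rule homogeneous_decompositionI[where N = "{m}"])
    (auto intro: assms subspace_0 subspace_G)

lemma G_unique: "x \<in> G m \<Longrightarrow> x \<in> G n \<Longrightarrow> x \<noteq> 0 \<Longrightarrow> m = n"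
  using component_homogeneous[of x m n] component_homogeneous[of x n n] by (auto split: if_splits)

lemma deg_eq: "x \<in> G m \<Longrightarrow> x \<noteq> 0 \<Longrightarrow> deg G x = m"
  unfolding deg_def by (rule the_equality) (auto dest: G_unique)

lemma hcomponents_conv: "hcomponents G x = (\<lambda>n. component n x) ` {n. component n x \<noteq> 0}"
  by (auto simp: hcomponents_def component_def)

lemma hcomponents_D: "y \<in> hcomponents G x \<Longrightarrow> y \<noteq> 0 \<and> (\<exists>n. y \<in> G n)"
  using component_in by (auto simp: hcomponents_conv)

lemma hcomponents_homogeneous: "x \<in> G m \<Longrightarrow> hcomponents G x = (if x = 0 then {} else {x})"
  by (auto simp: hcomponents_conv component_homogeneous)

text \<open>Nonzero components of different degrees are different, so the sum over a set of vectors
  is a sum over degrees. The freedom in N allows one index set for x, y and their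
  combinations.\<close>

lemma sum_hcomponents:
  assumes "finite N" "{n. component n x \<noteq> 0} \<subseteq> N"
  shows "(\<Sum>y\<in>hcomponents G x. \<phi> y) = (\<Sum>n\<in>N. if component n x = 0 then 0 else \<phi> (component n x))"
proof -
  have "inj_on (\<lambda>n. component n x) {n. component n x \<noteq> 0}"
  proof (rule inj_onI)
    fix m n
    assume "m \<in> {n. component n x \<noteq> 0}" "component m x = component n x"
    then show "m = n"
      using G_unique[of "component m x" m n] component_in[of m x] component_in[of n x] by simp
  qed
  then have "(\<Sum>y\<in>hcomponents G x. \<phi> y) = (\<Sum>n | component n x \<noteq> 0. \<phi> (component n x))"
    by (simp add: hcomponents_conv sum.reindex)
  also have "\<dots> = (\<Sum>n\<in>N. if component n x = 0 then 0 else \<phi> (component n x))"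
    by (rule sum.mono_neutral_cong_left) (use assms in auto)
  finally show ?thesis .
qed

abbreviation homs :: "'v list \<Rightarrow> bool" where
  "homs ys \<equiv> \<forall>y\<in>set ys. y \<noteq> 0 \<and> (\<exists>n. y \<in> G n)"

lemma homs_listset: "ys \<in> listset (map (hcomponents G) xs) \<Longrightarrow> homs ys \<and> length ys = length xs"
proof (induction xs arbitrary: ys)
  case (Cons x xs)
  then obtain y zs where "ys = y # zs" "y \<in> hcomponents G x" "zs \<in> listset (map (hcomponents G) xs)"
    by (auto simp: set_Cons_def)
  with Cons.IH[of zs] hcomponents_D[of y x] show ?case by auto
qed simp

lemma hextend_cong:
  assumes "\<And>ys. homs ys \<Longrightarrow> length ys = length xs \<Longrightarrow> \<phi> ys = \<psi> ys"
  shows "hextend G \<phi> xs = hextend G \<psi> xs"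
  unfolding hextend_def using homs_listset by (intro sum.cong refl assms) auto

lemma word_op_cong:
  assumes "\<And>ys. homs ys \<Longrightarrow> \<phi> ys = \<psi> ys"
  shows "word_op G \<phi> z = word_op G \<psi> z"
proof -
  have "hextend G \<phi> = hextend G \<psi>"
    by (rule ext, rule hextend_cong) (rule assms)
  then show ?thesis by simp
qed

lemma hextend_homs: "homs xs \<Longrightarrow> hextend G \<phi> xs = \<phi> xs"
proof (induction xs arbitrary: \<phi>)
  case (Cons x xs)
  then have "hcomponents G x = {x}" using hcomponents_homogeneous by fastforce
  with Cons show ?case by (simp add: hextend_Cons)
qed simp

lemma word_op_cons:
  assumes "y \<in> G m" "y \<noteq> 0"
  shows "word_op G \<phi> (cons y z) = word_op G (\<lambda>ys. \<phi> (y # ys)) z"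
  by (simp add: word_op_cons_sum hcomponents_homogeneous[OF assms(1)] assms(2))

lemma word_op_decompose:
  "word_op G \<phi> (cons x z) = (\<Sum>y\<in>hcomponents G x. word_op G \<phi> (cons y z))"
  unfolding word_op_cons_sum[of _ _ x]
proof (intro sum.cong refl)
  fix y assume "y \<in> hcomponents G x"
  then obtain m where "y \<in> G m" "y \<noteq> 0" using hcomponents_D by blast
  then show "word_op G (\<lambda>ys. \<phi> (y # ys)) z = word_op G \<phi> (cons y z)"
    by (rule word_op_cons[symmetric])
qed

lemma parity_gen_homs:
  "homs a \<Longrightarrow> parity G q (gen a) = smul ((-1) powi (q * (\<Sum>y\<leftarrow>a. deg G y))) (gen a)"
  by (simp add: parity_def hextend_homs)

lemma parity_cons:
  assumes "y \<in> G m" "y \<noteq> 0"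
  shows "parity G q (cons y z) = smul ((-1) powi (q * m)) (cons y (parity G q z))"
  by (simp add: parity_def word_op_cons[OF assms] lin_word_op[OF lin_cons] lin_smul[OF lin_cons]
      deg_eq[OF assms] distrib_left minus_one_powi_add flip: word_op_smul)

text \<open>For a unary \<open>f\<close> the tail is not changed when \<open>f\<close> takes the
  first letter, but its letters are still split into components; hence \<open>parity G 0\<close>
  instead of \<open>z\<close>.\<close>

lemma coder_cons:
  assumes "y \<in> G m" "y \<noteq> 0"
  shows "coder G (Suc i) p f (cons y z) =
    (if i = 0 then cons (f [y]) (parity G 0 z) else coder G i (p + m) (\<lambda>ys. f (y # ys)) z) +
    smul ((-1) powi (p * m)) (cons y (coder G (Suc i) p f z))"
  unfolding coder_def parity_def word_op_cons[OF assms] coder_word_Cons deg_eq[OF assms]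
    word_op_add lin_word_op[OF lin_cons] word_op_smul
  by simp

lemma comult_cons:
  assumes "y \<in> G m" "y \<noteq> 0"
  shows "(comult G (cons y z) :: _ \<Rightarrow>\<^sub>0 'c::field) = tensor (gen [y]) (drop_Nil (parity G 0 z)) + cons2 G m y (comult G z)"
proof -
  have "(comult_word G (y # ys) :: _ \<Rightarrow>\<^sub>0 'c) = tensor (gen [y]) (drop_Nil (gen ys)) + cons2 G m y (comult_word G ys)"
    if ys: "homs ys" for ys
  proof (cases "ys = []")
    case True
    then show ?thesis
      by (simp add: drop_Nil_def lin_0[OF lin_tensor_right] lin_0[OF lin_cons2])
  next
    case False
    have "(cons2 G m y (comult_word G ys) :: _ \<Rightarrow>\<^sub>0 'c) = linear_extension (\<lambda>(a, b). gen (y # a, b) +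
      smul ((-1) powi (deg G y * (\<Sum>y\<leftarrow>a. deg G y))) (gen (a, y # b))) (comult_word G ys)"
    proof (rule lin_eq_keys[OF lin_cons2 lin_linear_extension])
      fix t assume t: "t \<in> Poly_Mapping.keys (comult_word G ys :: _ \<Rightarrow>\<^sub>0 'c)"
      obtain a b where ab: "t = (a, b)" by (cases t)
      have "set a \<subseteq> set ys"
        using subsetD[OF keys_comult_word t] by (simp add: ab)
      with ys have "homs a" by blast
      note 1 = parity_gen_homs[OF this]
      show "(cons2 G m y (gen t) :: _ \<Rightarrow>\<^sub>0 'c) = linear_extension (\<lambda>(a, b). gen (y # a, b) +
         smul ((-1) powi (deg G y * (\<Sum>y\<leftarrow>a. deg G y))) (gen (a, y # b))) (gen t)"
        by (simp add: ab cons2_def deg_eq[OF assms] 1 lin_smul[OF lin_tensor_left])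
    qed
    with False show ?thesis
      by (simp add: comult_word_Cons drop_Nil_def)
  qed
  then have "comult G (cons y z) =
    word_op G (\<lambda>ys. tensor (gen [y]) (drop_Nil (gen ys)) + cons2 G m y (comult_word G ys)) z"
    unfolding comult_def word_op_cons[OF assms] by (rule word_op_cong)
  also have "\<dots> = tensor (gen [y]) (drop_Nil (parity G 0 z)) + cons2 G m y (comult G z)"
    by (simp only: word_op_add comult_def parity_def lin_word_op[OF lin_cons2]
        lin_word_op[OF lin_drop_Nil] lin_word_op[OF lin_tensor_right])
      simp
  finally show ?thesis .
qed

end

section \<open>Descent to the tensor coalgebra\<close>

lemma subspace_reduce_eq:
  assumes "free.subspace S" "lin f" "lin g"
  shows "free.subspace {z. reduce S (f z) = reduce S (g z)}"
  by (rule free.subspaceI)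
    (simp_all add: lin_simps[OF lin_reduce[OF assms(1)]] lin_simps[OF assms(2)] lin_simps[OF assms(3)])

text \<open>Lets word induction, which works with subspaces, run on claims quantified over all
  arities, degrees and maps; these data are packed into one tuple \<open>i\<close>.\<close>

lemma subspace_Collect_all:
  assumes "\<And>i. C i \<Longrightarrow> free.subspace {z. P i z}"
  shows "free.subspace {z. \<forall>i. C i \<longrightarrow> P i z}"
proof -
  have "{z. \<forall>i. C i \<longrightarrow> P i z} = \<Inter> ((\<lambda>i. {z. P i z}) ` {i. C i})" by auto
  also have "free.subspace \<dots>" by (rule free.subspace_Inter) (use assms in auto)
  finally show ?thesis .
qed

definition multilinear ::
  "('k::field \<Rightarrow> 'v::ab_group_add \<Rightarrow> 'v) \<Rightarrow> nat \<Rightarrow> ('v list \<Rightarrow> 'v) \<Rightarrow> bool" where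
  "multilinear scale n f \<longleftrightarrow> (\<forall>us x y vs c. length us + Suc (length vs) = n \<longrightarrow>
     f (us @ (x + y) # vs) = f (us @ x # vs) + f (us @ y # vs) \<and>
     f (us @ scale c x # vs) = scale c (f (us @ x # vs)))"

text \<open>The degrees are listed separately because \<open>deg\<close> is not meaningful at zero,
  which belongs to every \<open>G d\<close>.\<close>

definition graded_map :: "(int \<Rightarrow> 'v set) \<Rightarrow> nat \<Rightarrow> int \<Rightarrow> ('v list \<Rightarrow> 'v) \<Rightarrow> bool" where
  "graded_map G n p f \<longleftrightarrow> (\<forall>xs ds. length xs = n \<longrightarrow> list_all2 (\<lambda>x d. x \<in> G d) xs ds \<longrightarrow>
     f xs \<in> G (p + sum_list ds))"

lemma multilinear_head:
  assumes "multilinear scale (Suc n) f" "length vs = n"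
  shows "f ((x + y) # vs) = f (x # vs) + f (y # vs)" "f (scale c x # vs) = scale c (f (x # vs))"
  using assms(1)[unfolded multilinear_def, rule_format, of "[]" vs x y c] assms(2) by simp_all

lemma multilinear_Cons:
  assumes "multilinear scale (Suc n) f"
  shows "multilinear scale n (\<lambda>ys. f (x # ys))"
  unfolding multilinear_def
proof (intro allI impI)
  fix us vs :: "'b list" and y z c assume "length us + Suc (length vs) = n"
  then show "f (x # us @ (y + z) # vs) = f (x # us @ y # vs) + f (x # us @ z # vs) \<and>
    f (x # us @ scale c y # vs) = scale c (f (x # us @ y # vs))"
    using assms[unfolded multilinear_def, rule_format, of "x # us" vs y z c] by simp
qed

lemma graded_map_Cons:
  "graded_map G (Suc n) p f \<Longrightarrow> x \<in> G m \<Longrightarrow> graded_map G n (p + m) (\<lambda>ys. f (x # ys))"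
  unfolding graded_map_def
proof (intro allI impI)
  fix xs ds
  assume *: "\<forall>xs ds. length xs = Suc n \<longrightarrow> list_all2 (\<lambda>x d. x \<in> G d) xs ds \<longrightarrow> f xs \<in> G (p + sum_list ds)"
    and "x \<in> G m" "length xs = n" "list_all2 (\<lambda>x d. x \<in> G d) xs ds"
  then show "f (x # xs) \<in> G (p + m + sum_list ds)"
    using *[rule_format, of "x # xs" "m # ds"] by (simp add: add.assoc)
qed

lemma graded_map_1: "graded_map G (Suc 0) p f \<Longrightarrow> x \<in> G m \<Longrightarrow> f [x] \<in> G (p + m)"
  unfolding graded_map_def by (auto dest!: spec[of _ "[x]"] spec[of _ "[m]"])

lemma subspace_words: "free.subspace words"
  using subspace_keys[of "- {[]}"] by (simp add: words_def subset_Compl_singleton)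

lemma subspace_words2: "free.subspace words2"
  using subspace_keys[of "{(a, b). a \<noteq> [] \<and> b \<noteq> []}"]
  by (simp add: words2_def subset_eq case_prod_unfold)

lemma gen_in_words: "gen w \<in> words \<longleftrightarrow> w \<noteq> []"
  by (auto simp: words_def)

lemma gen_in_words2: "gen (a, b) \<in> words2 \<longleftrightarrow> a \<noteq> [] \<and> b \<noteq> []"
  by (auto simp: words2_def)

lemma cons_in_words: "cons x z \<in> words"
  by (rule lin_mem_keys[OF lin_cons subspace_words]) (simp add: gen_in_words)

lemma drop_Nil_in_words: "drop_Nil z \<in> words"
  by (rule lin_mem_keys[OF lin_drop_Nil subspace_words])
    (simp add: gen_in_words drop_Nil_def free.subspace_0[OF subspace_words])

lemma drop_Nil_words: "z \<in> words \<Longrightarrow> drop_Nil z = z"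
  by (rule lin_eq_keys[OF lin_drop_Nil lin_ident]) (auto simp: drop_Nil_def words_def)

lemma tensor_in_words2:
  assumes "u \<in> words" "v \<in> words"
  shows "tensor u v \<in> words2"
proof -
  have "tensor (gen a) v \<in> words2" if "a \<noteq> []" for a
    by (rule lin_mem_keys[OF lin_tensor_right subspace_words2])
      (use that assms(2) in \<open>auto simp: gen_in_words2 words_def\<close>)
  then show ?thesis
    by (rule lin_mem_keys[of "\<lambda>u. tensor u v", OF lin_tensor_left subspace_words2])
      (use assms(1) in \<open>auto simp: words_def\<close>)
qed

lemma subspace_tensor_relations: "free.subspace (tensor_relations scale)"
  by (simp add: tensor_relations_def)

lemma subspace_tensor_relations2: "free.subspace (tensor_relations2 scale)"
  by (simp add: tensor_relations2_def)

lemma tensor_relations_base: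
  "cons (x + y) z - cons x z - cons y z \<in> tensor_relations scale" (is "?A z \<in> _")
  "cons (scale c x) z - smul c (cons x z) \<in> tensor_relations scale" (is "?B z \<in> _")
proof -
  have 1: "gen ((x + y) # vs) - gen (x # vs) - gen (y # vs) \<in> tensor_relations scale"
    "gen (scale c x # vs) - smul c (gen (x # vs)) \<in> tensor_relations scale" for vs
    unfolding tensor_relations_def by (rule free.span_base, rule UnI1, rule CollectI, rule exI[of _ "[]"],
        rule exI[of _ x], rule exI[of _ y], rule exI[of _ vs], simp)
      (rule free.span_base, rule UnI2, rule CollectI, rule exI[of _ "[]"],
        rule exI[of _ c], rule exI[of _ x], rule exI[of _ vs], simp)
  have "lin ?A" "lin ?B" by (intro lin_minus_op lin_smul_op lin_cons)+
  then show "?A z \<in> tensor_relations scale" "?B z \<in> tensor_relations scale"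
    using lin_mem_keys[of ?A, OF _ subspace_tensor_relations, of z]
      lin_mem_keys[of ?B, OF _ subspace_tensor_relations, of z] 1 by simp_all
qed

lemma cons_tensor_relations: "z \<in> tensor_relations scale \<Longrightarrow> cons u z \<in> tensor_relations scale"
proof (rule lin_image_span[OF lin_cons subspace_tensor_relations])
  fix z assume "z \<in> {gen (us @ (x + y) # vs) - gen (us @ x # vs) - gen (us @ y # vs) | us x y vs. True} \<union>
      {gen (us @ scale c x # vs) - smul c (gen (us @ x # vs)) | us c x vs. True}"
  then consider us x y vs where "z = gen (us @ (x + y) # vs) - gen (us @ x # vs) - gen (us @ y # vs)"
    | us c x vs where "z = gen (us @ scale c x # vs) - smul c (gen (us @ x # vs))" by blast
  then show "cons u z \<in> tensor_relations scale"
  proof cases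
    case 1
    then have "cons u z = gen ((u # us) @ (x + y) # vs) - gen ((u # us) @ x # vs) - gen ((u # us) @ y # vs)"
      by (simp add: lin_simps[OF lin_cons])
    then show ?thesis unfolding tensor_relations_def by (intro free.span_base) blast
  next
    case 2
    then have "cons u z = gen ((u # us) @ scale c x # vs) - smul c (gen ((u # us) @ x # vs))"
      by (simp add: lin_simps[OF lin_cons])
    then show ?thesis unfolding tensor_relations_def by (intro free.span_base) blast
  qed
qed (simp add: tensor_relations_def)

text \<open>Every generating relation arises from one in the first letter by prepending letters, so
  the proof is by induction on the prefix \<open>us\<close>. Membership in the relations is carried
  along to supply the premise of the prepending step.\<close>

lemma tensor_relations_induct:
  assumes z: "z \<in> tensor_relations scale" and P: "free.subspace P"
    and add: "\<And>x y z. cons (x + y) z - cons x z - cons y z \<in> P"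
    and scale: "\<And>c x z. cons (scale c x) z - smul c (cons x z) \<in> P"
    and cons: "\<And>x z. z \<in> tensor_relations scale \<Longrightarrow> z \<in> P \<Longrightarrow> cons x z \<in> P"
  shows "z \<in> P"
proof -
  let ?R = "tensor_relations scale"
  have 1: "gen (us @ (x + y) # vs) - gen (us @ x # vs) - gen (us @ y # vs) \<in> ?R \<inter> P" for us x y vs
  proof (induction us)
    case Nil
    show ?case using tensor_relations_base(1)[of x y "gen vs"] add[of x y "gen vs"] by simp
  next
    case (Cons u us)
    then show ?case
      using cons[of "gen (us @ (x + y) # vs) - gen (us @ x # vs) - gen (us @ y # vs)" u]
        cons_tensor_relations[of "gen (us @ (x + y) # vs) - gen (us @ x # vs) - gen (us @ y # vs)" scale u]
      by (simp add: lin_simps[OF lin_cons])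
  qed
  have 2: "gen (us @ scale c x # vs) - smul c (gen (us @ x # vs)) \<in> ?R \<inter> P" for us c x vs
  proof (induction us)
    case Nil
    show ?case using tensor_relations_base(2)[of scale c x "gen vs"] scale[of c x "gen vs"] by simp
  next
    case (Cons u us)
    then show ?case
      using cons[of "gen (us @ scale c x # vs) - smul c (gen (us @ x # vs))" u]
        cons_tensor_relations[of "gen (us @ scale c x # vs) - smul c (gen (us @ x # vs))" scale u]
      by (simp add: lin_simps[OF lin_cons])
  qed
  show ?thesis
    by (rule lin_image_span[OF lin_ident P _ z[unfolded tensor_relations_def]])
      (elim UnE CollectE exE conjE, use 1 2 in simp_all)
qed

lemma tensor_relations_words: "tensor_relations scale \<subseteq> words"
proof
  fix z assume "z \<in> tensor_relations scale"
  then show "z \<in> words"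
    by (rule tensor_relations_induct[OF _ subspace_words])
      (auto intro: free.subspace_diff[OF subspace_words]
        free.subspace_scale[OF subspace_words] cons_in_words)
qed

lemma tensor_operatorI:
  assumes "lin f" "\<And>z. z \<in> words \<Longrightarrow> f z \<in> words" "\<And>z. z \<in> tensor_relations scale \<Longrightarrow> f z \<in> tensor_relations scale"
  shows "tensor_operator scale f"
  using assms by (auto simp: descends_def)

lemma
  assumes "tensor_operator scale f"
  shows tensor_operator_lin: "lin f"
    and tensor_operator_words: "z \<in> words \<Longrightarrow> f z \<in> words"
    and tensor_operator_relations: "z \<in> tensor_relations scale \<Longrightarrow> f z \<in> tensor_relations scale"
  using assms by (auto simp: descends_def)

lemma tensor_operator_id: "tensor_operator scale id"
  by (rule tensor_operatorI) (simp_all add: id_def lin_ident)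

lemma tensor_operator_compose:
  assumes "tensor_operator scale f" "tensor_operator scale g"
  shows "tensor_operator scale (\<lambda>z. f (g z))"
proof (rule tensor_operatorI)
  show "lin (\<lambda>z. f (g z))"
    by (rule lin_compose[OF tensor_operator_lin[OF assms(1)] tensor_operator_lin[OF assms(2)]])
qed (simp_all add: tensor_operator_words[OF assms(1)] tensor_operator_words[OF assms(2)]
    tensor_operator_relations[OF assms(1)] tensor_operator_relations[OF assms(2)])

lemma tensor_operator_funpow: "tensor_operator scale f \<Longrightarrow> tensor_operator scale (f ^^ n)"
proof (induction n)
  case (Suc n)
  show ?case using tensor_operator_compose[OF Suc.prems Suc.IH[OF Suc.prems]] by (simp add: comp_def)
qed (simp add: tensor_operator_id flip: id_def)

lemma tensor_relations2_left:
  "u \<in> tensor_relations scale \<Longrightarrow> v \<in> words \<Longrightarrow> tensor u v \<in> tensor_relations2 scale"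
  unfolding tensor_relations2_def by (intro free.span_base) blast

lemma tensor_relations2_right:
  "u \<in> words \<Longrightarrow> v \<in> tensor_relations scale \<Longrightarrow> tensor u v \<in> tensor_relations2 scale"
  unfolding tensor_relations2_def by (intro free.span_base) blast

lemma drop_Nil_tensor_relations: "z \<in> tensor_relations scale \<Longrightarrow> drop_Nil z \<in> tensor_relations scale"
  by (simp add: drop_Nil_words subsetD[OF tensor_relations_words])

section \<open>Congruences modulo the relations of multilinearity\<close>

context graded_vector_space
begin

abbreviation R :: "('v list \<Rightarrow>\<^sub>0 'k) set" where "R \<equiv> tensor_relations scale"
abbreviation R2 :: "('v list \<times> 'v list \<Rightarrow>\<^sub>0 'k) set" where "R2 \<equiv> tensor_relations2 scale"
abbreviation Q :: "('v list \<Rightarrow>\<^sub>0 'k) \<Rightarrow> ('v list \<Rightarrow>\<^sub>0 'k)" where "Q \<equiv> reduce R"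
abbreviation Q2 :: "('v list \<times> 'v list \<Rightarrow>\<^sub>0 'k) \<Rightarrow> ('v list \<times> 'v list \<Rightarrow>\<^sub>0 'k)" where "Q2 \<equiv> reduce R2"

lemmas subspace_R = subspace_tensor_relations[of scale]
lemmas subspace_R2 = subspace_tensor_relations2[of scale]
lemmas lin_Q = lin_reduce[OF subspace_R]
lemmas lin_Q2 = lin_reduce[OF subspace_R2]
lemmas Q_simps = lin_simps[OF lin_Q]
lemmas Q2_simps = lin_simps[OF lin_Q2]
lemmas Q_eq_iff = reduce_eq_iff[OF subspace_R]
lemmas Q_0_iff = reduce_eq_0_iff[OF subspace_R]
lemmas Q2_0_iff = reduce_eq_0_iff[OF subspace_R2]

lemma Q_cons_add: "Q (cons (x + y) z) = Q (cons x z) + Q (cons y z)"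
  using tensor_relations_base(1)[of x y z scale] 
  by (simp add: Q_0_iff[symmetric] Q_simps diff_eq_eq add.commute)

lemma Q_cons_scale: "Q (cons (scale c x) z) = smul c (Q (cons x z))"
  using tensor_relations_base(2)[of scale c x z] by (simp add: Q_0_iff[symmetric] Q_simps)

lemma Q_cons_lin: "Q (cons (scale c x + scale e y) z) = smul c (Q (cons x z)) + smul e (Q (cons y z))"
  by (simp add: Q_cons_add Q_cons_scale)

lemma Q_cons_0: "Q (cons 0 z) = 0"
  using Q_cons_scale[of 0 0 z] by simp

lemma Q_cons_sum: "Q (cons (\<Sum>n\<in>N. f n) z) = (\<Sum>n\<in>N. Q (cons (f n) z))"
  by (induction N rule: infinite_finite_induct) (simp_all add: Q_cons_0 Q_cons_add)

lemma Q_cons_cong: "Q z = Q z' \<Longrightarrow> Q (cons x z) = Q (cons x z')"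
  by (rule reduce_cong[OF subspace_R subspace_R lin_cons cons_tensor_relations])

text \<open>Modulo \<open>R\<close> a letter is the sum of its components, and \<open>P\<close>
  absorbs \<open>R\<close>; so only homogeneous letters have to be prepended. The letter in the step
  may be zero, which is why the congruences for \<open>cons y z\<close> are proved without assuming
  y nonzero.\<close>

lemma word_induct:
  assumes P: "free.subspace P" "R \<subseteq> P" "gen [] \<in> P"
    and step: "\<And>y m z. y \<in> G m \<Longrightarrow> z \<in> P \<Longrightarrow> cons y z \<in> P"
  shows "z \<in> P"
proof -
  have "gen w \<in> P" for w
  proof (induction w)
    case (Cons x w)
    let ?N = "{n. component n x \<noteq> 0}"
    have "Q (cons (\<Sum>n\<in>?N. component n x) (gen w)) = Q (\<Sum>n\<in>?N. cons (component n x) (gen w))"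
      by (simp only: Q_cons_sum Q_simps)
    then have "gen (x # w) - (\<Sum>n\<in>?N. cons (component n x) (gen w)) \<in> P"
      using subsetD[OF P(2)] by (simp only: sum_components Q_eq_iff cons_gen)
    moreover have "(\<Sum>n\<in>?N. cons (component n x) (gen w)) \<in> P"
      by (intro free.subspace_sum P(1) step[OF component_in] Cons.IH)
    ultimately have "gen (x # w) - (\<Sum>n\<in>?N. cons (component n x) (gen w)) +
        (\<Sum>n\<in>?N. cons (component n x) (gen w)) \<in> P"
      by (rule free.subspace_add[OF P(1)])
    then show ?case by simp
  qed fact
  then show ?thesis by (rule lin_mem_keys[OF lin_ident P(1)])
qed

lemma relations_induct:
  assumes "z \<in> R" "free.subspace P"
    and lin: "\<And>c e x y z. cons (scale c x + scale e y) z - smul c (cons x z) - smul e (cons y z) \<in> P"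
    and "\<And>x z. z \<in> R \<Longrightarrow> z \<in> P \<Longrightarrow> cons x z \<in> P"
  shows "z \<in> P"
proof (rule tensor_relations_induct[OF assms(1,2)])
  show "cons (x + y) z - cons x z - cons y z \<in> P" for x y z using lin[of 1 x 1 y z] by simp
  show "cons (scale c x) z - smul c (cons x z) \<in> P" for c x z using lin[of c x 0 0 z] by simp
qed fact

section \<open>Operators given by a recursion \<open>B\<close> in the first letter\<close>

context
  fixes S :: "('y \<Rightarrow>\<^sub>0 'k) set" and \<phi> :: "'v list \<Rightarrow> ('y \<Rightarrow>\<^sub>0 'k)"
    and B :: "int \<Rightarrow> 'v \<Rightarrow> ('v list \<Rightarrow>\<^sub>0 'k) \<Rightarrow> ('y \<Rightarrow>\<^sub>0 'k)"
  assumes S: "free.subspace S"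
    and B: "\<And>m y z. y \<in> G m \<Longrightarrow> y \<noteq> 0 \<Longrightarrow> word_op G \<phi> (cons y z) = B m y z"
    and B_lin: "\<And>m x y z c e. reduce S (B m (scale c x + scale e y) z) =
      smul c (reduce S (B m x z)) + smul e (reduce S (B m y z))"
begin

lemma reduce_B_0: "reduce S (B m 0 z) = 0"
  using B_lin[of m 0 0 0 0 z] by simp

text \<open>The exact recursion is known for nonzero letters. At y = 0 both sides vanish: the left
  one because zero has no components, the right one because \<open>B\<close> is linear in the letter
  modulo \<open>S\<close>.\<close>

lemma reduce_word_op_cons:
  assumes "y \<in> G m"
  shows "reduce S (word_op G \<phi> (cons y z)) = reduce S (B m y z)"
proof (cases "y = 0")
  case True
  then show ?thesis
    unfolding word_op_decompose[of _ y] hcomponents_homogeneous[OF assms]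
    by (simp add: reduce_B_0 lin_0[OF lin_reduce[OF S]])
qed (simp add: B[OF assms])

lemma reduce_word_op_decompose:
  assumes "finite N" "{n. component n x \<noteq> 0} \<subseteq> N"
  shows "reduce S (word_op G \<phi> (cons x z)) = (\<Sum>n\<in>N. reduce S (B n (component n x) z))"
  unfolding word_op_decompose[of _ x] sum_hcomponents[OF assms] lin_sum[OF lin_reduce[OF S]]
  by (intro sum.cong refl) (simp add: lin_0[OF lin_reduce[OF S]] reduce_B_0 B[OF component_in])

text \<open>Taking components is linear and \<open>B\<close> is linear in the letter in each degree,
  so both sides are compared degree by degree over the union of the supports of x and y.\<close>

lemma word_op_relations_lin:
  "word_op G \<phi> (cons (scale c x + scale e y) z - smul c (cons x z) - smul e (cons y z)) \<in> S"
proof -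
  let ?N = "{n. component n x \<noteq> 0} \<union> {n. component n y \<noteq> 0}"
  have "finite ?N" by (simp add: finite_components)
  note * = reduce_word_op_decompose[OF this]
  show ?thesis
    unfolding reduce_eq_0_iff[OF S, symmetric] lin_simps[OF lin_linear_extension] lin_simps[OF lin_reduce[OF S]]
    by (subst (1 2 3) *) (auto simp: component_add component_scale B_lin sum.distrib free.scale_sum_right)
qed

text \<open>Descent principle: relations in the first letter are respected by linearity of
  \<open>B\<close>, those in the tail by the induction hypothesis passed to
  \<open>B\<close>.\<close>

lemma word_op_relations:
  assumes "\<And>m y z. y \<in> G m \<Longrightarrow> z \<in> R \<Longrightarrow> word_op G \<phi> z \<in> S \<Longrightarrow> B m y z \<in> S" "z \<in> R"
  shows "word_op G \<phi> z \<in> S"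
proof -
  have "z \<in> {z. word_op G \<phi> z \<in> S}"
  proof (rule relations_induct[OF assms(2)])
    show "free.subspace {z. word_op G \<phi> z \<in> S}"
      by (rule subspace_vimage[OF lin_linear_extension S])
    show "cons x z \<in> {z. word_op G \<phi> z \<in> S}" if "z \<in> R" "z \<in> {z. word_op G \<phi> z \<in> S}" for x z
      unfolding mem_Collect_eq word_op_decompose[of _ x]
    proof (rule free.subspace_sum[OF S])
      fix y assume "y \<in> hcomponents G x"
      then obtain m where y: "y \<in> G m" "y \<noteq> 0" using hcomponents_D by blast
      show "word_op G \<phi> (cons y z) \<in> S"
        unfolding B[OF y] by (rule assms(1)[OF y(1)]) (use that in simp_all)
    qed
  qed (simp add: word_op_relations_lin)
  then show ?thesis by simp
qed

end

end

lemma minus_one_powi_square: "(-1 :: 'k::field) powi n * (-1) powi n = 1"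
  by (metis (no_types) mult_minus1 mult_minus1_right minus_minus power_int_1_left power_int_mult_distrib)

section \<open>Parity and the operators \<open>f\<^sup>c\<close> on the quotient\<close>

context graded_vector_space
begin

text \<open>The recursion of \<open>parity\<close> written as a function of degree, letter and tail,
  the format of \<open>B\<close> above; \<open>coder_rec\<close> and \<open>comult_rec\<close> play
  the same role.\<close>

definition parity_rec :: "int \<Rightarrow> int \<Rightarrow> 'v \<Rightarrow> ('v list \<Rightarrow>\<^sub>0 'k) \<Rightarrow> ('v list \<Rightarrow>\<^sub>0 'k)" where
  "parity_rec q m y z = smul ((-1) powi (q * m)) (cons y (parity G q z))"

lemma parity_rec:
  assumes "y \<in> G m" "y \<noteq> 0"
  shows "word_op G (\<lambda>ys. smul ((-1) powi (q * (\<Sum>y\<leftarrow>ys. deg G y))) (gen ys)) (cons y z) = parity_rec q m y z"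
  by (simp only: parity_rec_def parity_def parity_cons[OF assms, unfolded parity_def])

lemma parity_rec_lin:
  "Q (parity_rec q m (scale c x + scale e y) z) = smul c (Q (parity_rec q m x z)) + smul e (Q (parity_rec q m y z))"
  by (simp add: parity_rec_def Q_simps Q_cons_lin free.scale_right_distrib mult.commute)

lemma Q_parity_cons:
  assumes "y \<in> G m"
  shows "Q (parity G q (cons y z)) = smul ((-1) powi (q * m)) (Q (cons y (parity G q z)))"
proof -
  have "Q (parity G q (cons y z)) = Q (parity_rec q m y z)"
    unfolding parity_def
    by (rule reduce_word_op_cons[OF subspace_R parity_rec parity_rec_lin assms])
  then show ?thesis by (simp add: parity_rec_def Q_simps)
qed

lemma parity_R:
  assumes "z \<in> R"
  shows "parity G q z \<in> R"
  unfolding parity_def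
proof (rule word_op_relations[OF subspace_R parity_rec parity_rec_lin _ assms])
  fix m y z
  assume "word_op G (\<lambda>ys. smul ((-1) powi (q * (\<Sum>y\<leftarrow>ys. deg G y))) (gen ys)) z \<in> R"
  then show "parity_rec q m y z \<in> R"
    unfolding parity_rec_def parity_def
    by (intro free.subspace_scale[OF subspace_R] cons_tensor_relations)
qed

lemma Q_parity_cong: "Q z = Q z' \<Longrightarrow> Q (parity G q z) = Q (parity G q z')"
  by (rule reduce_cong[OF subspace_R subspace_R lin_parity parity_R])

lemma parity_words:
  assumes "z \<in> words"
  shows "(parity G q z :: 'v list \<Rightarrow>\<^sub>0 'k) \<in> words"
proof (rule lin_mem_keys[OF lin_parity subspace_words])
  fix w assume "w \<in> Poly_Mapping.keys z"
  with assms obtain x w' where w: "w = x # w'" by (cases w) (auto simp: words_def)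
  have "(parity G q (cons x (gen w')) :: 'v list \<Rightarrow>\<^sub>0 'k) \<in> words"
    unfolding parity_def word_op_decompose[of _ x]
  proof (rule free.subspace_sum[OF subspace_words])
    fix y assume "y \<in> hcomponents G x"
    then obtain m where y: "y \<in> G m" "y \<noteq> 0" using hcomponents_D by blast
    show "word_op G (\<lambda>ys. smul ((-1 :: 'k) powi (q * sum_list (map (deg G) ys))) (gen ys)) (cons y (gen w')) \<in> words"
      unfolding parity_rec[OF y] parity_rec_def
      by (intro free.subspace_scale[OF subspace_words] cons_in_words)
  qed
  then show "(parity G q (gen w) :: 'v list \<Rightarrow>\<^sub>0 'k) \<in> words" by (simp add: w)
qed

lemma parity_Nil [simp]: "parity G q (gen []) = gen []"
  by (simp add: parity_def)

lemma Q_parity_parity: "Q (parity G p (parity G q z)) = Q (parity G (p + q) z)"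
proof -
  have "z \<in> {z. Q (parity G p (parity G q z)) = Q (parity G (p + q) z)}"
  proof (rule word_induct)
    show "free.subspace {z. Q (parity G p (parity G q z)) = Q (parity G (p + q) z)}"
      by (intro subspace_reduce_eq subspace_R lin_parity lin_compose[OF lin_parity lin_parity])
    show "R \<subseteq> {z. Q (parity G p (parity G q z)) = Q (parity G (p + q) z)}"
      by (auto simp: Q_0_iff[THEN iffD2] parity_R)
  next
    fix y m z assume y: "y \<in> G m" and "z \<in> {z. Q (parity G p (parity G q z)) = Q (parity G (p + q) z)}"
    then have "Q (cons y (parity G p (parity G q z))) = Q (cons y (parity G (p + q) z))"
      by (intro Q_cons_cong) simp
    moreover have "Q (parity G p (parity G q (cons y z))) =
        Q (parity G p (smul ((-1) powi (q * m)) (cons y (parity G q z))))"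
      by (rule Q_parity_cong) (simp add: Q_parity_cons[OF y] Q_simps)
    ultimately show "cons y z \<in> {z. Q (parity G p (parity G q z)) = Q (parity G (p + q) z)}"
      by (simp add: lin_simps[OF lin_parity] Q_simps Q_parity_cons[OF y] ring_distribs minus_one_powi_add mult_ac)
  qed simp
  then show ?thesis by simp
qed

lemma Q_parity_0: "Q (parity G 0 z) = Q z"
proof -
  have "z \<in> {z. Q (parity G 0 z) = Q z}"
  proof (rule word_induct)
    show "free.subspace {z. Q (parity G 0 z) = Q z}"
      by (intro subspace_reduce_eq subspace_R lin_parity lin_ident)
    show "R \<subseteq> {z. Q (parity G 0 z) = Q z}"
      by (auto simp: Q_0_iff[THEN iffD2] parity_R)
  next
    fix y m z assume "y \<in> G m" "z \<in> {z. Q (parity G 0 z) = Q z}"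
    then show "cons y z \<in> {z. Q (parity G 0 z) = Q z}"
      using Q_cons_cong[of "parity G 0 z" z y] by (simp add: Q_parity_cons)
  qed simp
  then show ?thesis by simp
qed

lemma coder_Nil [simp]: "coder G (Suc i) p f (gen []) = 0"
  by (simp add: coder_def)

text \<open>The values of \<open>f\<close> become letters, so linearity in \<open>f\<close> is
  itself an instance of multilinearity and holds only after \<open>Q\<close>. The induction varies
  the map because its first argument gets fixed along the word.\<close>

lemma Q_coder_word_lin:
  assumes "\<And>ys. length ys = Suc i \<Longrightarrow> f ys = scale c (g ys) + scale e (h ys)"
  shows "Q (coder_word G (Suc i) p f w) = smul c (Q (coder_word G (Suc i) p g w)) + smul e (Q (coder_word G (Suc i) p h w))"
  using assms
proof (induction w arbitrary: i p f g h)
  case (Cons x w)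
  let ?W = "\<lambda>f. coder_word G (Suc i) p f w"
  have 1: "Q (cons x (?W f)) = smul c (Q (cons x (?W g))) + smul e (Q (cons x (?W h)))"
    using Q_cons_cong[of "?W f" "smul c (?W g) + smul e (?W h)" x]
    by (simp add: Cons.IH[OF Cons.prems] Q_simps lin_simps[OF lin_cons])
  show ?case
  proof (cases i)
    case 0
    then have "f [x] = scale c (g [x]) + scale e (h [x])" by (simp add: Cons.prems)
    with 1 Q_cons_lin[of c "g [x]" e "h [x]" "gen w"] show ?thesis
      by (simp add: coder_word_Cons 0 Q_simps free.scale_right_distrib mult.commute)
  next
    case (Suc j)
    let ?W = "\<lambda>f. coder_word G (Suc j) (p + deg G x) (\<lambda>ys. f (x # ys)) w"
    have "Q (?W f) = smul c (Q (?W g)) + smul e (Q (?W h))"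
      by (rule Cons.IH) (simp add: Cons.prems Suc)
    with 1 show ?thesis
      by (simp add: coder_word_Cons Suc Q_simps free.scale_right_distrib mult.commute)
  qed
qed (simp add: Q_simps)

lemma Q_coder_lin:
  assumes "\<And>ys. length ys = Suc i \<Longrightarrow> f ys = scale c (g ys) + scale e (h ys)"
  shows "Q (coder G (Suc i) p f z) = smul c (Q (coder G (Suc i) p g z)) + smul e (Q (coder G (Suc i) p h z))"
proof -
  have "Q (coder_word G (Suc i) p f w) = smul c (Q (coder_word G (Suc i) p g w)) + smul e (Q (coder_word G (Suc i) p h w))" for w
    by (rule Q_coder_word_lin) (rule assms)
  then show ?thesis unfolding coder_def lin_word_op[OF lin_Q] by (simp only: word_op_add word_op_smul)
qed

text \<open>Since words are split into components first, \<open>f\<close> is only evaluated at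
  homogeneous nonzero letters. This is where formulas with Koszul signs may be replaced by their
  simplified values.\<close>

lemma coder_cong:
  assumes "\<And>ys. homs ys \<Longrightarrow> length ys = Suc i \<Longrightarrow> f ys = g ys"
  shows "(coder G (Suc i) p f z :: 'v list \<Rightarrow>\<^sub>0 'c::field) = coder G (Suc i) p g z"
proof -
  have "(coder_word G (Suc i) p f w :: 'v list \<Rightarrow>\<^sub>0 'c) = coder_word G (Suc i) p g w" if "homs w" for w
    using assms that
  proof (induction w arbitrary: i p f g)
    case (Cons x w)
    have 1: "(coder_word G (Suc i) p f w :: 'v list \<Rightarrow>\<^sub>0 'c) = coder_word G (Suc i) p g w"
      using Cons.prems by (intro Cons.IH) auto
    show ?case
    proof (cases i)
      case 0
      then show ?thesis using Cons.prems(1)[of "[x]"] Cons.prems(2) 1 by (simp add: coder_word_Cons)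
    next
      case (Suc j)
      have "(coder_word G (Suc j) (p + deg G x) (\<lambda>ys. f (x # ys)) w :: 'v list \<Rightarrow>\<^sub>0 'c) =
        coder_word G (Suc j) (p + deg G x) (\<lambda>ys. g (x # ys)) w"
        using Cons.prems Suc by (intro Cons.IH) auto
      with 1 show ?thesis by (simp add: coder_word_Cons Suc)
    qed
  qed simp
  then show ?thesis unfolding coder_def by (rule word_op_cong)
qed

lemma coder_words: "coder G (Suc i) p f z \<in> words"
proof -
  have 0: "coder_word G (Suc i) p f w \<in> words" for i p f w
  proof (induction w arbitrary: i p f)
    case (Cons x w)
    then show ?case
      by (cases i) (auto simp: coder_word_Cons gen_in_words cons_in_words
          intro!: free.subspace_add[OF subspace_words] free.subspace_scale[OF subspace_words])
  qed (simp add: free.subspace_0[OF subspace_words])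
  show ?thesis
    unfolding coder_def
    by (rule lin_mem_keys[OF lin_linear_extension subspace_words])
      (auto simp: hextend_def intro!: free.subspace_sum[OF subspace_words] 0)
qed

text \<open>The part of the recursion in which \<open>f\<close> takes the first letter, simplified
  modulo \<open>R\<close>: in the unary case the tail is \<open>z\<close> itself instead of
  \<open>parity G 0 z\<close>.\<close>

definition coder_head :: "nat \<Rightarrow> int \<Rightarrow> ('v list \<Rightarrow> 'v) \<Rightarrow> int \<Rightarrow> 'v \<Rightarrow> ('v list \<Rightarrow>\<^sub>0 'k) \<Rightarrow> ('v list \<Rightarrow>\<^sub>0 'k)" where
  "coder_head i p f m y z = (if i = 0 then cons (f [y]) z else coder G i (p + m) (\<lambda>ys. f (y # ys)) z)"

definition coder_rec :: "nat \<Rightarrow> int \<Rightarrow> ('v list \<Rightarrow> 'v) \<Rightarrow> int \<Rightarrow> 'v \<Rightarrow> ('v list \<Rightarrow>\<^sub>0 'k) \<Rightarrow> ('v list \<Rightarrow>\<^sub>0 'k)" where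
  "coder_rec i p f m y z = (if i = 0 then cons (f [y]) (parity G 0 z) else coder G i (p + m) (\<lambda>ys. f (y # ys)) z) +
     smul ((-1) powi (p * m)) (cons y (coder G (Suc i) p f z))"

lemma coder_rec:
  "y \<in> G m \<Longrightarrow> y \<noteq> 0 \<Longrightarrow> word_op G (coder_word G (Suc i) p f) (cons y z) = coder_rec i p f m y z"
  using coder_cons[of y m i p f z] by (simp add: coder_rec_def coder_def)

lemma coder_rec_lin:
  assumes "multilinear scale (Suc i) f"
  shows "Q (coder_rec i p f m (scale c x + scale e y) z) = smul c (Q (coder_rec i p f m x z)) + smul e (Q (coder_rec i p f m y z))"
proof (cases i)
  case 0
  have "f [scale c x + scale e y] = scale c (f [x]) + scale e (f [y])"
    using multilinear_head[of scale 0 f "[]"] assms 0 by simp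
  then show ?thesis
    by (simp add: coder_rec_def 0 Q_simps Q_cons_lin free.scale_right_distrib mult.commute)
next
  case (Suc j)
  let ?C = "\<lambda>x. coder G (Suc j) (p + m) (\<lambda>ys. f (x # ys)) z"
  have "Q (?C (scale c x + scale e y)) = smul c (Q (?C x)) + smul e (Q (?C y))"
    by (rule Q_coder_lin) (use multilinear_head[OF assms] Suc in simp)
  then show ?thesis
    by (simp add: coder_rec_def Suc Q_simps Q_cons_lin free.scale_right_distrib mult.commute)
qed

text \<open>The recursion leads from \<open>f\<close> to f(y, ...), a different operator of smaller
  arity. The descent principle for a single operator does not cover this, so the tail step is done
  for all triples (i, p, f) together.\<close>

lemma coder_R:
  assumes "multilinear scale (Suc i) f" "z \<in> R"
  shows "coder G (Suc i) p f z \<in> R"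
proof -
  let ?P = "{z. \<forall>a. (case a of (i, p, f) \<Rightarrow> multilinear scale (Suc i) f) \<longrightarrow>
    (case a of (i, p, f) \<Rightarrow> coder G (Suc i) p f z \<in> R)}"
  have "z \<in> ?P"
  proof (rule relations_induct[OF assms(2)])
    show "free.subspace ?P"
      by (rule subspace_Collect_all) (auto intro: subspace_vimage[OF lin_coder subspace_R])
    show "cons (scale c x + scale e y) z - smul c (cons x z) - smul e (cons y z) \<in> ?P" for c e x y z
      by (auto simp: coder_def intro!: word_op_relations_lin[OF subspace_R coder_rec coder_rec_lin])
    fix x z assume z: "z \<in> R" and IH: "z \<in> ?P"
    have "coder G (Suc i) p f (cons x z) \<in> R" if f: "multilinear scale (Suc i) f" for i p f
      unfolding coder_def word_op_decompose[of _ x]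
    proof (rule free.subspace_sum[OF subspace_R])
      fix y assume "y \<in> hcomponents G x"
      then obtain m where y: "y \<in> G m" "y \<noteq> 0" using hcomponents_D by blast
      have 1: "coder G (Suc i) p f z \<in> R" using IH f by auto
      have 2: "coder G i (p + m) (\<lambda>ys. f (y # ys)) z \<in> R" if "i \<noteq> 0"
        using IH multilinear_Cons[OF f, of y] that by (cases i) auto
      show "word_op G (coder_word G (Suc i) p f) (cons y z) \<in> R"
        using 1 2 z unfolding coder_rec[OF y] coder_rec_def
        by (auto intro!: free.subspace_add[OF subspace_R] free.subspace_scale[OF subspace_R]
            cons_tensor_relations parity_R)
    qed
    then show "cons x z \<in> ?P" by auto
  qed
  then show ?thesis using assms(1) by auto
qed

lemma tensor_operator_coder:
  "multilinear scale (Suc i) f \<Longrightarrow> tensor_operator scale (coder G (Suc i) p f)"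
  by (rule tensor_operatorI[OF lin_coder coder_words coder_R])

lemma Q_operator_cong: "tensor_operator scale f \<Longrightarrow> Q z = Q z' \<Longrightarrow> Q (f z) = Q (f z')"
  by (rule reduce_cong[OF subspace_R subspace_R tensor_operator_lin tensor_operator_relations])

lemmas Q_coder_cong = Q_operator_cong[OF tensor_operator_coder]

lemma Q_coder_cons:
  assumes "multilinear scale (Suc i) f" "y \<in> G m"
  shows "Q (coder G (Suc i) p f (cons y z)) =
    Q (coder_head i p f m y z) + smul ((-1) powi (p * m)) (Q (cons y (coder G (Suc i) p f z)))"
proof -
  have "Q (coder G (Suc i) p f (cons y z)) = Q (coder_rec i p f m y z)"
    unfolding coder_def
    by (rule reduce_word_op_cons[OF subspace_R coder_rec coder_rec_lin])
      (use assms in auto)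
  then show ?thesis
    using Q_cons_cong[OF Q_parity_0, of "f [y]" z] by (simp add: coder_rec_def coder_head_def Q_simps)
qed

text \<open>The operator \<open>f\<^sup>c\<close> raises total degree by p, and
  \<open>parity G q\<close> weighs total degree by q; the discrepancy is the sign with exponent
  qp.\<close>

lemma Q_parity_coder:
  assumes "multilinear scale (Suc i) f" "graded_map G (Suc i) p f"
  shows "Q (parity G q (coder G (Suc i) p f z)) = smul ((-1) powi (q * p)) (Q (coder G (Suc i) p f (parity G q z)))"
proof -
  let ?E = "\<lambda>i p f z. Q (parity G q (coder G (Suc i) p f z)) = Q (smul ((-1) powi (q * p)) (coder G (Suc i) p f (parity G q z)))"
  let ?P = "{z. \<forall>a. (case a of (i, p, f) \<Rightarrow> multilinear scale (Suc i) f \<and> graded_map G (Suc i) p f) \<longrightarrow>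
    (case a of (i, p, f) \<Rightarrow> ?E i p f z)}"
  have "z \<in> ?P"
  proof (rule word_induct)
    show "free.subspace ?P"
      by (rule subspace_Collect_all)
        (auto intro!: subspace_reduce_eq subspace_R lin_smul_op
          intro: lin_compose[OF lin_parity lin_coder] lin_compose[OF lin_coder lin_parity])
    show "R \<subseteq> ?P"
      by (auto simp: Q_simps Q_0_iff[THEN iffD2] parity_R coder_R)
    show "gen [] \<in> ?P" by (auto simp: lin_0[OF lin_parity])
    fix y n z assume y: "y \<in> G n" and IH: "z \<in> ?P"
    have "?E i p f (cons y z)" if f: "multilinear scale (Suc i) f" "graded_map G (Suc i) p f" for i p f
    proof -
      let ?C = "coder G (Suc i) p f"
      let ?H = "coder_head i p f n y"
      have 1: "Q (parity G q (?C (cons y z))) = Q (parity G q (?H z + smul ((-1) powi (p * n)) (cons y (?C z))))"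
        by (rule Q_parity_cong) (simp add: Q_coder_cons[OF f(1) y] Q_simps)
      have 2: "Q (?C (parity G q (cons y z))) = Q (?C (smul ((-1) powi (q * n)) (cons y (parity G q z))))"
        by (rule Q_coder_cong[OF f(1)]) (simp add: Q_parity_cons[OF y] Q_simps)
      have IH1: "Q (cons y (parity G q (?C z))) = Q (cons y (smul ((-1) powi (q * p)) (?C (parity G q z))))"
        by (rule Q_cons_cong) (use IH f in auto)
      have 3: "Q (parity G q (?H z)) = smul ((-1) powi (q * (p + n))) (Q (?H (parity G q z)))"
      proof (cases i)
        case 0
        then show ?thesis using graded_map_1[of G p f y n] f y by (simp add: coder_head_def Q_parity_cons)
      next
        case (Suc j)
        then show ?thesis
          using IH multilinear_Cons[OF f(1), of y] graded_map_Cons[OF f(2) y] by (auto simp: coder_head_def Q_simps)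
      qed
      show ?thesis
        by (simp add: 1 2 3 IH1 lin_simps[OF lin_parity] lin_simps[OF lin_coder] lin_simps[OF lin_cons] Q_simps
            Q_parity_cons[OF y] Q_coder_cons[OF f(1) y] free.scale_right_distrib distrib_left minus_one_powi_add mult_ac)
    qed
    then show "cons y z \<in> ?P" by auto
  qed
  then show ?thesis using assms by (auto simp: Q_simps)
qed

end

section \<open>The coproduct and coderivations\<close>

lemma words2_tensor_induct:
  assumes "t \<in> words2" "lin g" "lin h"
    and "\<And>u v. u \<in> words \<Longrightarrow> v \<in> words \<Longrightarrow> g (tensor u v) = h (tensor u v)"
  shows "g t = h t"
  by (rule lin_eq_tensorI[OF assms(2,3)])
    (use assms(1) in \<open>auto intro!: assms(4) simp: gen_in_words words2_def simp del: tensor_gen\<close>)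

lemma comult_Nil [simp]: "comult G (gen []) = 0"
  by (simp add: comult_def)

lemma comult_words2: "(comult G z :: _ \<Rightarrow>\<^sub>0 'k::field) \<in> words2"
proof -
  have 0: "(comult_word G w :: _ \<Rightarrow>\<^sub>0 'k) \<in> words2" for w
    using keys_comult_word[of G w] by (force simp: words2_def)
  show ?thesis
    unfolding comult_def
    by (rule lin_mem_keys[OF lin_linear_extension subspace_words2])
      (auto simp: hextend_def intro!: free.subspace_sum[OF subspace_words2] 0)
qed

context graded_vector_space
begin

text \<open>Split the difference as (u - u') \<otimes> v + u' \<otimes> (v - v'). Each summand is a
  relation once the factor kept fixed, v or u', contains no empty word.\<close>

lemma Q2_tensor_cong:
  assumes "Q u = Q u'" "Q v = Q v'" "u' \<in> words" "v \<in> words"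
  shows "Q2 (tensor u v) = Q2 (tensor u' v')"
proof -
  have "tensor (u - u') v \<in> R2" "tensor u' (v - v') \<in> R2"
    using assms by (auto intro: tensor_relations2_left tensor_relations2_right simp: Q_eq_iff)
  then have "Q2 (tensor (u - u') v) = 0" "Q2 (tensor u' (v - v')) = 0"
    by (simp_all add: Q2_0_iff)
  then show ?thesis by (simp add: tensor_simps Q2_simps)
qed

lemma relations2_stable:
  assumes "lin g"
    and "\<And>u v. u \<in> R \<Longrightarrow> v \<in> words \<Longrightarrow> g (tensor u v) \<in> R2"
    and "\<And>u v. u \<in> words \<Longrightarrow> v \<in> R \<Longrightarrow> g (tensor u v) \<in> R2"
    and "t \<in> R2"
  shows "g t \<in> R2"
  by (rule lin_image_span[OF assms(1) subspace_R2 _ assms(4)[unfolded tensor_relations2_def]])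
    (use assms(2,3) in blast)

lemma cons2_R2: "t \<in> R2 \<Longrightarrow> cons2 G m x t \<in> R2"
  by (rule relations2_stable[OF lin_cons2])
    (auto simp: cons2_tensor intro!: free.subspace_add[OF subspace_R2]
      intro: tensor_relations2_left tensor_relations2_right cons_tensor_relations cons_in_words parity_R parity_words)

lemma Q2_cons2_cong: "Q2 t = Q2 t' \<Longrightarrow> Q2 (cons2 G m x t) = Q2 (cons2 G m x t')"
  by (rule reduce_cong[OF subspace_R2 subspace_R2 lin_cons2 cons2_R2])

lemma Q2_cons2_lin:
  assumes "t \<in> words2"
  shows "Q2 (cons2 G m (scale c x + scale e y) t) = smul c (Q2 (cons2 G m x t)) + smul e (Q2 (cons2 G m y t))"
proof (rule words2_tensor_induct[OF assms])
  show "lin (\<lambda>t. Q2 (cons2 G m (scale c x + scale e y) t))" by (rule lin_compose[OF lin_Q2 lin_cons2])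
  show "lin (\<lambda>t. smul c (Q2 (cons2 G m x t)) + smul e (Q2 (cons2 G m y t)))"
    by (intro lin_plus lin_smul_op) (rule lin_compose[OF lin_Q2 lin_cons2])+
  fix u v :: "'v list \<Rightarrow>\<^sub>0 'k" assume uv: "u \<in> words" "v \<in> words"
  let ?l = "\<lambda>z. smul c (cons x z) + smul e (cons y z)"
  have "Q2 (tensor (cons (scale c x + scale e y) u) v) = Q2 (tensor (?l u) v)"
    by (rule Q2_tensor_cong) (auto simp: uv Q_cons_lin Q_simps cons_in_words
        intro!: free.subspace_add[OF subspace_words] free.subspace_scale[OF subspace_words])
  moreover have "Q2 (tensor (parity G m u) (cons (scale c x + scale e y) v)) = Q2 (tensor (parity G m u) (?l v))"
    by (rule Q2_tensor_cong) (auto simp: uv Q_cons_lin Q_simps cons_in_words parity_words)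
  ultimately show "Q2 (cons2 G m (scale c x + scale e y) (tensor u v)) =
    smul c (Q2 (cons2 G m x (tensor u v))) + smul e (Q2 (cons2 G m y (tensor u v)))"
    by (simp add: cons2_tensor tensor_simps Q2_simps free.scale_right_distrib add_ac)
qed

definition comult_rec :: "int \<Rightarrow> 'v \<Rightarrow> ('v list \<Rightarrow>\<^sub>0 'k) \<Rightarrow> ('v list \<times> 'v list \<Rightarrow>\<^sub>0 'k)" where
  "comult_rec m y z = tensor (gen [y]) (drop_Nil (parity G 0 z)) + cons2 G m y (comult G z)"

lemma comult_rec: "y \<in> G m \<Longrightarrow> y \<noteq> 0 \<Longrightarrow> word_op G (comult_word G) (cons y z) = comult_rec m y z"
  using comult_cons[of y m z] by (simp add: comult_rec_def comult_def)

lemma comult_rec_lin: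
  "Q2 (comult_rec m (scale c x + scale e y) z) = smul c (Q2 (comult_rec m x z)) + smul e (Q2 (comult_rec m y z))"
proof -
  let ?w = "drop_Nil (parity G 0 z)"
  have "Q2 (tensor (gen [scale c x + scale e y]) ?w) = Q2 (tensor (smul c (gen [x]) + smul e (gen [y])) ?w)"
    by (rule Q2_tensor_cong)
      (use Q_cons_lin[of c x e y "gen []"] in \<open>auto simp: Q_simps drop_Nil_in_words gen_in_words
        intro!: free.subspace_add[OF subspace_words] free.subspace_scale[OF subspace_words]\<close>)
  then show ?thesis
    by (simp add: comult_rec_def Q2_simps Q2_cons2_lin comult_words2 tensor_simps free.scale_right_distrib add_ac)
qed

lemma comult_R:
  assumes "z \<in> R"
  shows "comult G z \<in> R2"
  unfolding comult_def
proof (rule word_op_relations[OF subspace_R2 comult_rec comult_rec_lin _ assms])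
  fix m y z assume z: "z \<in> R" "word_op G (comult_word G) z \<in> R2"
  show "comult_rec m y z \<in> R2"
    unfolding comult_rec_def
  proof (rule free.subspace_add[OF subspace_R2])
    show "tensor (gen [y]) (drop_Nil (parity G 0 z)) \<in> R2"
      by (rule tensor_relations2_right)
        (simp_all add: gen_in_words drop_Nil_tensor_relations parity_R z)
    show "cons2 G m y (comult G z) \<in> R2"
      by (rule cons2_R2) (use z in \<open>simp add: comult_def\<close>)
  qed
qed

lemma Q2_comult_cong: "Q z = Q z' \<Longrightarrow> Q2 (comult G z) = Q2 (comult G z')"
  by (rule reduce_cong[OF subspace_R subspace_R2 lin_comult comult_R])

lemma Q2_comult_cons:
  assumes "y \<in> G m"
  shows "Q2 (comult G (cons y z)) = Q2 (tensor (gen [y]) (drop_Nil z)) + Q2 (cons2 G m y (comult G z))"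
proof -
  have "Q2 (comult G (cons y z)) = Q2 (comult_rec m y z)"
    unfolding comult_def
    by (rule reduce_word_op_cons[OF subspace_R2 comult_rec comult_rec_lin assms])
  moreover have "Q2 (tensor (gen [y]) (drop_Nil (parity G 0 z))) = Q2 (tensor (gen [y]) (drop_Nil z))"
  proof (rule Q2_tensor_cong)
    show "Q (drop_Nil (parity G 0 z)) = Q (drop_Nil z)"
      by (rule reduce_cong[OF subspace_R subspace_R lin_drop_Nil drop_Nil_tensor_relations Q_parity_0])
  qed (simp_all add: gen_in_words drop_Nil_in_words)
  ultimately show ?thesis by (simp add: comult_rec_def Q2_simps)
qed

lemma op_tensor_relations:
  assumes "tensor_operator scale g" "tensor_operator scale h" "t \<in> R2"
  shows "op_tensor G q g h t \<in> R2"
proof (rule relations2_stable[OF lin_op_tensor _ _ assms(3)])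
  note * = op_tensor_tensor[OF tensor_operator_lin[OF assms(1)] tensor_operator_lin[OF assms(2)]]
  show "op_tensor G q g h (tensor u v) \<in> R2" if "u \<in> R" "v \<in> words" for u v
    unfolding * by (intro tensor_relations2_left tensor_operator_relations[OF assms(1)]
        tensor_operator_words[OF assms(2)] parity_R that)
  show "op_tensor G q g h (tensor u v) \<in> R2" if "u \<in> words" "v \<in> R" for u v
    unfolding * by (intro tensor_relations2_right tensor_operator_words[OF assms(1)]
        tensor_operator_relations[OF assms(2)] parity_words that)
qed

lemma op_tensor_in_words2:
  assumes "tensor_operator scale g" "tensor_operator scale h" "t \<in> words2"
  shows "op_tensor G q g h t \<in> words2"
proof (rule lin_mem_keys[OF lin_op_tensor subspace_words2])
  fix p assume "p \<in> Poly_Mapping.keys t"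
  moreover obtain a b where p: "p = (a, b)" by (cases p)
  ultimately have "a \<noteq> []" "b \<noteq> []" using assms(3) by (auto simp: words2_def)
  then show "op_tensor G q g h (gen p) \<in> words2"
    unfolding p tensor_gen[symmetric] op_tensor_tensor[OF tensor_operator_lin[OF assms(1)] tensor_operator_lin[OF assms(2)]]
    by (intro tensor_in_words2 tensor_operator_words[OF assms(1)] tensor_operator_words[OF assms(2)] parity_words)
      (simp_all add: gen_in_words)
qed

lemma Q2_op_tensor:
  assumes "tensor_operator scale g" "tensor_operator scale h" "u \<in> words" "v \<in> words"
  shows "Q2 (op_tensor G 0 g h (tensor u v)) = Q2 (tensor (g u) (h v))"
  unfolding op_tensor_tensor[OF tensor_operator_lin[OF assms(1)] tensor_operator_lin[OF assms(2)]]
  by (rule Q2_tensor_cong[OF Q_operator_cong[OF assms(1) Q_parity_0] refl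
        tensor_operator_words[OF assms(1,3)] tensor_operator_words[OF assms(2,4)]])

text \<open>The operator \<open>f\<^sup>c \<otimes> 1 + 1 \<otimes> f\<^sup>c\<close> from the
  coderivation rule, with Koszul signs.\<close>

definition coder_tensor ::
  "nat \<Rightarrow> int \<Rightarrow> ('v list \<Rightarrow> 'v) \<Rightarrow> ('v list \<times> 'v list \<Rightarrow>\<^sub>0 'k) \<Rightarrow> ('v list \<times> 'v list \<Rightarrow>\<^sub>0 'k)" where
  "coder_tensor i p f t = op_tensor G 0 (coder G i p f) id t + op_tensor G p id (coder G i p f) t"

lemma lin_coder_tensor: "lin (coder_tensor i p f)"
  unfolding coder_tensor_def by (intro lin_plus lin_op_tensor)

lemma Q2_coder_tensor_tensor:
  assumes "multilinear scale (Suc i) f" "u \<in> words" "v \<in> words"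
  shows "Q2 (coder_tensor (Suc i) p f (tensor u v)) =
    Q2 (tensor (coder G (Suc i) p f u) v) + Q2 (tensor (parity G p u) (coder G (Suc i) p f v))"
  using Q2_op_tensor[OF tensor_operator_coder[OF assms(1)] tensor_operator_id assms(2,3)]
  by (simp add: coder_tensor_def Q2_simps op_tensor_tensor[OF tensor_operator_lin[OF tensor_operator_id] lin_coder])

lemma coder_tensor_R2:
  assumes "multilinear scale (Suc i) f" "t \<in> R2"
  shows "coder_tensor (Suc i) p f t \<in> R2"
  unfolding coder_tensor_def
  by (intro free.subspace_add[OF subspace_R2] op_tensor_relations tensor_operator_id
      tensor_operator_coder[OF assms(1)] assms(2))

lemma Q2_coder_tensor_cong:
  "multilinear scale (Suc i) f \<Longrightarrow> Q2 t = Q2 t' \<Longrightarrow> Q2 (coder_tensor (Suc i) p f t) = Q2 (coder_tensor (Suc i) p f t')"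
  by (rule reduce_cong[OF subspace_R2 subspace_R2 lin_coder_tensor coder_tensor_R2])

text \<open>The analogue of \<open>coder_head\<close> on tensors: \<open>f\<close> takes the letter
  x as its first argument, in either factor. In the unary case this is shuffle multiplication by the
  letter f(x) of degree p + m.\<close>

definition coder_tensor_head where
  "coder_tensor_head i p f m x t = (if i = 0 then cons2 G (p + m) (f [x]) t else coder_tensor i (p + m) (\<lambda>ys. f (x # ys)) t)"

lemma coder_head_words: "coder_head i p f m x z \<in> words"
  by (cases i) (simp_all add: coder_head_def cons_in_words coder_words)

lemma Q2_coder_tensor_head:
  assumes f: "multilinear scale (Suc i) f" and uv: "u \<in> words" "v \<in> words"
  shows "Q2 (coder_tensor_head i p f m x (tensor u v)) =
    Q2 (tensor (coder_head i p f m x u) v) + Q2 (tensor (parity G (p + m) u) (coder_head i p f m x v))"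
proof (cases i)
  case (Suc j)
  then have "multilinear scale (Suc j) (\<lambda>ys. f (x # ys))" using f multilinear_Cons by simp
  from Q2_coder_tensor_tensor[OF this uv, of "p + m"] Suc show ?thesis
    by (simp add: coder_tensor_head_def coder_head_def)
qed (simp add: coder_tensor_head_def coder_head_def cons2_tensor Q2_simps)

text \<open>This is the recursion of \<open>coder\<close> carried over to tensors, checked on u
  \<otimes> v. Where x joins the right factor it leaves \<open>parity G m\<close> on u; exchanging
  that with \<open>f\<^sup>c\<close> on u costs the sign with exponent pm, the same as for
  \<open>f\<close> passing x directly, so all terms carry a common sign.\<close>

lemma coder_tensor_cons2:
  assumes f: "multilinear scale (Suc i) f" "graded_map G (Suc i) p f" and x: "x \<in> G m" and t: "t \<in> words2"
  shows "Q2 (coder_tensor (Suc i) p f (cons2 G m x t)) =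
    Q2 (coder_tensor_head i p f m x t) + smul ((-1) powi (p * m)) (Q2 (cons2 G m x (coder_tensor (Suc i) p f t)))"
proof -
  let ?C = "coder G (Suc i) p f"
  let ?H = "coder_head i p f m x"
  let ?s = "(-1 :: 'k) powi (p * m)"
  have lin: "lin (coder_tensor_head i p f m x)"
    unfolding coder_tensor_head_def by (cases "i = 0") (simp_all add: lin_cons2 lin_coder_tensor)
  have "Q2 (coder_tensor (Suc i) p f (cons2 G m x t)) =
    Q2 (coder_tensor_head i p f m x t + smul ?s (cons2 G m x (coder_tensor (Suc i) p f t)))"
  proof (rule words2_tensor_induct[OF t])
    show "lin (\<lambda>t. Q2 (coder_tensor (Suc i) p f (cons2 G m x t)))"
      by (rule lin_compose[OF lin_Q2 lin_compose[OF lin_coder_tensor lin_cons2]])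
    show "lin (\<lambda>t. Q2 (coder_tensor_head i p f m x t + smul ?s (cons2 G m x (coder_tensor (Suc i) p f t))))"
      by (rule lin_compose[OF lin_Q2 lin_plus[OF lin lin_smul_op[OF lin_compose[OF lin_cons2 lin_coder_tensor]]]])
    fix u v :: "'v list \<Rightarrow>\<^sub>0 'k" assume uv: "u \<in> words" "v \<in> words"
    note w = cons_in_words coder_words coder_head_words parity_words uv
      free.subspace_add[OF subspace_words] free.subspace_scale[OF subspace_words]
    have 1: "Q2 (tensor (?C (cons x u)) v) = Q2 (tensor (?H u + smul ?s (cons x (?C u))) v)"
      by (rule Q2_tensor_cong) (auto simp: Q_coder_cons[OF f(1) x] Q_simps w)
    have 2: "Q2 (tensor (parity G p (cons x u)) (?C v)) = Q2 (tensor (smul ?s (cons x (parity G p u))) (?C v))"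
      by (rule Q2_tensor_cong) (auto simp: Q_parity_cons[OF x] Q_simps w)
    have 3: "Q2 (tensor (?C (parity G m u)) (cons x v)) = Q2 (tensor (smul ?s (parity G m (?C u))) (cons x v))"
      by (rule Q2_tensor_cong) (auto simp: Q_parity_coder[OF f] Q_simps w minus_one_powi_square mult.commute[of m])
    have 4: "Q2 (tensor (parity G p (parity G m u)) (?C (cons x v))) =
        Q2 (tensor (parity G (p + m) u) (?H v + smul ?s (cons x (?C v))))"
      by (rule Q2_tensor_cong) (auto simp: Q_coder_cons[OF f(1) x] Q_parity_parity Q_simps w)
    have 5: "Q2 (tensor (parity G m (parity G p u)) (cons x (?C v))) =
        Q2 (tensor (parity G (p + m) u) (cons x (?C v)))"
      by (rule Q2_tensor_cong) (auto simp: Q_parity_parity w add.commute)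
    have 6: "Q2 (cons2 G m x (coder_tensor (Suc i) p f (tensor u v))) =
        Q2 (cons2 G m x (tensor (?C u) v + tensor (parity G p u) (?C v)))"
      by (rule Q2_cons2_cong) (simp add: Q2_coder_tensor_tensor[OF f(1) uv] Q2_simps)
    have 7: "Q2 (coder_tensor (Suc i) p f (cons2 G m x (tensor u v))) =
      Q2 (tensor (?C (cons x u)) v) + Q2 (tensor (parity G p (cons x u)) (?C v)) +
      (Q2 (tensor (?C (parity G m u)) (cons x v)) + Q2 (tensor (parity G p (parity G m u)) (?C (cons x v))))"
      by (simp add: cons2_tensor lin_add[OF lin_coder_tensor] Q2_simps Q2_coder_tensor_tensor[OF f(1)] w)
    show "Q2 (coder_tensor (Suc i) p f (cons2 G m x (tensor u v))) =
      Q2 (coder_tensor_head i p f m x (tensor u v) + smul ?s (cons2 G m x (coder_tensor (Suc i) p f (tensor u v))))"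
      unfolding 7 1 2 3 4
      by (simp add: Q2_simps 6 Q2_coder_tensor_head[OF f(1) uv] tensor_simps lin_simps[OF lin_cons2] cons2_tensor 5
          free.scale_right_distrib)
  qed
  then show ?thesis by (simp add: Q2_simps)
qed

text \<open>The coproduct, \<open>f\<^sup>c\<close> and its action on tensors all satisfy recursions
  along the first letter, and these match. The hypothesis for f(y, ...) settles the terms where
  \<open>f\<close> takes y, the hypothesis for \<open>f\<close> those where y stays in
  front.\<close>

theorem coder_coderivation:
  assumes "multilinear scale (Suc i) f" "graded_map G (Suc i) p f"
  shows "Q2 (comult G (coder G (Suc i) p f z)) = Q2 (coder_tensor (Suc i) p f (comult G z))"
proof -
  let ?E = "\<lambda>i p f z. Q2 (comult G (coder G (Suc i) p f z)) = Q2 (coder_tensor (Suc i) p f (comult G z))"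
  let ?P = "{z. \<forall>a. (case a of (i, p, f) \<Rightarrow> multilinear scale (Suc i) f \<and> graded_map G (Suc i) p f) \<longrightarrow>
    (case a of (i, p, f) \<Rightarrow> ?E i p f z)}"
  have "z \<in> ?P"
  proof (rule word_induct)
    show "free.subspace ?P"
      by (rule subspace_Collect_all)
        (auto intro!: subspace_reduce_eq subspace_R2
          intro: lin_compose[OF lin_comult lin_coder] lin_compose[OF lin_coder_tensor lin_comult])
    show "R \<subseteq> ?P"
      by (auto simp: Q2_0_iff[THEN iffD2] comult_R coder_R coder_tensor_R2)
    show "gen [] \<in> ?P" by (auto simp: lin_0[OF lin_comult] lin_0[OF lin_coder_tensor])
    fix y m z assume y: "y \<in> G m" and IH: "z \<in> ?P"
    have "?E i p f (cons y z)" if f: "multilinear scale (Suc i) f" "graded_map G (Suc i) p f" for i p f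
    proof -
      let ?C = "coder G (Suc i) p f"
      let ?H = "coder_head i p f m y"
      let ?s = "(-1 :: 'k) powi (p * m)"
      \<comment> \<open>The class of \<open>f\<^sup>c\<close> on the one-letter word y: a map of
        higher arity gives zero there.\<close>
      let ?h = "if i = 0 then gen [f [y]] else 0"
      have 1: "Q2 (comult G (?C (cons y z))) = Q2 (comult G (?H z + smul ?s (cons y (?C z))))"
        by (rule Q2_comult_cong) (simp add: Q_coder_cons[OF f(1) y] Q_simps)
      have 2: "Q2 (comult G (cons y (?C z))) =
          Q2 (tensor (gen [y]) (?C z)) + Q2 (cons2 G m y (coder_tensor (Suc i) p f (comult G z)))"
      proof -
        have "?E i p f z" using IH f by auto
        then show ?thesis
          by (simp add: Q2_comult_cons[OF y] drop_Nil_words coder_words Q2_cons2_cong[of "comult G (?C z)"])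
      qed
      have 3: "Q2 (comult G (?H z)) = Q2 (tensor ?h (drop_Nil z)) + Q2 (coder_tensor_head i p f m y (comult G z))"
      proof (cases i)
        case 0
        then show ?thesis
          using graded_map_1[of G p f y m] f y
          by (simp add: coder_head_def coder_tensor_head_def Q2_comult_cons)
      next
        case (Suc j)
        then have "?E j (p + m) (\<lambda>ys. f (y # ys)) z"
          using IH multilinear_Cons[of scale i f y] graded_map_Cons[of G i p f y m] f y by auto
        then show ?thesis
          by (simp add: Suc coder_head_def coder_tensor_head_def lin_0[OF lin_tensor_left] Q2_simps)
      qed
      have 4: "Q2 (coder_tensor (Suc i) p f (comult G (cons y z))) =
          Q2 (coder_tensor (Suc i) p f (tensor (gen [y]) (drop_Nil z) + cons2 G m y (comult G z)))"
        by (rule Q2_coder_tensor_cong[OF f(1)]) (simp add: Q2_comult_cons[OF y] Q2_simps)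
      \<comment> \<open>The coderivation kills the empty word, so removing it beforehand changes
        nothing.\<close>
      have 5: "?C (drop_Nil z) = ?C z"
        by (rule lin_eqI[OF lin_compose[OF lin_coder lin_drop_Nil] lin_coder])
          (simp add: drop_Nil_def lin_0[OF lin_coder])
      have 6: "Q2 (tensor (?C (gen [y])) (drop_Nil z)) = Q2 (tensor ?h (drop_Nil z))"
      proof (rule Q2_tensor_cong)
        have "Q (?C (cons y (gen []))) = Q ?h"
          unfolding Q_coder_cons[OF f(1) y]
          by (cases i) (simp_all add: coder_head_def Q_simps lin_0[OF lin_cons])
        then show "Q (?C (gen [y])) = Q ?h" by simp
      qed (auto simp: gen_in_words drop_Nil_in_words free.subspace_0[OF subspace_words])
      have 7: "Q2 (tensor (parity G p (gen [y])) (?C z)) = Q2 (tensor (smul ?s (gen [y])) (?C z))"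
        by (rule Q2_tensor_cong)
          (use Q_parity_cons[OF y, of p "gen []"] in
            \<open>auto simp: gen_in_words coder_words Q_simps free.subspace_scale[OF subspace_words]\<close>)
      have 8: "Q2 (coder_tensor (Suc i) p f (tensor (gen [y]) (drop_Nil z))) =
          Q2 (tensor ?h (drop_Nil z)) + smul ?s (Q2 (tensor (gen [y]) (?C z)))"
        using Q2_coder_tensor_tensor[OF f(1), of "gen [y]" "drop_Nil z" p]
        by (simp add: gen_in_words drop_Nil_in_words 5 6 7 tensor_simps Q2_simps)
      show ?thesis
        unfolding 1 4
        by (simp add: lin_simps[OF lin_comult] lin_simps[OF lin_coder_tensor] Q2_simps 2 3 8
            coder_tensor_cons2[OF f y comult_words2] free.scale_right_distrib)
    qed
    then show "cons y z \<in> ?P" by auto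
  qed
  then show ?thesis using assms by auto
qed

end

section \<open>Nested brackets of derivations\<close>

lemma minus_one_powi_square_left: "(-1 :: 'k::field) powi n * ((-1) powi n * x) = x"
  by (simp add: minus_one_powi_square flip: mult.assoc)

text \<open>Truncated subtraction gives exponent 0 at both k = 0 and k = 1; the exponents 0, 0, 1,
  ..., i - 1 add up to a triangular number.\<close>

lemma prod_minus_one_powers: "(\<Prod>k<Suc i. (-1 :: 'k::field) ^ (k - 1)) = (-1) ^ (i * (i - 1) div 2)"
proof (induction i)
  case (Suc i)
  have "Suc i * i = i * (i - 1) + 2 * i" by (cases i) simp_all
  then have "Suc i * (Suc i - 1) div 2 = i * (i - 1) div 2 + i" by simp
  moreover have "(\<Prod>k<Suc (Suc i). (-1 :: 'k) ^ (k - 1)) = (\<Prod>k<Suc i. (-1) ^ (k - 1)) * (-1) ^ i"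
    by (subst prod.lessThan_Suc) simp
  ultimately show ?case using Suc by (simp add: power_add)
qed simp

context graded_vector_space
begin

lemma homogeneous_decomposition_susp:
  "homogeneous_decomposition (susp G) x c \<longleftrightarrow> homogeneous_decomposition G x (\<lambda>n. c (n + 1))"
proof -
  have "{n. c n \<noteq> 0} = (\<lambda>n. n + 1) ` {n. c (n + 1) \<noteq> 0}"
  proof (intro equalityI subsetI)
    fix n assume "n \<in> {n. c n \<noteq> 0}"
    then show "n \<in> (\<lambda>n. n + 1) ` {n. c (n + 1) \<noteq> 0}"
      by (intro image_eqI[of _ _ "n - 1"]) simp_all
  qed auto
  moreover have "(\<forall>n. c n \<in> susp G n) \<longleftrightarrow> (\<forall>n. c (n + 1) \<in> G n)"
    unfolding susp_def by (metis add_diff_cancel_right' diff_add_cancel)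
  ultimately show ?thesis
    by (simp add: homogeneous_decomposition_def sum.reindex inj_on_def finite_image_iff)
qed

lemma graded_vector_space_susp: "graded_vector_space scale (susp G)"
proof unfold_locales
  show "subspace (susp G n)" for n by (simp add: susp_def subspace_G)
  fix x
  obtain c where c: "homogeneous_decomposition G x c" "\<And>c'. homogeneous_decomposition G x c' \<Longrightarrow> c' = c"
    using direct_sum[of x] by blast
  show "\<exists>!c. homogeneous_decomposition (susp G) x c"
  proof (rule ex1I[of _ "\<lambda>n. c (n - 1)"])
    fix c' assume "homogeneous_decomposition (susp G) x c'"
    then have "(\<lambda>n. c' (n + 1)) = c" by (intro c(2)) (simp add: homogeneous_decomposition_susp)
    then have "c' (n - 1 + 1) = c (n - 1)" for n by (rule fun_cong)
    then show "c' = (\<lambda>n. c (n - 1))" by (simp add: fun_eq_iff)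
  qed (simp add: homogeneous_decomposition_susp c(1))
qed

end

context leibniz_algebra
begin

lemma br_add_right: "br x (y + z) = br x y + br x z" and br_scale_right: "br x (scale c y) = scale c (br x y)"
  using linear_right[of x] by (simp_all add: Vector_Spaces.linear_iff)

lemma br_add_left: "br (x + y) z = br x z + br y z" and br_scale_left: "br (scale c x) z = scale c (br x z)"
  using linear_left[of z] by (simp_all add: Vector_Spaces.linear_iff)

lemma br_0_left: "br 0 z = 0"
  using br_scale_left[of 0 0 z] by simp

lemma br_minus_left: "br (- x) z = - br x z"
  using br_scale_left[of "-1" x z] by simp

lemma br_diff_left: "br (x - y) z = br x z - br y z"
  using br_add_left[of x "- y" z] by (simp add: br_minus_left)

lemma foldl_br_add: "foldl br (x + y) zs = foldl br x zs + foldl br y zs"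
  by (induction zs arbitrary: x y) (simp_all add: br_add_left)

lemma foldl_br_scale: "foldl br (scale c x) zs = scale c (foldl br x zs)"
  by (induction zs arbitrary: x) (simp_all add: br_scale_left)

lemma foldl_br_0: "foldl br 0 zs = 0"
  by (induction zs) (simp_all add: br_0_left)

lemma foldl_br_graded:
  "x \<in> G m \<Longrightarrow> list_all2 (\<lambda>x d. x \<in> G d) zs ds \<Longrightarrow> foldl br x zs \<in> G (m + sum_list ds)"
proof (induction zs arbitrary: x m ds)
  case (Cons z zs)
  then obtain d ds' where ds: "ds = d # ds'" "z \<in> G d" "list_all2 (\<lambda>x d. x \<in> G d) zs ds'"
    by (auto simp: list_all2_Cons1)
  from Cons.IH[OF degree_br[OF Cons.prems(1) ds(2)] ds(3)] show ?case by (simp add: ds add.assoc)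
qed simp

lemma nested_op_Cons: "nested_op br D (x # xs) = foldl br (D x) xs"
  by (simp add: nested_op_def nested_def)

context
  fixes p :: int and D :: "'v \<Rightarrow> 'v"
  assumes D: "derivation scale G br p D"
begin

lemma derivation_add: "D (x + y) = D x + D y" and derivation_scale: "D (scale c x) = scale c (D x)"
  and derivation_degree: "x \<in> G n \<Longrightarrow> D x \<in> G (n + p)"
  and derivation_br: "x \<in> G n \<Longrightarrow> D (br x y) = br (D x) y + scale ((-1) powi (p * n)) (br x (D y))"
  using D by (auto simp: derivation_def graded_linear_def Vector_Spaces.linear_iff image_subset_iff)

lemma derivation_0: "D 0 = 0"
  using derivation_scale[of 0 0] by simp

lemma multilinear_nested_op: "multilinear scale n (nested_op br D)"
  unfolding multilinear_def
proof (intro allI impI)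
  fix us x y and vs :: "'v list" and c
  show "nested_op br D (us @ (x + y) # vs) = nested_op br D (us @ x # vs) + nested_op br D (us @ y # vs) \<and>
     nested_op br D (us @ scale c x # vs) = scale c (nested_op br D (us @ x # vs))"
    by (cases us) (simp_all add: nested_op_Cons derivation_add derivation_scale foldl_br_add foldl_br_scale
        br_add_right br_scale_right)
qed

lemma graded_map_nested_op: "graded_map G (Suc n) p (nested_op br D)"
  unfolding graded_map_def
proof (intro allI impI)
  fix xs ds assume "length xs = Suc n" "list_all2 (\<lambda>x d. x \<in> G d) xs ds"
  then obtain x xs' d ds' where *: "xs = x # xs'" "ds = d # ds'" "x \<in> G d" "list_all2 (\<lambda>x d. x \<in> G d) xs' ds'"
    by (cases xs; cases ds) auto
  from foldl_br_graded[OF derivation_degree[OF *(3)] *(4)]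
  show "nested_op br D xs \<in> G (p + sum_list ds)"
    by (simp add: * nested_op_Cons ac_simps)
qed

end

text \<open>For the left bracket by y, the derivation rule is exactly the left Leibniz
  identity.\<close>

lemma derivation_inner: "y \<in> G n \<Longrightarrow> derivation scale G br n (br y)"
  unfolding derivation_def graded_linear_def
proof (intro conjI allI ballI linear_right)
  show "br y ` G m \<subseteq> G (m + n)" if "y \<in> G n" for m
    using degree_br[OF that, of _ m] by (auto simp: add.commute)
qed (rule leibniz)

definition graded_commutator :: "int \<Rightarrow> int \<Rightarrow> ('v \<Rightarrow> 'v) \<Rightarrow> ('v \<Rightarrow> 'v) \<Rightarrow> 'v \<Rightarrow> 'v" where
  "graded_commutator p q A B x = A (B x) - scale ((-1) powi (p * q)) (B (A x))"

lemma derivation_graded_commutator: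
  assumes A: "derivation scale G br p A" and B: "derivation scale G br q B"
  shows "derivation scale G br (p + q) (graded_commutator p q A B)"
  unfolding derivation_def graded_linear_def Vector_Spaces.linear_iff
proof (intro conjI allI ballI subsetI)
  note lin = derivation_add[OF A] derivation_add[OF B] derivation_scale[OF A] derivation_scale[OF B]
  show "graded_commutator p q A B (x + y) = graded_commutator p q A B x + graded_commutator p q A B y" for x y
    by (simp add: graded_commutator_def lin scale_right_distrib)
  show "graded_commutator p q A B (scale c x) = scale c (graded_commutator p q A B x)" for c x
    by (simp add: graded_commutator_def lin scale_right_diff_distrib mult.commute)
  show "y \<in> G (n + (p + q))" if *: "y \<in> graded_commutator p q A B ` G n" for n y
  proof -
    obtain x where x: "x \<in> G n" "y = graded_commutator p q A B x" using * by blast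
    have "A (B x) \<in> G (n + (p + q))" "B (A x) \<in> G (n + (p + q))"
      using derivation_degree[OF A derivation_degree[OF B x(1)]]
        derivation_degree[OF B derivation_degree[OF A x(1)]] by (simp_all add: ac_simps)
    then show ?thesis
      by (simp add: x(2) graded_commutator_def subspace_diff subspace_scale subspace_G)
  qed
  show "graded_commutator p q A B (br x y) = br (graded_commutator p q A B x) y
    + scale ((-1) powi ((p + q) * n)) (br x (graded_commutator p q A B y))" if x: "x \<in> G n" for n x y
  proof -
    have neg: "br x (- y) = - br x y" for x y using br_scale_right[of x "-1" y] by simp
    have diff: "br x (y - z) = br x y - br x z" for x y z
      using br_add_right[of x y "- z"] by (simp add: neg)
    show ?thesis
      by (simp add: graded_commutator_def derivation_br[OF A x] derivation_br[OF B x] lin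
          derivation_br[OF A derivation_degree[OF B x]] derivation_br[OF B derivation_degree[OF A x]]
          br_diff_left br_scale_left diff br_scale_right
          scale_right_distrib scale_right_diff_distrib ring_distribs minus_one_powi_add mult_ac minus_one_powi_square minus_one_powi_square_left)
  qed
qed (simp_all add: vector_space_axioms)

text \<open>\<open>nested_coder i p D\<close> is \<open>N\<^sub>i\<^sub>+\<^sub>1\<^sup>cD\<close> for \<open>D\<close> of degree \<open>p\<close>.\<close>

definition nested_coder :: "nat \<Rightarrow> int \<Rightarrow> ('v \<Rightarrow> 'v) \<Rightarrow> ('v list \<Rightarrow>\<^sub>0 'k) \<Rightarrow> ('v list \<Rightarrow>\<^sub>0 'k)" where
  "nested_coder i p D = coder G (Suc i) p (nested_op br D)"

lemma lin_nested_coder: "lin (nested_coder i p D)"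
  unfolding nested_coder_def by (rule lin_coder)

lemma nested_coder_Nil [simp]: "nested_coder i p D (gen []) = 0"
  by (simp add: nested_coder_def)

lemma nested_coder_R: "derivation scale G br p D \<Longrightarrow> z \<in> R \<Longrightarrow> nested_coder i q D z \<in> R"
  unfolding nested_coder_def by (rule coder_R[OF multilinear_nested_op])

lemma Q_nested_coder_cong:
  "derivation scale G br p D \<Longrightarrow> Q z = Q z' \<Longrightarrow> Q (nested_coder i q D z) = Q (nested_coder i q D z')"
  by (rule reduce_cong[OF subspace_R subspace_R lin_nested_coder nested_coder_R])

lemma Q_nested_coder_lin:
  assumes "\<And>x. D x = scale c (A x) + scale e (B x)"
  shows "Q (nested_coder i p D z) = smul c (Q (nested_coder i p A z)) + smul e (Q (nested_coder i p B z))"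
  unfolding nested_coder_def
proof (rule Q_coder_lin)
  fix ys :: "'v list" assume "length ys = Suc i"
  then show "nested_op br D ys = scale c (nested_op br A ys) + scale e (nested_op br B ys)"
    by (cases ys) (simp_all add: nested_op_Cons assms foldl_br_add foldl_br_scale)
qed

lemma Q_nested_coder_scale:
  "(\<And>x. D x = scale c (A x)) \<Longrightarrow> Q (nested_coder i p D z) = smul c (Q (nested_coder i p A z))"
  using Q_nested_coder_lin[of D c A 0 A] by simp

lemma Q_nested_coder_cons:
  assumes "derivation scale G br p D" "y \<in> G m"
  shows "Q (nested_coder i p D (cons y z)) =
    (if i = 0 then Q (cons (D y) z) else Q (nested_coder (i - 1) (p + m) (br (D y)) z)) +
    smul ((-1) powi (p * m)) (Q (cons y (nested_coder i p D z)))"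
proof (cases i)
  case (Suc j)
  have "coder G (Suc j) (p + m) (\<lambda>ys. nested_op br D (y # ys)) z = coder G (Suc j) (p + m) (nested_op br (br (D y))) z"
  proof (rule coder_cong)
    fix ys :: "'v list" assume "length ys = Suc j"
    then show "nested_op br D (y # ys) = nested_op br (br (D y)) ys"
      by (cases ys) (simp_all add: nested_op_Cons)
  qed
  with Suc show ?thesis
    using Q_coder_cons[OF multilinear_nested_op[OF assms(1)] assms(2), of i p z]
    by (simp add: nested_coder_def coder_head_def)
next
  case 0
  then show ?thesis
    using Q_coder_cons[OF multilinear_nested_op[OF assms(1)] assms(2), of i p z]
    by (simp add: nested_coder_def coder_head_def nested_op_Cons)
qed

text \<open>Two uses of the recursion: \<open>B\<close> takes y or passes it, then \<open>A\<close>
  acts. If j = 0, \<open>B\<close> leaves the letter B y of degree m + q in front, which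
  \<open>A\<close> may take in turn.\<close>

lemma Q_nested_coder_nested_coder_cons:
  assumes A: "derivation scale G br p A" and B: "derivation scale G br q B" and y: "y \<in> G m"
  shows "Q (nested_coder i p A (nested_coder j q B (cons y z))) =
    (if j = 0 then
       (if i = 0 then Q (cons (A (B y)) z) else Q (nested_coder (i - 1) (p + (m + q)) (br (A (B y))) z)) +
       smul ((-1) powi (p * (m + q))) (Q (cons (B y) (nested_coder i p A z)))
     else Q (nested_coder i p A (nested_coder (j - 1) (q + m) (br (B y)) z))) +
    smul ((-1) powi (q * m))
      ((if i = 0 then Q (cons (A y) (nested_coder j q B z))
        else Q (nested_coder (i - 1) (p + m) (br (A y)) (nested_coder j q B z))) +
      smul ((-1) powi (p * m)) (Q (cons y (nested_coder i p A (nested_coder j q B z)))))"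
proof -
  let ?H = "if j = 0 then cons (B y) z else nested_coder (j - 1) (q + m) (br (B y)) z"
  have "Q (nested_coder i p A (nested_coder j q B (cons y z))) =
    Q (nested_coder i p A (?H + smul ((-1) powi (q * m)) (cons y (nested_coder j q B z))))"
    by (rule Q_nested_coder_cong[OF A]) (simp add: Q_nested_coder_cons[OF B y] Q_simps)
  also have "\<dots> = Q (nested_coder i p A ?H) + smul ((-1) powi (q * m)) (Q (nested_coder i p A (cons y (nested_coder j q B z))))"
    by (simp only: lin_simps[OF lin_nested_coder] Q_simps)
  finally show ?thesis
    by (simp add: Q_nested_coder_cons[OF A y] Q_nested_coder_cons[OF A derivation_degree[OF B y]])
qed

text \<open>Expand both compositions along the first letter y. Where y is consumed, the induction
  hypothesis is applied to the pairs (ad(Ay), B) and (A, ad(By)), whose degrees and arities differ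
  from those of (A, B). The resulting inner derivations ad(A(By)) and ad(B(Ay)) combine to the inner
  derivation of [A, B]y, and the mixed terms cancel.\<close>

theorem nested_coder_commutator:
  assumes "derivation scale G br p A" "derivation scale G br q B"
  shows "Q (nested_coder i p A (nested_coder j q B z)) - smul ((-1) powi (p * q)) (Q (nested_coder j q B (nested_coder i p A z)))
    = Q (nested_coder (i + j) (p + q) (graded_commutator p q A B) z)"
proof -
  let ?L = "\<lambda>i j p q A B z. nested_coder i p A (nested_coder j q B z) - smul ((-1) powi (p * q)) (nested_coder j q B (nested_coder i p A z))"
  let ?E = "\<lambda>i j p q A B z. Q (?L i j p q A B z) = Q (nested_coder (i + j) (p + q) (graded_commutator p q A B) z)"
  let ?P = "{z. \<forall>a. (case a of (i, j, p, q, A, B) \<Rightarrow> derivation scale G br p A \<and> derivation scale G br q B) \<longrightarrow>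
    (case a of (i :: nat, j, p, q, A, B) \<Rightarrow> ?E i j p q A B z)}"
  have "z \<in> ?P"
  proof (rule word_induct)
    have "free.subspace {z. ?E i j p q A B z}" for i j p q A B
      by (intro subspace_reduce_eq subspace_R lin_minus_op lin_smul_op lin_nested_coder
          lin_compose[OF lin_nested_coder lin_nested_coder])
    then show "free.subspace ?P" by (intro subspace_Collect_all) (simp add: case_prod_unfold)
    show "R \<subseteq> ?P"
      by (auto simp: Q_simps Q_0_iff[THEN iffD2] nested_coder_R nested_coder_R[OF derivation_graded_commutator])
    show "gen [] \<in> ?P" by (auto simp: lin_0[OF lin_nested_coder])
    fix y m z assume y: "y \<in> G m" and IH0: "z \<in> ?P"
    have IH: "?E i j p q A B z" if "derivation scale G br p A" "derivation scale G br q B" for i j p q A B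
      using IH0 that by auto
    have "?E i j p q A B (cons y z)"
      if A: "derivation scale G br p A" and B: "derivation scale G br q B" for i j p q A B
    proof -
      let ?T = "nested_coder"
      let ?s = "\<lambda>n :: int. (-1 :: 'k) powi n"
      have IHy: "Q (cons y (?L i j p q A B z)) = Q (cons y (?T (i + j) (p + q) (graded_commutator p q A B) z))"
        by (rule Q_cons_cong[OF IH[OF A B]])
      then have IHy: "Q (cons y (?T i p A (?T j q B z))) =
        smul (?s (p * q)) (Q (cons y (?T j q B (?T i p A z)))) + Q (cons y (?T (i + j) (p + q) (graded_commutator p q A B) z))"
        by (simp add: lin_simps[OF lin_cons] Q_simps diff_eq_eq add.commute)
      \<comment> \<open>The commutator of ad(Ay) with B is minus ad(B(Ay)) up to the sign of
        exchanging Ay and B, because B is a derivation.\<close>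
      have IHA: "Q (?T k (p + m) (br (A y)) (?T j q B z)) =
        smul (?s ((p + m) * q)) (Q (?T j q B (?T k (p + m) (br (A y)) z))) -
        smul (?s ((p + m) * q)) (Q (?T (k + j) (p + m + q) (br (B (A y))) z))" for k
      proof -
        have "Q (?T (k + j) (p + m + q) (graded_commutator (p + m) q (br (A y)) B) z) =
          smul (- ?s ((p + m) * q)) (Q (?T (k + j) (p + m + q) (br (B (A y))) z))"
          by (rule Q_nested_coder_scale)
            (simp add: graded_commutator_def derivation_br[OF B derivation_degree[OF A y]] scale_right_distrib
              ring_distribs minus_one_powi_add mult_ac minus_one_powi_square minus_one_powi_square_left add.commute)
        with IH[OF derivation_inner[OF derivation_degree[OF A y]] B, of k j] show ?thesis
          by (simp add: Q_simps diff_eq_eq add.commute[of m p])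
      qed
      \<comment> \<open>Here A is on the left, so its commutator with ad(By) is ad(A(By)) without a
        further sign.\<close>
      have IHB: "Q (?T i p A (?T k (q + m) (br (B y)) z)) =
        smul (?s (p * (q + m))) (Q (?T k (q + m) (br (B y)) (?T i p A z))) +
        Q (?T (i + k) (p + (q + m)) (br (A (B y))) z)" for k
      proof -
        have "graded_commutator p (q + m) A (br (B y)) = br (A (B y))"
          by (simp add: fun_eq_iff graded_commutator_def derivation_br[OF A derivation_degree[OF B y]] add.commute)
        with IH[OF A derivation_inner[OF derivation_degree[OF B y]], of i k] show ?thesis
          by (simp add: Q_simps diff_eq_eq add.commute)
      qed
      have gc: "Q (?T k r (br (graded_commutator p q A B y)) z) =
          Q (?T k r (br (A (B y))) z) - smul (?s (p * q)) (Q (?T k r (br (B (A y))) z))" for k r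
        using Q_nested_coder_lin[of "br (graded_commutator p q A B y)" 1 "br (A (B y))" "- ?s (p * q)" "br (B (A y))"]
        by (simp add: graded_commutator_def br_diff_left br_scale_left)
      have gc0: "Q (cons (graded_commutator p q A B y) z) =
          Q (cons (A (B y)) z) - smul (?s (p * q)) (Q (cons (B (A y)) z))"
        using Q_cons_lin[of 1 "A (B y)" "- ?s (p * q)" "B (A y)" z] by (simp add: graded_commutator_def)
      have 1: "Q (?L i j p q A B (cons y z)) = Q (?T i p A (?T j q B (cons y z))) - smul (?s (p * q)) (Q (?T j q B (?T i p A (cons y z))))"
        by (simp add: Q_simps)
      note R = Q_nested_coder_cons[OF derivation_graded_commutator[OF A B] y]
      note sgns = free.scale_right_distrib free.scale_right_diff_distrib ring_distribs minus_one_powi_add mult_ac minus_one_powi_square minus_one_powi_square_left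
      show ?thesis
        unfolding 1 R Q_nested_coder_nested_coder_cons[OF A B y] Q_nested_coder_nested_coder_cons[OF B A y] IHy IHA IHB gc gc0
        \<comment> \<open>In arity one the consumed letter stays visible in the word, hence four
          cases.\<close>
        by (cases i; cases j) (simp_all add: sgns add_ac)
    qed
    then show "cons y z \<in> ?P" by auto
  qed
  then show ?thesis using assms by (auto simp: Q_simps)
qed

end

section \<open>Exponentials\<close>

text \<open>The strict bound makes \<open>short_words 0\<close> the zero space, so L shortening
  steps annihilate \<open>short_words L\<close>.\<close>

definition short_words :: "nat \<Rightarrow> ('v list \<Rightarrow>\<^sub>0 'k::field) set" where
  "short_words L = {z. Poly_Mapping.keys z \<subseteq> {w. length w < L}}"

lemma subspace_short_words: "free.subspace (short_words L)"
  unfolding short_words_def by (rule subspace_keys)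

lemma short_words_0: "z \<in> short_words 0 \<Longrightarrow> z = 0"
  by (simp add: short_words_def)

lemma short_words_mono: "z \<in> short_words L \<Longrightarrow> L \<le> M \<Longrightarrow> z \<in> short_words M"
  by (auto simp: short_words_def)

lemma gen_short_words: "gen w \<in> short_words L \<longleftrightarrow> length w < L"
  by (simp add: short_words_def)

lemma ex_short_words: "\<exists>L. z \<in> short_words L"
proof
  show "z \<in> short_words (Suc (\<Sum>w\<in>Poly_Mapping.keys z. length w))"
    by (auto simp: short_words_def less_Suc_eq_le intro: member_le_sum)
qed

text \<open>The number of summands depends on the argument, but two arguments share a length bound
  and hence a common finite sum of linear maps.\<close>

lemma lin_of_truncations:
  assumes f: "\<And>L z. z \<in> short_words L \<Longrightarrow> f z = (\<Sum>i<L. g i z)" and g: "\<And>i. lin (g i)"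
  shows "lin f"
proof (rule linI)
  fix x y :: "'a list \<Rightarrow>\<^sub>0 'b" and c
  obtain L M where "x \<in> short_words L" "y \<in> short_words M" using ex_short_words by metis
  then have *: "x \<in> short_words (max L M)" "y \<in> short_words (max L M)"
    using short_words_mono max.cobounded1 max.cobounded2 by blast+
  then have "x + y \<in> short_words (max L M)" "smul c x \<in> short_words (max L M)"
    by (simp_all add: free.subspace_add[OF subspace_short_words] free.subspace_scale[OF subspace_short_words])
  note f = f[OF this(1)] f[OF this(2)] f[OF *(1)] f[OF *(2)]
  show "f (x + y) = f x + f y" "f (smul c x) = smul c (f x)"
    by (simp_all only: f lin_simps[OF g] sum.distrib free.scale_sum_right)
qed

text \<open>An abstract binomial theorem whose induction step is Pascal's rule. A family
  \<open>H\<close> instead of two operators also covers commutators and tensor products of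
  operators.\<close>

lemma sum_binomial_recursion:
  fixes H :: "nat \<Rightarrow> nat \<Rightarrow> nat \<Rightarrow> ('x \<Rightarrow>\<^sub>0 'k::field_char_0)"
  assumes "\<And>n a b. H (Suc n) a b = H n (Suc a) b + H n a (Suc b)"
  shows "H n a b = (\<Sum>k\<le>n. smul (of_nat (n choose k)) (H 0 (a + k) (b + (n - k))))"
proof (induction n arbitrary: a b)
  case (Suc n)
  let ?g = "\<lambda>k l. H 0 (a + k) (b + l)"
  have "H (Suc n) a b = (\<Sum>k\<le>n. smul (of_nat (n choose k)) (?g (Suc k) (n - k))) +
      (\<Sum>k\<le>n. smul (of_nat (n choose k)) (?g k (Suc n - k)))"
    by (simp add: assms Suc.IH Suc_diff_le)
  also have "(\<Sum>k\<le>n. smul (of_nat (n choose k)) (?g k (Suc n - k))) =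
      (\<Sum>k\<le>Suc n. smul (of_nat (n choose k)) (?g k (Suc n - k)))"
    by (simp add: binomial_eq_0)
  also have "\<dots> = ?g 0 (Suc n) + (\<Sum>k\<le>n. smul (of_nat (n choose Suc k)) (?g (Suc k) (n - k)))"
    by (subst sum.atMost_Suc_shift) simp
  also have "(\<Sum>k\<le>n. smul (of_nat (n choose k)) (?g (Suc k) (n - k))) +
      (?g 0 (Suc n) + (\<Sum>k\<le>n. smul (of_nat (n choose Suc k)) (?g (Suc k) (n - k)))) =
      ?g 0 (Suc n) + (\<Sum>k\<le>n. smul (of_nat (Suc n choose Suc k)) (?g (Suc k) (n - k)))"
    by (simp add: sum.distrib[symmetric] free.scale_left_distrib add_ac)
  also have "\<dots> = (\<Sum>k\<le>Suc n. smul (of_nat (Suc n choose k)) (?g k (Suc n - k)))"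
    by (subst sum.atMost_Suc_shift) simp
  finally show ?case .
qed simp

text \<open>The formal identity \<open>exp (A + B) = exp A exp B\<close> for commuting \<open>A\<close> and \<open>B\<close>, where
  \<open>H n a b\<close> stands for \<open>(A + B)\<^sup>n A\<^sup>a B\<^sup>b\<close>.\<close>

lemma exp_product:
  fixes H :: "nat \<Rightarrow> nat \<Rightarrow> nat \<Rightarrow> ('x \<Rightarrow>\<^sub>0 'k::field_char_0)"
  assumes H: "\<And>n a b. H (Suc n) a b = H n (Suc a) b + H n a (Suc b)"
    and zero: "\<And>a b. a + b \<ge> N \<Longrightarrow> H 0 a b = 0"
  shows "(\<Sum>n<N. smul (1 / fact n) (H n 0 0)) =
    (\<Sum>a<N. \<Sum>b<N. smul (1 / fact a) (smul (1 / fact b) (H 0 a b)))"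
    and "n \<ge> N \<Longrightarrow> H n 0 0 = 0"
proof -
  show "H n 0 0 = 0" if "n \<ge> N"
    unfolding sum_binomial_recursion[of H n 0 0, OF H] using zero that by simp
  let ?f = "\<lambda>a b. smul (1 / fact a) (smul (1 / fact b) (H 0 a b))"
  have "smul (1 / fact n) (H n 0 0) = (\<Sum>k\<le>n. ?f k (n - k))" for n
    unfolding sum_binomial_recursion[of H n 0 0, OF H] free.scale_sum_right
    by (intro sum.cong refl) (simp add: binomial_fact)
  then have "(\<Sum>n<N. smul (1 / fact n) (H n 0 0)) = (\<Sum>(a, b)\<in>{(a, b). a + b < N}. ?f a b)"
    by (simp add: sum.triangle_reindex)
  \<comment> \<open>The triangle may be filled up to a square because terms with a + b \<ge> N
    vanish.\<close>
  also have "\<dots> = (\<Sum>(a, b)\<in>{..<N} \<times> {..<N}. ?f a b)"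
  proof (rule sum.mono_neutral_left)
    show "\<forall>p\<in>{..<N} \<times> {..<N} - {(a, b). a + b < N}. (case p of (a, b) \<Rightarrow> ?f a b) = 0"
      by (auto, erule contrapos_np, rule zero, simp)
  qed auto
  also have "\<dots> = (\<Sum>a<N. \<Sum>b<N. ?f a b)"
    by (simp add: sum.cartesian_product)
  finally show "(\<Sum>n<N. smul (1 / fact n) (H n 0 0)) = (\<Sum>a<N. \<Sum>b<N. ?f a b)" .
qed

locale shortening =
  fixes X :: "('v list \<Rightarrow>\<^sub>0 'k::field_char_0) \<Rightarrow> ('v list \<Rightarrow>\<^sub>0 'k)"
  assumes lin_X: "lin X"
    and shortens: "z \<in> short_words (Suc L) \<Longrightarrow> X z \<in> short_words L"
begin

lemma shortening_uminus: "shortening (\<lambda>z. - X z)"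
proof (rule shortening.intro)
  show "lin (\<lambda>z. - X z)" using lin_X by (rule lin_uminus)
  show "- X z \<in> short_words L" if "z \<in> short_words (Suc L)" for z L
    using shortens[OF that] by (rule free.subspace_neg[OF subspace_short_words])
qed

lemma shortens_funpow: "z \<in> short_words L \<Longrightarrow> (X ^^ n) z \<in> short_words (L - n)"
proof (induction n)
  case (Suc n)
  show ?case
  proof (cases "L - n")
    case 0
    then have "(X ^^ n) z = 0" using Suc short_words_0 by simp
    then show ?thesis by (simp add: lin_0[OF lin_X] free.subspace_0[OF subspace_short_words])
  next
    case (Suc m)
    then have "L - Suc n = m" by simp
    then show ?thesis using shortens[of "(X ^^ n) z" m] Suc Suc.IH Suc.prems by simp
  qed
qed simp

lemma funpow_eq_0:
  assumes "z \<in> short_words L" "L \<le> n"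
  shows "(X ^^ n) z = 0"
  using shortens_funpow[OF assms(1), of n] assms(2) short_words_0 by simp

lemma op_exp_eq:
  assumes "z \<in> short_words L" "L \<le> M"
  shows "op_exp X z = (\<Sum>n<M. smul (1 / fact n) ((X ^^ n) z))"
  unfolding op_exp_def
proof (rule Sum_any.expand_superset)
  show "{n. smul (1 / fact n) ((X ^^ n) z) \<noteq> 0} \<subseteq> {..<M}"
  proof
    fix n assume "n \<in> {n. smul (1 / fact n) ((X ^^ n) z) \<noteq> 0}"
    then have "(X ^^ n) z \<noteq> 0" by auto
    then have "\<not> L \<le> n" using funpow_eq_0[OF assms(1)] by blast
    then show "n \<in> {..<M}" using assms(2) by simp
  qed
qed simp

lemma lin_op_exp: "lin (op_exp X)"
proof (rule lin_of_truncations[where g = "\<lambda>n z. smul (1 / fact n) ((X ^^ n) z)"])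
  show "op_exp X z = (\<Sum>n<L. smul (1 / fact n) ((X ^^ n) z))" if "z \<in> short_words L" for L z
    by (rule op_exp_eq[OF that order_refl])
qed (rule lin_smul_op[OF lin_funpow[OF lin_X]])

text \<open>On each argument the exponential is a finite linear combination of powers. Applied to
  \<open>words\<close>, the relations, length bounds and graded pieces.\<close>

lemma op_exp_mem:
  assumes "free.subspace S" "\<And>z. z \<in> S \<Longrightarrow> X z \<in> S" "z \<in> S"
  shows "op_exp X z \<in> S"
proof -
  have "(X ^^ n) z \<in> S" for n by (induction n) (simp_all add: assms)
  moreover obtain L where "z \<in> short_words L" using ex_short_words by blast
  ultimately show ?thesis
    by (simp add: op_exp_eq[OF _ order_refl] free.subspace_sum free.subspace_scale assms(1))
qed

lemma op_exp_short_words: "z \<in> short_words L \<Longrightarrow> op_exp X z \<in> short_words L"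
proof (rule op_exp_mem[OF subspace_short_words])
  show "X z \<in> short_words L" if "z \<in> short_words L" for z
    by (rule shortens[OF short_words_mono[OF that]]) simp
qed

lemma op_exp_uminus: "op_exp (\<lambda>z. - X z) (op_exp X z) = z"
proof -
  interpret minus: shortening "\<lambda>z. - X z" by (rule shortening_uminus)
  obtain L where "z \<in> short_words L" using ex_short_words by blast
  \<comment> \<open>A positive bound guarantees that the sums contain the term for n = 0.\<close>
  then have z: "z \<in> short_words (Suc L)" using short_words_mono by fastforce
  let ?N = "Suc L"
  let ?Y = "\<lambda>z. - X z"
  \<comment> \<open>The commuting operators are -X and X, with sum zero, so the powers of the sum
    vanish except the zeroth.\<close>
  let ?H = "\<lambda>n a b. if n = (0 :: nat) then (?Y ^^ a) ((X ^^ b) z) else 0"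
  have lin: "lin (?Y ^^ a)" for a by (rule lin_funpow[OF minus.lin_X])
  have H: "?H (Suc n) a b = ?H n (Suc a) b + ?H n a (Suc b)" for n a b
    by (simp add: funpow_swap1[of ?Y] lin_simps[OF lin])
  have zero: "?H 0 a b = 0" if "a + b \<ge> ?N" for a b
    using minus.funpow_eq_0[OF shortens_funpow[OF z], of b a] that by simp
  have "op_exp ?Y (op_exp X z) = (\<Sum>a<?N. smul (1 / fact a) ((?Y ^^ a) (op_exp X z)))"
    by (rule minus.op_exp_eq[OF op_exp_short_words[OF z] order_refl])
  also have "\<dots> = (\<Sum>a<?N. \<Sum>b<?N. smul (1 / fact a) (smul (1 / fact b) ((?Y ^^ a) ((X ^^ b) z))))"
    by (simp only: op_exp_eq[OF z order_refl] lin_simps[OF lin] free.scale_sum_right)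
  also have "\<dots> = (\<Sum>n<?N. smul (1 / fact n) (?H n 0 0))"
    by (subst exp_product(1)[of ?H, OF H zero]) (simp_all only: if_True simp_thms)
  also have "\<dots> = z"
    by (subst sum.lessThan_Suc_shift) simp
  finally show ?thesis .
qed

lemma op_exp_uminus': "op_exp X (op_exp (\<lambda>z. - X z) z) = z"
  using shortening.op_exp_uminus[OF shortening_uminus] by simp

context
  fixes D :: "('v list \<Rightarrow>\<^sub>0 'k) \<Rightarrow> ('v list \<Rightarrow>\<^sub>0 'k)"
  assumes lin_D: "lin D" and D: "\<And>L z. z \<in> short_words L \<Longrightarrow> D z \<in> short_words L"
begin

text \<open>Taking commutators with X is the sum of two commuting operations on D: composing with -X
  on the left and with X on the right. The exponential of the sum is therefore conjugation by the
  exponential of X.\<close>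

lemma op_exp_ad:
  assumes z: "z \<in> short_words N"
  shows "op_exp_ad X D z = (\<Sum>n<N. smul (1 / fact n) ((op_ad X ^^ n) D z))"
    and "op_exp_ad X D z = op_exp (\<lambda>z. - X z) (D (op_exp X z))"
proof -
  interpret minus: shortening "\<lambda>z. - X z" by (rule shortening_uminus)
  let ?Y = "\<lambda>z. - X z"
  let ?H = "\<lambda>n a b. (?Y ^^ a) (((op_ad X ^^ n) D) ((X ^^ b) z))"
  have lin: "lin (?Y ^^ a)" for a by (rule lin_funpow[OF minus.lin_X])
  have H: "?H (Suc n) a b = ?H n (Suc a) b + ?H n a (Suc b)" for n a b
    by (simp add: op_ad_def funpow_swap1[of ?Y] lin_simps[OF lin])
  have zero: "?H 0 a b = 0" if "a + b \<ge> N" for a b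
    using minus.funpow_eq_0[OF D[OF shortens_funpow[OF z]], of b a] that by simp
  note ep = exp_product[of ?H, OF H zero]
  show 1: "op_exp_ad X D z = (\<Sum>n<N. smul (1 / fact n) ((op_ad X ^^ n) D z))"
    unfolding op_exp_ad_def
  proof (rule Sum_any.expand_superset)
    show "{n. smul (1 / fact n) ((op_ad X ^^ n) D z) \<noteq> 0} \<subseteq> {..<N}"
    proof
      fix n assume "n \<in> {n. smul (1 / fact n) ((op_ad X ^^ n) D z) \<noteq> 0}"
      then have "(op_ad X ^^ n) D z \<noteq> 0" by auto
      then have "\<not> N \<le> n" using ep(2)[of n] by auto
      then show "n \<in> {..<N}" by simp
    qed
  qed simp
  have "op_exp ?Y (D (op_exp X z)) = (\<Sum>a<N. smul (1 / fact a) ((?Y ^^ a) (D (op_exp X z))))"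
    by (rule minus.op_exp_eq[OF D[OF op_exp_short_words[OF z]] order_refl])
  also have "\<dots> = (\<Sum>a<N. \<Sum>b<N. smul (1 / fact a) (smul (1 / fact b) ((?Y ^^ a) (D ((X ^^ b) z)))))"
    by (simp only: op_exp_eq[OF z order_refl] lin_simps[OF lin] lin_simps[OF lin_D] free.scale_sum_right)
  finally show "op_exp_ad X D z = op_exp ?Y (D (op_exp X z))"
    unfolding 1 using ep(1) by simp
qed

end

end

section \<open>Coderivations shorten words\<close>

lemma length_listset: "ys \<in> listset As \<Longrightarrow> length ys = length As"
  by (induction As arbitrary: ys) (auto simp: set_Cons_def)

lemma keys_coder_word:
  "Poly_Mapping.keys (coder_word G (Suc i) p f xs :: _ \<Rightarrow>\<^sub>0 'k::field) \<subseteq> {u. length u + i = length xs}"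
proof (induction xs arbitrary: i p f)
  case (Cons x xs)
  let ?S = "{z :: _ \<Rightarrow>\<^sub>0 'k. Poly_Mapping.keys z \<subseteq> {u. length u + i = length (x # xs)}}"
  have "cons x (coder_word G (Suc i) p f xs) \<in> ?S"
    by (rule lin_mem_keys[OF lin_cons subspace_keys]) (use Cons[of i p f] in auto)
  moreover have "(if i = 0 then gen (f [x] # xs) else coder_word G i (p + deg G x) (\<lambda>ys. f (x # ys)) xs) \<in> ?S"
  proof (cases i)
    case (Suc j)
    then show ?thesis using Cons[of j "p + deg G x" "\<lambda>ys. f (x # ys)"] by auto
  qed simp
  ultimately have "coder_word G (Suc i) p f (x # xs) \<in> ?S"
    unfolding coder_word_Cons
    by (intro free.subspace_add[OF subspace_keys] free.subspace_scale[OF subspace_keys])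
  then show ?case by simp
qed simp

lemma coder_short_words:
  assumes "z \<in> short_words L"
  shows "coder G (Suc i) p f z \<in> short_words (L - i)"
  unfolding coder_def
proof (rule lin_mem_keys[OF lin_linear_extension subspace_short_words])
  fix w assume "w \<in> Poly_Mapping.keys z"
  then have w: "length w < L" using assms by (auto simp: short_words_def)
  have "coder_word G (Suc i) p f ys \<in> short_words (L - i)" if "ys \<in> listset (map (hcomponents G) w)" for ys
    using keys_coder_word[of G i p f ys] w length_listset[OF that] by (fastforce simp: short_words_def)
  then show "word_op G (coder_word G (Suc i) p f) (gen w) \<in> short_words (L - i)"
    unfolding linear_extension_gen hextend_def by (rule free.subspace_sum[OF subspace_short_words])
qed

lemma modulo_class:
  "free.subspace S \<Longrightarrow> z \<in> F \<Longrightarrow> modulo F S `` {z} = {y \<in> F. reduce S z = reduce S y}"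
  by (auto simp: modulo_def reduce_eq_iff)

section \<open>Induced maps on classes\<close>

lemma qmap_conv: "qmap r f X = (\<Union>z\<in>X. r `` {f z})"
  by (auto simp: qmap_def)

lemma qmap_cong:
  fixes S :: "('y \<Rightarrow>\<^sub>0 'k::field) set"
  assumes S: "free.subspace S"
    and "\<And>z. z \<in> X \<Longrightarrow> f z \<in> F" "\<And>z. z \<in> X \<Longrightarrow> g z \<in> F" "\<And>z. z \<in> X \<Longrightarrow> reduce S (f z) = reduce S (g z)"
  shows "qmap (modulo F S) f X = qmap (modulo F S) g X"
proof -
  have "modulo F S `` {f z} = modulo F S `` {g z}" if "z \<in> X" for z
    by (simp only: modulo_class[OF S] assms(2-4)[OF that])
  then have "(\<Union>z\<in>X. modulo F S `` {f z}) = (\<Union>z\<in>X. modulo F S `` {g z})" by simp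
  then show ?thesis by (simp only: qmap_conv)
qed

lemma qmap_class:
  fixes S :: "('x \<Rightarrow>\<^sub>0 'k::field) set"
  assumes S: "free.subspace S" "free.subspace S'" and f: "lin f" "\<And>z. z \<in> S \<Longrightarrow> f z \<in> S'" "\<And>z. z \<in> F \<Longrightarrow> f z \<in> F'"
    and z: "z \<in> F"
  shows "qmap (modulo F' S') f (modulo F S `` {z}) = modulo F' S' `` {f z}"
proof -
  have "modulo F' S' `` {f x} = modulo F' S' `` {f z}" if "x \<in> modulo F S `` {z}" for x
  proof -
    have x: "x \<in> F" "z - x \<in> S" using that by (auto simp: modulo_def)
    have "reduce S' (f x) = reduce S' (f z)"
      using f(2)[OF x(2)] reduce_eq_iff[OF S(2), of "f z" "f x"] by (simp add: lin_diff[OF f(1)] eq_commute)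
    then show ?thesis by (simp only: modulo_class[OF S(2)] f(3)[OF x(1)] f(3)[OF z])
  qed
  moreover have "z \<in> modulo F S `` {z}"
    using z by (simp add: modulo_def free.subspace_0[OF S(1)])
  ultimately have "(\<Union>x\<in>modulo F S `` {z}. modulo F' S' `` {f x}) = modulo F' S' `` {f z}" by blast
  then show ?thesis by (simp only: qmap_conv)
qed

lemma tensor_space_subset: "X \<in> tensor_space scale \<Longrightarrow> X \<subseteq> words"
  by (auto simp: tensor_space_def tensor_rel_def quotient_def modulo_def)

text \<open>The maps are inverse to each other on representatives, not merely on classes; the
  exponentials of \<open>\<Xi>\<close> and of its negative satisfy this stronger condition.\<close>

locale tensor_automorphism =
  fixes scale :: "'k::field \<Rightarrow> 'v::ab_group_add \<Rightarrow> 'v"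
    and f g :: "('v list \<Rightarrow>\<^sub>0 'k) \<Rightarrow> ('v list \<Rightarrow>\<^sub>0 'k)"
  assumes lin: "lin f" "lin g"
    and words: "\<And>z. z \<in> words \<Longrightarrow> f z \<in> words" "\<And>z. z \<in> words \<Longrightarrow> g z \<in> words"
    and relations: "\<And>z. z \<in> tensor_relations scale \<Longrightarrow> f z \<in> tensor_relations scale"
      "\<And>z. z \<in> tensor_relations scale \<Longrightarrow> g z \<in> tensor_relations scale"
    and inverse: "\<And>z. f (g z) = z" "\<And>z. g (f z) = z"
begin

lemma qmap_f: "z \<in> words \<Longrightarrow> qmap (tensor_rel scale) f (tensor_rel scale `` {z}) = tensor_rel scale `` {f z}"
  unfolding tensor_rel_def
  by (rule qmap_class) (simp_all add: subspace_tensor_relations lin relations words)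

lemma qmap_g: "z \<in> words \<Longrightarrow> qmap (tensor_rel scale) g (tensor_rel scale `` {z}) = tensor_rel scale `` {g z}"
  unfolding tensor_rel_def
  by (rule qmap_class) (simp_all add: subspace_tensor_relations lin relations words)

lemma bij_betw_qmap: "bij_betw (qmap (tensor_rel scale) f) (tensor_space scale) (tensor_space scale)"
proof -
  let ?c = "\<lambda>z. tensor_rel scale `` {z}"
  have space: "tensor_space scale = ?c ` words"
    by (auto simp: tensor_space_def quotient_def)
  have "?c (f z) \<in> ?c ` words" "?c (g z) \<in> ?c ` words" if "z \<in> words" for z
    by (rule imageI, rule words, rule that)+
  then show ?thesis
    by (intro bij_betw_byWitness[where f' = "qmap (tensor_rel scale) g"])
      (simp_all add: space image_subset_iff qmap_f qmap_g words inverse)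
qed

lemma qmap_image:
  assumes "H \<subseteq> words" "\<And>z. z \<in> H \<Longrightarrow> f z \<in> H" "\<And>z. z \<in> H \<Longrightarrow> g z \<in> H"
  shows "qmap (tensor_rel scale) f ` ((\<lambda>z. tensor_rel scale `` {z}) ` H) = (\<lambda>z. tensor_rel scale `` {z}) ` H"
proof -
  have "f ` H = H" 
  proof (intro equalityI subsetI)
    fix z assume "z \<in> H"
    then show "z \<in> f ` H" using assms(3) inverse(1)[of z] by (intro image_eqI[of _ _ "g z"]) simp_all
  qed (use assms(2) in auto)
  moreover have "qmap (tensor_rel scale) f ` ((\<lambda>z. tensor_rel scale `` {z}) ` H) = (\<lambda>z. tensor_rel scale `` {z}) ` (f ` H)"
    unfolding image_image by (intro image_cong refl qmap_f subsetD[OF assms(1)])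
  ultimately show ?thesis by simp
qed

end

text \<open>The representatives occurring in \<open>tensor_space_grade\<close>, before passing to
  classes.\<close>

definition homogeneous_tensors :: "(int \<Rightarrow> 'v set) \<Rightarrow> int \<Rightarrow> ('v list \<Rightarrow>\<^sub>0 'k::field) set" where
  "homogeneous_tensors G n = free.span {gen xs | xs ds. xs \<noteq> [] \<and> list_all2 (\<lambda>x d. x \<in> G d) xs ds \<and> sum_list ds = n}"

lemma subspace_homogeneous_tensors: "free.subspace (homogeneous_tensors G n)"
  by (simp add: homogeneous_tensors_def)

lemma gen_homogeneous_tensors:
  "xs \<noteq> [] \<Longrightarrow> list_all2 (\<lambda>x d. x \<in> G d) xs ds \<Longrightarrow> sum_list ds = n \<Longrightarrow> gen xs \<in> homogeneous_tensors G n"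
  unfolding homogeneous_tensors_def by (rule free.span_base) blast

lemma homogeneous_tensors_words: "homogeneous_tensors G n \<subseteq> words"
  unfolding homogeneous_tensors_def
  by (rule free.span_minimal[OF _ subspace_words]) (auto simp: gen_in_words)

lemma cons_homogeneous_tensors:
  assumes "x \<in> G m" "z \<in> homogeneous_tensors G n"
  shows "cons x z \<in> homogeneous_tensors G (m + n)"
proof (rule lin_image_span[OF lin_cons subspace_homogeneous_tensors _ assms(2)[unfolded homogeneous_tensors_def]])
  fix z assume "z \<in> {gen xs | xs ds. xs \<noteq> [] \<and> list_all2 (\<lambda>x d. x \<in> G d) xs ds \<and> sum_list ds = n}"
  then obtain xs ds where "z = gen xs" "list_all2 (\<lambda>x d. x \<in> G d) xs ds" "sum_list ds = n" by blast
  then show "cons x z \<in> homogeneous_tensors G (m + n)"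
    using assms(1) gen_homogeneous_tensors[of "x # xs" G "m # ds"] by simp
qed

context graded_vector_space
begin

lemma coder_word_homogeneous:
  assumes "homs xs" "list_all2 (\<lambda>x d. x \<in> G d) xs ds" "graded_map G (Suc i) p f"
  shows "(coder_word G (Suc i) p f xs :: _ \<Rightarrow>\<^sub>0 'c::field) \<in> homogeneous_tensors G (p + sum_list ds)"
  using assms
proof (induction xs arbitrary: i p f ds)
  case (Cons x xs)
  then obtain d ds' where ds: "ds = d # ds'" "x \<in> G d" "list_all2 (\<lambda>x d. x \<in> G d) xs ds'" and xs: "homs xs" "x \<noteq> 0"
    by (auto simp: list_all2_Cons1)
  have 1: "(if i = 0 then gen (f [x] # xs) else coder_word G i (p + deg G x) (\<lambda>ys. f (x # ys)) xs :: _ \<Rightarrow>\<^sub>0 'c)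
      \<in> homogeneous_tensors G (p + sum_list ds)"
  proof (cases i)
    case 0
    then show ?thesis
      using graded_map_1[of G p f x d] Cons.prems(3) ds
        gen_homogeneous_tensors[of "f [x] # xs" G "(p + d) # ds'"] by (simp add: add.assoc)
  next
    case (Suc j)
    then have "graded_map G (Suc j) (p + d) (\<lambda>ys. f (x # ys))"
      using graded_map_Cons[of G i p f x d] Cons.prems(3) ds(2) by simp
    from Cons.IH[OF xs(1) ds(3) this] show ?thesis
      by (simp add: Suc ds deg_eq[OF ds(2) xs(2)] add.assoc)
  qed
  have "(cons x (coder_word G (Suc i) p f xs) :: _ \<Rightarrow>\<^sub>0 'c) \<in> homogeneous_tensors G (p + sum_list ds)"
    using cons_homogeneous_tensors[where x = x and G = G, OF ds(2) Cons.IH[OF xs(1) ds(3) Cons.prems(3)]]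
    by (simp add: ds add_ac)
  with 1 show ?case
    unfolding coder_word_Cons
    by (intro free.subspace_add[OF subspace_homogeneous_tensors] free.subspace_scale[OF subspace_homogeneous_tensors])
qed (simp add: free.subspace_0[OF subspace_homogeneous_tensors])

lemma hextend_0: "0 \<in> set xs \<Longrightarrow> hextend G \<phi> xs = 0"
proof (induction xs arbitrary: \<phi>)
  case (Cons x xs)
  then show ?case
    using hcomponents_homogeneous[OF subspace_0[OF subspace_G]] by (auto simp: hextend_Cons)
qed simp

lemma coder_homogeneous:
  assumes "graded_map G (Suc i) p f" "z \<in> homogeneous_tensors G n"
  shows "coder G (Suc i) p f z \<in> homogeneous_tensors G (p + n)"
proof (rule lin_image_span[OF lin_coder subspace_homogeneous_tensors _ assms(2)[unfolded homogeneous_tensors_def]])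
  fix z assume "z \<in> {gen xs | xs ds. xs \<noteq> [] \<and> list_all2 (\<lambda>x d. x \<in> G d) xs ds \<and> sum_list ds = n}"
  then obtain xs ds where xs: "z = gen xs" "list_all2 (\<lambda>x d. x \<in> G d) xs ds" "sum_list ds = n" by blast
  show "coder G (Suc i) p f z \<in> homogeneous_tensors G (p + n)"
  proof (cases "0 \<in> set xs")
    \<comment> \<open>A zero letter belongs to every degree but has no components, so the word is
      sent to 0.\<close>
    case True
    then show ?thesis
      by (simp add: xs(1) coder_def hextend_0 free.subspace_0[OF subspace_homogeneous_tensors])
  next
    case False
    have "homs xs"
    proof
      fix x assume x: "x \<in> set xs"
      then have "\<exists>d. x \<in> G d" using xs(2) by (auto simp: list_all2_conv_all_nth in_set_conv_nth)
      with False x show "x \<noteq> 0 \<and> (\<exists>n. x \<in> G n)" by auto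
    qed
    then show ?thesis
      using coder_word_homogeneous[OF _ xs(2) assms(1)] by (simp add: xs(1,3) coder_def hextend_homs)
  qed
qed

end

section \<open>The gauge transformation\<close>

lemma prod_minus_one_but_first: "(\<Prod>j<k. if j = 0 then 1 else - 1 :: 'k::field) = (-1) ^ (k - 1)"
proof (cases k)
  case (Suc n)
  show ?thesis unfolding Suc by (subst prod.lessThan_Suc_shift) simp
qed simp

lemma tensor_operator_sum:
  fixes scale :: "'k::field \<Rightarrow> 'v::ab_group_add \<Rightarrow> 'v"
  assumes "\<And>L z. z \<in> short_words L \<Longrightarrow> f z = (\<Sum>i<L. g i z)" and g: "\<And>i. tensor_operator scale (g i)"
  shows "tensor_operator scale f"
proof (rule tensor_operatorI)
  show "lin f" using assms(1) tensor_operator_lin[OF g] by (rule lin_of_truncations)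
  fix z :: "'v list \<Rightarrow>\<^sub>0 'k"
  obtain L where L: "z \<in> short_words L" using ex_short_words by blast
  show "f z \<in> words" if "z \<in> words"
    unfolding assms(1)[OF L] by (intro free.subspace_sum[OF subspace_words] tensor_operator_words[OF g] that)
  show "f z \<in> tensor_relations scale" if "z \<in> tensor_relations scale"
    unfolding assms(1)[OF L]
    by (intro free.subspace_sum[OF subspace_tensor_relations] tensor_operator_relations[OF g] that)
qed

section \<open>The exponential of a coderivation is a coalgebra map\<close>

context graded_vector_space
begin

lemma Q2_op_tensor_cong:
  assumes "tensor_operator scale g" "tensor_operator scale h" "Q2 t = Q2 t'"
  shows "Q2 (op_tensor G q g h t) = Q2 (op_tensor G q g h t')"
  by (rule reduce_cong[OF subspace_R2 subspace_R2 lin_op_tensor op_tensor_relations[OF assms(1,2)] assms(3)])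

lemma Q2_op_tensor_compose:
  assumes ops: "tensor_operator scale g" "tensor_operator scale h" "tensor_operator scale g'" "tensor_operator scale h'"
    and t: "t \<in> words2"
  shows "Q2 (op_tensor G 0 g h (op_tensor G 0 g' h' t)) = Q2 (op_tensor G 0 (\<lambda>z. g (g' z)) (\<lambda>z. h (h' z)) t)"
proof (rule words2_tensor_induct[OF t])
  show "lin (\<lambda>t. Q2 (op_tensor G 0 g h (op_tensor G 0 g' h' t)))"
    by (rule lin_compose[OF lin_Q2 lin_compose[OF lin_op_tensor lin_op_tensor]])
  show "lin (\<lambda>t. Q2 (op_tensor G 0 (\<lambda>z. g (g' z)) (\<lambda>z. h (h' z)) t))"
    by (rule lin_compose[OF lin_Q2 lin_op_tensor])
  fix u v :: "'v list \<Rightarrow>\<^sub>0 'k" assume uv: "u \<in> words" "v \<in> words"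
  have "Q2 (op_tensor G 0 g h (op_tensor G 0 g' h' (tensor u v))) = Q2 (op_tensor G 0 g h (tensor (g' u) (h' v)))"
    by (rule Q2_op_tensor_cong[OF ops(1,2) Q2_op_tensor[OF ops(3,4) uv]])
  also have "\<dots> = Q2 (tensor (g (g' u)) (h (h' v)))"
    by (rule Q2_op_tensor[OF ops(1,2) tensor_operator_words[OF ops(3) uv(1)] tensor_operator_words[OF ops(4) uv(2)]])
  also have "\<dots> = Q2 (op_tensor G 0 (\<lambda>z. g (g' z)) (\<lambda>z. h (h' z)) (tensor u v))"
    by (rule Q2_op_tensor[OF tensor_operator_compose[OF ops(1,3)] tensor_operator_compose[OF ops(2,4)] uv, symmetric])
  finally show "Q2 (op_tensor G 0 g h (op_tensor G 0 g' h' (tensor u v))) =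
    Q2 (op_tensor G 0 (\<lambda>z. g (g' z)) (\<lambda>z. h (h' z)) (tensor u v))" .
qed

lemma Q2_op_tensor_id:
  assumes "t \<in> words2"
  shows "Q2 (op_tensor G 0 id id t) = Q2 t"
proof (rule words2_tensor_induct[OF assms])
  show "lin (\<lambda>t. Q2 (op_tensor G 0 id id t))" by (rule lin_compose[OF lin_Q2 lin_op_tensor])
  show "Q2 (op_tensor G 0 id id (tensor u v)) = Q2 (tensor u v)" if "u \<in> words" "v \<in> words" for u v
    using Q2_op_tensor[OF tensor_operator_id tensor_operator_id that] by simp
qed (rule lin_Q2)

text \<open>One length bound for z and for both factors of every term of its coproduct, so that sums
  over powers or arities can be truncated uniformly.\<close>

lemma ex_short_comult:
  fixes z :: "'v list \<Rightarrow>\<^sub>0 'k"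
  obtains N where "z \<in> short_words N"
    "\<And>a b. (a, b) \<in> Poly_Mapping.keys (comult G z :: _ \<Rightarrow>\<^sub>0 'k) \<Longrightarrow>
      (gen a :: 'v list \<Rightarrow>\<^sub>0 'k) \<in> short_words N \<and> (gen b :: 'v list \<Rightarrow>\<^sub>0 'k) \<in> short_words N \<and> a \<noteq> [] \<and> b \<noteq> []"
proof -
  obtain L where L: "z \<in> short_words L" using ex_short_words by blast
  let ?K = "Poly_Mapping.keys (comult G z :: _ \<Rightarrow>\<^sub>0 'k)"
  let ?N = "L + Suc (\<Sum>(a, b)\<in>?K. length a + length b)"
  have "length a < ?N \<and> length b < ?N" if "(a, b) \<in> ?K" for a b
    using member_le_sum[OF that, of "\<lambda>(a, b). length a + length b"] by simp
  moreover have "a \<noteq> [] \<and> b \<noteq> []" if "(a, b) \<in> ?K" for a b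
    using comult_words2[of G z] that by (auto simp: words2_def)
  ultimately show ?thesis
    by (intro that[of ?N] short_words_mono[OF L]) (auto simp: gen_short_words)
qed

text \<open>The coderivation rule moves X through the coproduct as X \<otimes> 1 + 1 \<otimes> X, a
  sum of commuting operators. Thus \<open>H n a b\<close> is
  \<open>X\<^sup>a \<otimes> X\<^sup>b\<close> applied to the coproduct of
  \<open>X\<^sup>n z\<close>, and the product formula for exponentials applies.\<close>

theorem comult_op_exp:
  assumes X: "shortening X" "tensor_operator scale X"
    and coder: "\<And>z. Q2 (comult G (X z)) = Q2 (op_tensor G 0 X id (comult G z)) + Q2 (op_tensor G 0 id X (comult G z))"
    and e: "tensor_operator scale (op_exp X)"
  shows "Q2 (comult G (op_exp X z)) = Q2 (op_tensor G 0 (op_exp X) (op_exp X) (comult G z))"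
proof -
  interpret X: shortening X by fact
  let ?t = "comult G z"
  obtain N where N: "z \<in> short_words N"
    "\<And>a b. (a, b) \<in> Poly_Mapping.keys ?t \<Longrightarrow>
      (gen a :: 'v list \<Rightarrow>\<^sub>0 'k) \<in> short_words N \<and> (gen b :: 'v list \<Rightarrow>\<^sub>0 'k) \<in> short_words N \<and> a \<noteq> [] \<and> b \<noteq> []"
    by (rule ex_short_comult[of z], rule that)
  \<comment> \<open>If a + b \<ge> 2N, then a \<ge> N or b \<ge> N, and one of the factors is
    annihilated.\<close>
  let ?M = "N + N"
  define E where "E a b = op_tensor G 0 (X ^^ a) (X ^^ b)" for a b
  let ?H = "\<lambda>n a b. Q2 (E a b (comult G ((X ^^ n) z)))"
  note pow = tensor_operator_funpow[OF X(2)]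
  have lin_E: "lin (\<lambda>t. Q2 (E a b t))" for a b
    unfolding E_def by (rule lin_compose[OF lin_Q2 lin_op_tensor])
  have H: "?H (Suc n) a b = ?H n (Suc a) b + ?H n a (Suc b)" for n a b
  proof -
    let ?w = "comult G ((X ^^ n) z)"
    have "Q2 (E a b (comult G (X ((X ^^ n) z)))) = Q2 (E a b (op_tensor G 0 X id ?w + op_tensor G 0 id X ?w))"
      unfolding E_def by (rule Q2_op_tensor_cong[OF pow pow]) (simp add: coder Q2_simps)
    also have "\<dots> = Q2 (E a b (op_tensor G 0 X id ?w)) + Q2 (E a b (op_tensor G 0 id X ?w))"
      by (rule lin_add[OF lin_E])
    also have "Q2 (E a b (op_tensor G 0 X id ?w)) = Q2 (E (Suc a) b ?w)"
      unfolding E_def Q2_op_tensor_compose[OF pow pow X(2) tensor_operator_id comult_words2]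
      by (simp add: funpow_swap1[symmetric] comp_def)
    also have "Q2 (E a b (op_tensor G 0 id X ?w)) = Q2 (E a (Suc b) ?w)"
      unfolding E_def Q2_op_tensor_compose[OF pow pow tensor_operator_id X(2) comult_words2]
      by (simp add: funpow_swap1[symmetric] comp_def)
    finally show ?thesis by simp
  qed
  have E_gen: "Q2 (E a b (tensor (gen u) (gen v))) = Q2 (tensor ((X ^^ a) (gen u)) ((X ^^ b) (gen v)))"
    if "(u, v) \<in> Poly_Mapping.keys ?t" for a b u v
    unfolding E_def by (rule Q2_op_tensor[OF pow pow]) (use N(2)[OF that] in \<open>simp_all add: gen_in_words\<close>)
  have zero: "?H 0 a b = 0" if ab: "a + b \<ge> ?M" for a b
  proof -
    have "Q2 (E a b ?t) = 0"
    proof (rule lin_eq_tensorI[OF lin_E lin_zero_op])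
      fix u v assume uv: "(u, v) \<in> Poly_Mapping.keys ?t"
      have "N \<le> a \<or> N \<le> b" using ab by linarith
      then have "(X ^^ a) (gen u) = 0 \<or> (X ^^ b) (gen v) = 0"
        using X.funpow_eq_0[of "gen u" N a] X.funpow_eq_0[of "gen v" N b] N(2)[OF uv] by blast
      then show "Q2 (E a b (tensor (gen u) (gen v))) = 0"
        unfolding E_gen[OF uv] by (auto simp: tensor_simps Q2_simps)
    qed
    then show ?thesis by simp
  qed
  have "Q2 (op_tensor G 0 (op_exp X) (op_exp X) ?t) =
    (\<Sum>a<?M. \<Sum>b<?M. smul (1 / fact a) (smul (1 / fact b) (Q2 (E a b ?t))))"
  proof (rule lin_eq_tensorI[of "\<lambda>t. Q2 (op_tensor G 0 (op_exp X) (op_exp X) t)"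
        "\<lambda>t. \<Sum>a<?M. \<Sum>b<?M. smul (1 / fact a) (smul (1 / fact b) (Q2 (E a b t)))"])
    show "lin (\<lambda>t. Q2 (op_tensor G 0 (op_exp X) (op_exp X) t))"
      by (rule lin_compose[OF lin_Q2 lin_op_tensor])
    show "lin (\<lambda>t. \<Sum>a<?M. \<Sum>b<?M. smul (1 / fact a) (smul (1 / fact b) (Q2 (E a b t))))"
      by (intro lin_sum_op lin_smul_op lin_E)
    fix u v assume uv: "(u, v) \<in> Poly_Mapping.keys ?t"
    have "Q2 (op_tensor G 0 (op_exp X) (op_exp X) (tensor (gen u) (gen v))) = Q2 (tensor (op_exp X (gen u)) (op_exp X (gen v)))"
      by (rule Q2_op_tensor[OF e e]) (use N(2)[OF uv] in \<open>simp_all add: gen_in_words\<close>)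
    also have "\<dots> = (\<Sum>a<?M. \<Sum>b<?M. smul (1 / fact a) (smul (1 / fact b) (Q2 (tensor ((X ^^ a) (gen u)) ((X ^^ b) (gen v))))))"
    proof -
      have eu: "op_exp X (gen u) = (\<Sum>a<?M. smul (1 / fact a) ((X ^^ a) (gen u)))"
        by (rule X.op_exp_eq[of _ N]) (use N(2)[OF uv] in simp_all)
      have ev: "op_exp X (gen v) = (\<Sum>a<?M. smul (1 / fact a) ((X ^^ a) (gen v)))"
        by (rule X.op_exp_eq[of _ N]) (use N(2)[OF uv] in simp_all)
      have 1: "Q2 (tensor (op_exp X (gen u)) w) = (\<Sum>a<?M. smul (1 / fact a) (Q2 (tensor ((X ^^ a) (gen u)) w)))" for w
        by (simp only: eu lin_sum[OF lin_tensor_left] lin_smul[OF lin_tensor_left] Q2_simps)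
      have 2: "Q2 (tensor w (op_exp X (gen v))) = (\<Sum>b<?M. smul (1 / fact b) (Q2 (tensor w ((X ^^ b) (gen v)))))" for w
        by (simp only: ev lin_sum[OF lin_tensor_right] lin_smul[OF lin_tensor_right] Q2_simps)
      show ?thesis unfolding 1 by (simp only: 2 free.scale_sum_right)
    qed
    finally show "Q2 (op_tensor G 0 (op_exp X) (op_exp X) (tensor (gen u) (gen v))) =
      (\<Sum>a<?M. \<Sum>b<?M. smul (1 / fact a) (smul (1 / fact b) (Q2 (E a b (tensor (gen u) (gen v))))))"
      by (simp only: E_gen[OF uv])
  qed
  also have "\<dots> = (\<Sum>n<?M. smul (1 / fact n) (?H n 0 0))"
    by (subst exp_product(1)[of ?H, OF H zero]) simp_all
  also have "\<dots> = (\<Sum>n<?M. smul (1 / fact n) (Q2 (comult G ((X ^^ n) z))))"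
    by (simp add: E_def Q2_op_tensor_id comult_words2 flip: id_def)
  also have "\<dots> = Q2 (comult G (op_exp X z))"
    by (simp only: X.op_exp_eq[OF N(1) le_add1[of N N]] lin_simps[OF lin_comult] Q2_simps)
  finally show ?thesis ..
qed

end

context leibniz_algebra
begin

lemma tensor_operator_nested_coder:
  "derivation scale G br p D \<Longrightarrow> tensor_operator scale (nested_coder i q D)"
  unfolding nested_coder_def by (rule tensor_operator_coder[OF multilinear_nested_op])

lemma nested_coder_short_words: "z \<in> short_words L \<Longrightarrow> nested_coder i p D z \<in> short_words (L - i)"
  unfolding nested_coder_def by (rule coder_short_words)

lemma nested_coder_eq_0: "z \<in> short_words L \<Longrightarrow> L \<le> i \<Longrightarrow> nested_coder i p D z = 0"
  using nested_coder_short_words[of z L i p D] short_words_0 by simp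

lemma Q_nested_coder_sum:
  assumes "finite N" "\<And>x. D x = (\<Sum>a\<in>N. A a x)"
  shows "Q (nested_coder i p D z) = (\<Sum>a\<in>N. Q (nested_coder i p (A a) z))"
  using assms
proof (induction N arbitrary: D rule: finite_induct)
  case empty
  then have "Q (nested_coder i p D z) = smul 0 (Q (nested_coder i p D z))"
    by (intro Q_nested_coder_scale) simp
  then show ?case by simp
next
  case (insert a N)
  have 1: "Q (nested_coder i p D z) = Q (nested_coder i p (A a) z) + Q (nested_coder i p (\<lambda>x. \<Sum>a\<in>N. A a x) z)"
    using Q_nested_coder_lin[of D 1 "A a" 1] by (simp add: insert)
  show ?case unfolding 1 using insert.hyps insert.IH[OF refl] by simp
qed

text \<open>The k-th shift and the k-th inverse shift both pass each earlier letter j. In sV the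
  degree is larger by 1, and for j = 0 by 2 after \<open>\<delta> i\<close>, so the pair contributes
  -1 for j > 0 and 1 for j = 0. Over all j < k \<le> i this gives the sign with exponent i(i-1)/2,
  which is the prefactor of the bracket; the two cancel.\<close>

lemma desuspended_bracket_eq:
  assumes \<delta>: "derivation scale G br 1 (\<delta> i)" and ys: "homs ys" "length ys = Suc i"
  shows "desuspended_bracket scale G br \<delta> (Suc i) ys = nested_op br (\<delta> i) ys"
proof -
  interpret s: graded_vector_space scale "susp G" by (rule graded_vector_space_susp)
  obtain x xs where ys_eq: "ys = x # xs" using ys(2) by (cases ys) auto
  define zs where "zs = \<delta> i x # xs"
  have nested: "nested_op br (\<delta> i) ys = nested br zs"
    by (simp add: nested_op_def ys_eq zs_def)
  have homs_susp: "s.homs ys"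
  proof
    fix y assume "y \<in> set ys"
    then obtain n where "y \<noteq> 0" "y \<in> G n" using ys(1) by blast
    then show "y \<noteq> 0 \<and> (\<exists>n. y \<in> susp G n)" by (auto simp: susp_def intro!: exI[of _ "n + 1"])
  qed
  let ?s = "(- 1) ^ (i * (i - 1) div 2) * apply_sign (susp G) (replicate (Suc i) (-1)) zs
    * apply_sign (susp G) (1 # replicate i 0) ys :: 'k"
  have lhs: "desuspended_bracket scale G br \<delta> (Suc i) ys =
      scale (apply_sign G (replicate (Suc i) 1) ys * ?s) (nested br zs)"
    unfolding desuspended_bracket_def higher_derived_bracket_def
      hextend_homs[OF ys(1)] s.hextend_homs[OF homs_susp] Let_def
    by (simp add: ys_eq zs_def mult_ac)
  show ?thesis
  proof (cases "\<delta> i x = 0")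
    \<comment> \<open>The degree of zero is meaningless, but both brackets vanish whatever the
      sign.\<close>
    case True
    then show ?thesis unfolding lhs nested by (simp add: zs_def nested_def foldl_br_0)
  next
    case False
    have deg: "deg (susp G) y = deg G y + 1" if "y \<in> G n" "y \<noteq> 0" for y n
      using s.deg_eq[of y "n + 1"] deg_eq[OF that] that by (simp add: susp_def)
    obtain n where x: "x \<in> G n" "x \<noteq> 0" using ys(1) by (auto simp: ys_eq)
    \<comment> \<open>One degree comes from \<open>\<delta> i\<close>, the other from the
      suspension.\<close>
    have deg0: "deg (susp G) (\<delta> i x) = deg G x + 2"
      using deg[OF derivation_degree[OF \<delta> x(1)] False] deg_eq[OF x] deg_eq[OF derivation_degree[OF \<delta> x(1)] False]
      by simp
    have degS: "deg (susp G) (zs ! j) = (if j = 0 then deg G (ys ! j) + 2 else deg G (ys ! j) + 1)"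
      if "j < Suc i" for j
    proof (cases j)
      case (Suc k)
      then have "ys ! j \<in> set ys" using that ys(2) by simp
      then obtain n where "ys ! j \<in> G n" "ys ! j \<noteq> 0" using ys(1) by blast
      from deg[OF this] Suc show ?thesis by (simp add: zs_def ys_eq)
    qed (simp add: zs_def ys_eq deg0)
    \<comment> \<open>The only factor of nonzero degree stands first and passes no letter.\<close>
    have "apply_sign (susp G) (1 # replicate i 0) ys = (\<Prod>k<Suc i. \<Prod>j<k. (1 :: 'k))"
      unfolding apply_sign_def ys(2)
    proof (intro prod.cong refl)
      fix k j assume "k \<in> {..<Suc i}" "j \<in> {..<k}"
      then show "(- 1) powi ((1 # replicate i 0) ! k * deg (susp G) (ys ! j)) = (1 :: 'k)"
        by (cases k) simp_all
    qed
    then have 1: "apply_sign (susp G) (1 # replicate i 0) ys = (1 :: 'k)" by simp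
    have len: "length zs = Suc i" using ys(2) by (simp add: zs_def ys_eq)
    have "apply_sign G (replicate (Suc i) 1) ys * apply_sign (susp G) (replicate (Suc i) (-1)) zs =
      (\<Prod>k<Suc i. \<Prod>j<k. if j = 0 then 1 else - 1 :: 'k)"
      unfolding apply_sign_def ys(2) len prod.distrib[symmetric]
    proof (intro prod.cong refl)
      fix k j assume kj: "k \<in> {..<Suc i}" "j \<in> {..<k}"
      then have "j < Suc i" by simp
      then have "replicate (Suc i) (1 :: int) ! k * deg G (ys ! j) + replicate (Suc i) (- 1) ! k * deg (susp G) (zs ! j)
        = (if j = 0 then - 2 else - 1)"
        using kj(1) by (simp add: degS del: replicate.simps)
      then show "(- 1) powi (replicate (Suc i) 1 ! k * deg G (ys ! j)) *
          (- 1) powi (replicate (Suc i) (- 1) ! k * deg (susp G) (zs ! j)) = (if j = 0 then 1 else - 1 :: 'k)"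
        unfolding minus_one_powi_add[symmetric] by (simp add: power_int_minus)
    qed
    also have "\<dots> = (- 1) ^ (i * (i - 1) div 2)"
      by (simp only: prod_minus_one_but_first prod_minus_one_powers)
    finally have 2: "apply_sign G (replicate (Suc i) 1) ys * apply_sign (susp G) (replicate (Suc i) (-1)) zs =
      (- 1 :: 'k) ^ (i * (i - 1) div 2)" .
    have "apply_sign G (replicate (Suc i) 1) ys * ?s = (- 1) ^ (i * (i - 1) div 2) *
      (apply_sign G (replicate (Suc i) 1) ys * apply_sign (susp G) (replicate (Suc i) (-1)) zs)"
      unfolding 1 by (simp only: mult_ac mult_1)
    also have "\<dots> = 1" unfolding 2 by (simp flip: power_mult_distrib)
    finally have "apply_sign G (replicate (Suc i) 1) ys * ?s = 1" .
    then show ?thesis unfolding lhs nested by simp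
  qed
qed

text \<open>The image of the power series with coefficients \<open>A i\<close> under the
  homomorphism that sends \<open>t\<^sup>i D\<close> to
  \<open>N\<^sub>i\<^sub>+\<^sub>1\<^sup>c D\<close>.\<close>

definition coder_series :: "int \<Rightarrow> (nat \<Rightarrow> 'v \<Rightarrow> 'v) \<Rightarrow> ('v list \<Rightarrow>\<^sub>0 'k) \<Rightarrow> ('v list \<Rightarrow>\<^sub>0 'k)" where
  "coder_series p A z = Sum_any (\<lambda>i. nested_coder i p (A i) z)"

lemma coder_series_eq:
  assumes "z \<in> short_words L"
  shows "coder_series p A z = (\<Sum>i<L. nested_coder i p (A i) z)"
  unfolding coder_series_def
proof (rule Sum_any.expand_superset)
  show "{i. nested_coder i p (A i) z \<noteq> 0} \<subseteq> {..<L}"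
    using nested_coder_eq_0[OF assms] not_le by blast
qed simp

lemma tensor_operator_coder_series:
  assumes "\<And>i. derivation scale G br p (A i)"
  shows "tensor_operator scale (coder_series q A)"
  by (rule tensor_operator_sum[where g = "\<lambda>i. nested_coder i q (A i)"])
    (rule coder_series_eq tensor_operator_nested_coder[OF assms], assumption?)+

lemma coder_series_short_words:
  assumes "z \<in> short_words L"
  shows "coder_series p A z \<in> short_words L"
  unfolding coder_series_eq[OF assms]
  by (intro free.subspace_sum[OF subspace_short_words] short_words_mono[OF nested_coder_short_words[OF assms]]) simp

lemma codifferential_eq:
  assumes "\<And>i. derivation scale G br 1 (\<delta> i)"
  shows "codifferential scale G br \<delta> = coder_series 1 \<delta>"
proof -
  have "coder G (i + 1) 1 (desuspended_bracket scale G br \<delta> (i + 1)) z = nested_coder i 1 (\<delta> i) z" for i z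
    unfolding nested_coder_def Suc_eq_plus1[symmetric]
    by (rule coder_cong) (rule desuspended_bracket_eq[OF assms])
  then show ?thesis by (simp add: fun_eq_iff codifferential_def coder_series_def)
qed

lemma gauge_coder_eq:
  assumes "z \<in> short_words L"
  shows "gauge_coder G br \<xi> z = (\<Sum>i<L. nested_coder (Suc i) 0 (\<xi> (Suc i)) z)"
proof -
  have "gauge_coder G br \<xi> z = Sum_any (\<lambda>i. nested_coder (Suc i) 0 (\<xi> (Suc i)) z)"
    by (simp add: gauge_coder_def nested_coder_def)
  also have "\<dots> = (\<Sum>i<L. nested_coder (Suc i) 0 (\<xi> (Suc i)) z)"
  proof (rule Sum_any.expand_superset)
    show "{i. nested_coder (Suc i) 0 (\<xi> (Suc i)) z \<noteq> 0} \<subseteq> {..<L}"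
      using nested_coder_eq_0[OF assms] not_le le_SucI by blast
  qed simp
  finally show ?thesis .
qed

context
  fixes \<xi> :: "nat \<Rightarrow> 'v \<Rightarrow> 'v"
  assumes \<xi>: "\<And>i. derivation scale G br 0 (\<xi> i)"
begin

lemma tensor_operator_gauge_coder: "tensor_operator scale (gauge_coder G br \<xi>)"
  by (rule tensor_operator_sum[where g = "\<lambda>i. nested_coder (Suc i) 0 (\<xi> (Suc i))"])
    (rule gauge_coder_eq tensor_operator_nested_coder[OF \<xi>], assumption?)+

lemma shortening_gauge_coder: "shortening (gauge_coder G br \<xi> :: ('v list \<Rightarrow>\<^sub>0 'k) \<Rightarrow> _)"
proof (rule shortening.intro)
  show "lin (gauge_coder G br \<xi> :: ('v list \<Rightarrow>\<^sub>0 'k) \<Rightarrow> _)"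
    by (rule tensor_operator_lin[OF tensor_operator_gauge_coder])
  show "gauge_coder G br \<xi> z \<in> short_words L" if "z \<in> short_words (Suc L)" for z :: "'v list \<Rightarrow>\<^sub>0 'k" and L
    unfolding gauge_coder_eq[OF that]
    by (intro free.subspace_sum[OF subspace_short_words] short_words_mono[OF nested_coder_short_words[OF that]]) simp
qed

lemma gauge_coder_homogeneous:
  assumes "(z :: 'v list \<Rightarrow>\<^sub>0 'k) \<in> homogeneous_tensors G n"
  shows "gauge_coder G br \<xi> z \<in> homogeneous_tensors G n"
proof -
  obtain L where L: "z \<in> short_words L" using ex_short_words by blast
  have "nested_coder i 0 (\<xi> i) z \<in> homogeneous_tensors G n" for i
    using coder_homogeneous[OF graded_map_nested_op[OF \<xi>] assms] by (simp add: nested_coder_def)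
  then show ?thesis
    unfolding gauge_coder_eq[OF L] by (intro free.subspace_sum[OF subspace_homogeneous_tensors])
qed

text \<open>\<open>gauge_coder\<close> starts with \<open>\<xi> 1\<close>. The additional term of
  the series, for the zero map, produces words with a letter 0 and so vanishes only modulo the
  relations.\<close>

lemma Q_gauge_coder:
  assumes "\<xi> 0 = (\<lambda>_. 0)"
  shows "Q (gauge_coder G br \<xi> z) = Q (coder_series 0 \<xi> z)"
proof -
  obtain L where L: "z \<in> short_words L" using ex_short_words by blast
  then have L': "z \<in> short_words (Suc L)" by (rule short_words_mono) simp
  have "Q (nested_coder 0 0 (\<xi> 0) z) = smul 0 (Q (nested_coder 0 0 (\<xi> 0) z))"
    by (rule Q_nested_coder_scale) (simp add: assms)
  then show ?thesis
    unfolding gauge_coder_eq[OF L] coder_series_eq[OF L'] sum.lessThan_Suc_shift by (simp add: Q_simps)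
qed

text \<open>Each summand is a coderivation, but the number of summands depends on the argument. A
  bound valid for z and for all factors of its coproduct truncates the three sums at the same
  place.\<close>

lemma gauge_coder_coderivation:
  "Q2 (comult G (gauge_coder G br \<xi> z)) =
    Q2 (op_tensor G 0 (gauge_coder G br \<xi>) id (comult G z)) + Q2 (op_tensor G 0 id (gauge_coder G br \<xi>) (comult G z))"
proof -
  let ?t = "comult G z"
  let ?X = "gauge_coder G br \<xi> :: ('v list \<Rightarrow>\<^sub>0 'k) \<Rightarrow> _"
  let ?C = "\<lambda>i. coder_tensor (Suc (Suc i)) 0 (nested_op br (\<xi> (Suc i)))"
  obtain N where N: "z \<in> short_words N"
    "\<And>a b. (a, b) \<in> Poly_Mapping.keys ?t \<Longrightarrow>
      (gen a :: 'v list \<Rightarrow>\<^sub>0 'k) \<in> short_words N \<and> (gen b :: 'v list \<Rightarrow>\<^sub>0 'k) \<in> short_words N \<and> a \<noteq> [] \<and> b \<noteq> []"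
    by (rule ex_short_comult[of z], rule that)
  note X = tensor_operator_gauge_coder
  have "Q2 (comult G (?X z)) = (\<Sum>i<N. Q2 (comult G (nested_coder (Suc i) 0 (\<xi> (Suc i)) z)))"
    by (simp only: gauge_coder_eq[OF N(1)] lin_simps[OF lin_comult] Q2_simps)
  also have "\<dots> = (\<Sum>i<N. Q2 (?C i ?t))"
    unfolding nested_coder_def
    by (intro sum.cong refl coder_coderivation multilinear_nested_op[OF \<xi>] graded_map_nested_op[OF \<xi>])
  also have "\<dots> = Q2 (op_tensor G 0 ?X id ?t) + Q2 (op_tensor G 0 id ?X ?t)"
  proof (rule lin_eq_tensorI[of "\<lambda>t. \<Sum>i<N. Q2 (?C i t)"
        "\<lambda>t. Q2 (op_tensor G 0 ?X id t) + Q2 (op_tensor G 0 id ?X t)"])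
    show "lin (\<lambda>t. \<Sum>i<N. Q2 (?C i t))"
      by (intro lin_sum_op lin_compose[OF lin_Q2 lin_coder_tensor])
    show "lin (\<lambda>t. Q2 (op_tensor G 0 ?X id t) + Q2 (op_tensor G 0 id ?X t))"
      by (intro lin_plus lin_compose[OF lin_Q2 lin_op_tensor])
    fix a b assume ab: "(a, b) \<in> Poly_Mapping.keys ?t"
    have w: "gen a \<in> words" "gen b \<in> words" using N(2)[OF ab] by (simp_all add: gen_in_words)
    have "Q2 (?C i (tensor (gen a) (gen b))) =
        Q2 (tensor (nested_coder (Suc i) 0 (\<xi> (Suc i)) (gen a)) (gen b)) +
        Q2 (tensor (gen a) (nested_coder (Suc i) 0 (\<xi> (Suc i)) (gen b)))" for i
    proof -
      have "Q2 (tensor (parity G 0 (gen a)) (nested_coder (Suc i) 0 (\<xi> (Suc i)) (gen b))) =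
          Q2 (tensor (gen a) (nested_coder (Suc i) 0 (\<xi> (Suc i)) (gen b)))"
        by (rule Q2_tensor_cong) (simp_all add: Q_parity_0 w nested_coder_def coder_words)
      then show ?thesis
        using Q2_coder_tensor_tensor[OF multilinear_nested_op[OF \<xi>] w, of "Suc i" 0] by (simp add: nested_coder_def)
    qed
    then have "(\<Sum>i<N. Q2 (?C i (tensor (gen a) (gen b)))) =
        Q2 (tensor (?X (gen a)) (gen b)) + Q2 (tensor (gen a) (?X (gen b)))"
      using N(2)[OF ab]
      by (simp only: gauge_coder_eq[of _ N] tensor_simps Q2_simps sum.distrib)
    then show "(\<Sum>i<N. Q2 (?C i (tensor (gen a) (gen b)))) =
        Q2 (op_tensor G 0 ?X id (tensor (gen a) (gen b))) + Q2 (op_tensor G 0 id ?X (tensor (gen a) (gen b)))"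
      by (simp only: Q2_op_tensor[OF X tensor_operator_id w] Q2_op_tensor[OF tensor_operator_id X w] id_apply)
  qed
  finally show ?thesis .
qed

lemma derivation_series_ad:
  assumes "\<And>i. derivation scale G br p (A i)"
  shows "derivation scale G br p (series_ad \<xi> A m)"
proof -
  have sum: "derivation scale G br p (\<lambda>x. \<Sum>i\<in>N. B i x)" if "finite N" "\<And>i. derivation scale G br p (B i)"
    for N and B :: "nat \<Rightarrow> 'v \<Rightarrow> 'v"
    unfolding derivation_def graded_linear_def Vector_Spaces.linear_iff
  proof (intro conjI allI ballI subsetI)
    show "(\<Sum>i\<in>N. B i (x + y)) = (\<Sum>i\<in>N. B i x) + (\<Sum>i\<in>N. B i y)" for x y
      by (simp add: derivation_add[OF that(2)] sum.distrib)
    show "(\<Sum>i\<in>N. B i (scale c x)) = scale c (\<Sum>i\<in>N. B i x)" for c x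
      by (simp add: derivation_scale[OF that(2)] scale_sum_right)
    show "y \<in> G (n + p)" if "y \<in> (\<lambda>x. \<Sum>i\<in>N. B i x) ` G n" for y n
      using that derivation_degree[OF \<open>\<And>i. derivation scale G br p (B i)\<close>]
      by (auto intro!: subspace_sum[OF subspace_G])
    show "(\<Sum>i\<in>N. B i (br x y)) = br (\<Sum>i\<in>N. B i x) y + scale ((- 1) powi (p * n)) (br x (\<Sum>i\<in>N. B i y))"
      if "x \<in> G n" for n x y
    proof -
      have "br x (\<Sum>i\<in>N. B i y) = (\<Sum>i\<in>N. br x (B i y))" for B :: "nat \<Rightarrow> 'v \<Rightarrow> 'v"
        using \<open>finite N\<close> br_scale_right[of x 0 0] by (induction N) (simp_all add: br_add_right)
      moreover have "br (\<Sum>i\<in>N. B i x) y = (\<Sum>i\<in>N. br (B i x) y)" for B :: "nat \<Rightarrow> 'v \<Rightarrow> 'v"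
        using \<open>finite N\<close> by (induction N) (simp_all add: br_add_left br_0_left)
      ultimately show ?thesis
        by (simp add: derivation_br[OF \<open>\<And>i. derivation scale G br p (B i)\<close> that] sum.distrib scale_sum_right)
    qed
  qed (simp_all add: vector_space_axioms)
  have "series_ad \<xi> A m = (\<lambda>x. \<Sum>i\<le>m. graded_commutator p 0 (A i) (\<xi> (m - i)) x)"
    by (simp add: series_ad_def graded_commutator_def)
  then show ?thesis
    using sum[of "{..m}" "\<lambda>i. graded_commutator p 0 (A i) (\<xi> (m - i))"]
      derivation_graded_commutator[OF assms \<xi>] by simp
qed

lemma derivation_series_ad_funpow:
  "(\<And>i. derivation scale G br p (A i)) \<Longrightarrow> derivation scale G br p ((series_ad \<xi> ^^ n) A m)"
  by (induction n arbitrary: m) (simp_all add: derivation_series_ad)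

text \<open>Without constant term in \<open>\<xi>\<close>, each commutator raises the order in t by
  at least one.\<close>

lemma series_ad_funpow_eq_0:
  assumes "\<xi> 0 = (\<lambda>_. 0)" "\<And>i. derivation scale G br p (A i)" "m < n"
  shows "(series_ad \<xi> ^^ n) A m x = 0"
  using assms(3)
proof (induction n arbitrary: m x)
  case (Suc n)
  let ?B = "(series_ad \<xi> ^^ n) A"
  have B: "derivation scale G br p (?B i)" for i by (rule derivation_series_ad_funpow) (rule assms(2))
  have "?B i (\<xi> (m - i) x) - \<xi> (m - i) (?B i x) = 0" if "i \<le> m" for i
  proof (cases "i < n")
    case True
    then show ?thesis by (simp add: Suc.IH derivation_0[OF \<xi>])
  next
    \<comment> \<open>Only i = m = n is left, and this coefficient is paired with
      \<open>\<xi> 0\<close>, which is zero.\<close>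
    case False
    then have "m - i = 0" using that Suc.prems by simp
    then show ?thesis by (simp only: assms(1) derivation_0[OF B] diff_self)
  qed
  then have "(\<Sum>i\<le>m. ?B i (\<xi> (m - i) x) - \<xi> (m - i) (?B i x)) = 0"
    by (intro sum.neutral) simp
  moreover have "(series_ad \<xi> ^^ Suc n) A m x = (\<Sum>i\<le>m. ?B i (\<xi> (m - i) x) - \<xi> (m - i) (?B i x))"
    unfolding funpow.simps comp_apply by (subst series_ad_def) (rule refl)
  ultimately show ?case by (simp only:)
qed simp

text \<open>The operator F is only required to be congruent to a series: iterated commutators
  satisfy this, whereas they need not equal a series on representatives.\<close>

theorem op_ad_coder_series:
  assumes "\<xi> 0 = (\<lambda>_. 0)" and A: "\<And>i. derivation scale G br p (A i)"
    and F: "\<And>z. Q (F z) = Q (coder_series p A z)"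
  shows "Q (op_ad (gauge_coder G br \<xi>) F z) = Q (coder_series p (series_ad \<xi> A) z)"
proof -
  let ?X = "gauge_coder G br \<xi> :: ('v list \<Rightarrow>\<^sub>0 'k) \<Rightarrow> _"
  let ?S = "coder_series p A"
  let ?X' = "coder_series 0 \<xi>"
  let ?T = "nested_coder"
  have S: "tensor_operator scale ?S" by (rule tensor_operator_coder_series[OF A])
  have X': "tensor_operator scale ?X'" by (rule tensor_operator_coder_series[OF \<xi>])
  obtain L where L: "z \<in> short_words L" using ex_short_words by blast
  have "Q (F (?X z)) = Q (?S (?X' z))"
    unfolding F by (rule Q_operator_cong[OF S Q_gauge_coder[OF assms(1)]])
  moreover have "Q (?X (F z)) = Q (?X' (?S z))"
    unfolding Q_gauge_coder[OF assms(1)] by (rule Q_operator_cong[OF X' F])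
  ultimately have "Q (op_ad ?X F z) = Q (?S (?X' z)) - Q (?X' (?S z))"
    by (simp add: op_ad_def Q_simps)
  also have "Q (?S (?X' z)) = (\<Sum>i<L. \<Sum>j<L. Q (?T i p (A i) (?T j 0 (\<xi> j) z)))"
    unfolding coder_series_eq[OF coder_series_short_words[OF L]]
    by (simp only: coder_series_eq[OF L] lin_simps[OF lin_nested_coder] Q_simps)
  also have "Q (?X' (?S z)) = (\<Sum>j<L. \<Sum>i<L. Q (?T j 0 (\<xi> j) (?T i p (A i) z)))"
    unfolding coder_series_eq[OF coder_series_short_words[OF L]]
    by (simp only: coder_series_eq[OF L] lin_simps[OF lin_nested_coder] Q_simps)
  also have "\<dots> = (\<Sum>i<L. \<Sum>j<L. Q (?T j 0 (\<xi> j) (?T i p (A i) z)))"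
    by (rule sum.swap)
  also have "(\<Sum>i<L. \<Sum>j<L. Q (?T i p (A i) (?T j 0 (\<xi> j) z))) - (\<Sum>i<L. \<Sum>j<L. Q (?T j 0 (\<xi> j) (?T i p (A i) z)))
    = (\<Sum>i<L. \<Sum>j<L. Q (?T (i + j) p (graded_commutator p 0 (A i) (\<xi> j)) z))"
    using nested_coder_commutator[OF A \<xi>] by (simp add: sum_subtractf[symmetric])
  also have "\<dots> = (\<Sum>(i, j)\<in>{..<L} \<times> {..<L}. Q (?T (i + j) p (graded_commutator p 0 (A i) (\<xi> j)) z))"
    by (simp add: sum.cartesian_product)
  \<comment> \<open>A coderivation of index i + j \<ge> L kills words shorter than L. The remaining
    triangle, summed by i + j, is the Cauchy product in \<open>series_ad\<close>.\<close>
  also have "\<dots> = (\<Sum>(i, j)\<in>{(i, j). i + j < L}. Q (?T (i + j) p (graded_commutator p 0 (A i) (\<xi> j)) z))"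
  proof (rule sum.mono_neutral_right)
    show "\<forall>a\<in>{..<L} \<times> {..<L} - {(i, j). i + j < L}.
        (case a of (i, j) \<Rightarrow> Q (?T (i + j) p (graded_commutator p 0 (A i) (\<xi> j)) z)) = 0"
      by (auto, erule contrapos_np, simp add: nested_coder_eq_0[OF L] Q_simps)
  qed auto
  also have "\<dots> = (\<Sum>m<L. \<Sum>i\<le>m. Q (?T m p (graded_commutator p 0 (A i) (\<xi> (m - i))) z))"
    by (simp add: sum.triangle_reindex)
  also have "\<dots> = (\<Sum>m<L. Q (?T m p (series_ad \<xi> A m) z))"
    by (intro sum.cong refl Q_nested_coder_sum[symmetric]) (simp_all add: series_ad_def graded_commutator_def)
  finally show ?thesis by (simp only: coder_series_eq[OF L] Q_simps)
qed

text \<open>The homomorphism commutes with each power of the commutator operation. A bound on the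
  length of words truncates both sums, in the exponent n and in the order m of t, so they may be
  exchanged.\<close>

theorem op_exp_ad_coder_series:
  assumes "\<xi> 0 = (\<lambda>_. 0)" and A: "\<And>i. derivation scale G br p (A i)"
  shows "Q (op_exp_ad (gauge_coder G br \<xi>) (coder_series p A) z) = Q (coder_series p (series_exp_ad scale \<xi> A) z)"
proof -
  let ?X = "gauge_coder G br \<xi> :: ('v list \<Rightarrow>\<^sub>0 'k) \<Rightarrow> _"
  let ?B = "\<lambda>n. (series_ad \<xi> ^^ n) A"
  interpret X: shortening ?X by (rule shortening_gauge_coder)
  obtain L where L: "z \<in> short_words L" using ex_short_words by blast
  have ad: "Q ((op_ad ?X ^^ n) (coder_series p A) z) = Q (coder_series p (?B n) z)" for n z
  proof (induction n arbitrary: z)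
    case (Suc n)
    show ?case
      unfolding funpow.simps comp_apply
      by (rule op_ad_coder_series[OF assms(1) derivation_series_ad_funpow[OF A] Suc])
  qed simp
  \<comment> \<open>The n-th commutator has no coefficient below order n, so for m < L the terms
    with n \<ge> L vanish.\<close>
  have exp: "series_exp_ad scale \<xi> A m x = (\<Sum>n<L. scale (1 / fact n) (?B n m x))" if "m < L" for m x
    unfolding series_exp_ad_def
  proof (rule Sum_any.expand_superset)
    show "{n. scale (1 / fact n) (?B n m x) \<noteq> 0} \<subseteq> {..<L}"
    proof
      fix n assume "n \<in> {n. scale (1 / fact n) (?B n m x) \<noteq> 0}"
      then have "?B n m x \<noteq> 0" by auto
      then have "\<not> m < n" using series_ad_funpow_eq_0[OF assms, where m = m and n = n and x = x] by auto
      then show "n \<in> {..<L}" using that by simp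
    qed
  qed simp
  have "op_exp_ad ?X (coder_series p A) z = (\<Sum>n<L. smul (1 / fact n) ((op_ad ?X ^^ n) (coder_series p A) z))"
    by (rule X.op_exp_ad(1)[OF tensor_operator_lin[OF tensor_operator_coder_series[OF A]] coder_series_short_words L])
  then have "Q (op_exp_ad ?X (coder_series p A) z) = (\<Sum>n<L. smul (1 / fact n) (Q (coder_series p (?B n) z)))"
    by (simp only: Q_simps ad)
  also have "\<dots> = (\<Sum>n<L. \<Sum>m<L. smul (1 / fact n) (Q (nested_coder m p (?B n m) z)))"
    by (simp only: coder_series_eq[OF L] Q_simps free.scale_sum_right)
  also have "\<dots> = (\<Sum>m<L. \<Sum>n<L. smul (1 / fact n) (Q (nested_coder m p (?B n m) z)))"
    by (rule sum.swap)
  also have "\<dots> = (\<Sum>m<L. Q (nested_coder m p (series_exp_ad scale \<xi> A m) z))"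
  proof (rule sum.cong[OF refl])
    fix m assume m: "m \<in> {..<L}"
    have "smul (1 / fact n) (Q (nested_coder m p (?B n m) z)) =
        Q (nested_coder m p (\<lambda>x. scale (1 / fact n) (?B n m x)) z)" for n
      by (rule Q_nested_coder_scale[symmetric]) (rule refl)
    moreover have "Q (nested_coder m p (series_exp_ad scale \<xi> A m) z) =
        (\<Sum>n<L. Q (nested_coder m p (\<lambda>x. scale (1 / fact n) (?B n m x)) z))"
      by (rule Q_nested_coder_sum) (use m in \<open>simp_all add: exp\<close>)
    ultimately show "(\<Sum>n<L. smul (1 / fact n) (Q (nested_coder m p (?B n m) z))) =
        Q (nested_coder m p (series_exp_ad scale \<xi> A m) z)" by simp
  qed
  finally show ?thesis by (simp only: coder_series_eq[OF L] Q_simps)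
qed

end

end

theorem proposition5p1:
  fixes scale :: "'k::field_char_0 \<Rightarrow> 'v::ab_group_add \<Rightarrow> 'v"
    and G :: "int \<Rightarrow> 'v set"
    and br :: "'v \<Rightarrow> 'v \<Rightarrow> 'v"
    and d :: "'v \<Rightarrow> 'v"
    and \<delta> \<delta>' \<xi> :: "nat \<Rightarrow> 'v \<Rightarrow> 'v"
    and D D' \<Xi> :: "('v list \<Rightarrow>\<^sub>0 'k) \<Rightarrow> ('v list \<Rightarrow>\<^sub>0 'k)"
  assumes "dg_leibniz_algebra scale G br d"
    and "formal_deformation scale G br d \<delta>"
    and "\<xi> 0 = (\<lambda>_. 0)" and "\<And>i. derivation scale G br 0 (\<xi> i)"
    and "formal_deformation scale G br d \<delta>'"
    and "\<delta>' = series_exp_ad scale \<xi> \<delta>"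
    and "D = codifferential scale G br \<delta>"
    and "D' = codifferential scale G br \<delta>'"
    and "\<Xi> = gauge_coder G br \<xi>"
  shows
    \<comment> \<open>the maps below are well defined on the tensor coalgebra, and \<open>\<Xi>\<close> is a coderivation\<close>
    "(tensor_operator scale D \<and> tensor_operator scale D' \<and> tensor_operator scale \<Xi> \<and>
      tensor_operator scale (op_exp_ad \<Xi> D) \<and>
      tensor_operator scale (op_exp \<Xi>) \<and> tensor_operator scale (op_exp (\<lambda>z. - \<Xi> z)) \<and>
      descends words (tensor_relations scale) words2 (tensor_relations2 scale) (comult G) \<and>
      descends words2 (tensor_relations2 scale) words2 (tensor_relations2 scale)
        (op_tensor G 0 (op_exp \<Xi>) (op_exp \<Xi>)) \<and>
      coderivation scale G 0 \<Xi>)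
     \<and> \<comment> \<open>(I)\<close>
     (\<forall>X \<in> tensor_space scale.
        qmap (tensor_rel scale) D' X = qmap (tensor_rel scale) (op_exp_ad \<Xi> D) X)
     \<and> \<comment> \<open>(II)\<close>
     (bij_betw (qmap (tensor_rel scale) (op_exp \<Xi>)) (tensor_space scale) (tensor_space scale) \<and>
      (\<forall>n. qmap (tensor_rel scale) (op_exp \<Xi>) ` tensor_space_grade scale G n =
           tensor_space_grade scale G n) \<and>
      (\<forall>X \<in> tensor_space scale.
        qmap (tensor_rel scale) D' X =
        qmap (tensor_rel scale) (\<lambda>z. op_exp (\<lambda>z. - \<Xi> z) (D (op_exp \<Xi> z))) X) \<and>
      (\<forall>X \<in> tensor_space scale.
        qmap (tensor_rel2 scale) (\<lambda>z. comult G (op_exp \<Xi> z)) X =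
        qmap (tensor_rel2 scale) (\<lambda>z. op_tensor G 0 (op_exp \<Xi>) (op_exp \<Xi>) (comult G z)) X))"
proof -
  interpret dg_leibniz_algebra scale G br d by fact
  note \<xi> = assms(4)
  have \<delta>: "derivation scale G br 1 (\<delta> i)" and \<delta>': "derivation scale G br 1 (\<delta>' i)" for i
    using assms(2,5) by (simp_all add: formal_deformation_def)
  have D: "D = coder_series 1 \<delta>" and D': "D' = coder_series 1 \<delta>'"
    unfolding assms(7,8) by (rule codifferential_eq[OF \<delta>], rule codifferential_eq[OF \<delta>'])
  interpret X: shortening \<Xi>
    unfolding assms(9) by (rule shortening_gauge_coder[OF \<xi>])
  interpret minus: shortening "\<lambda>z. - \<Xi> z" by (rule X.shortening_uminus)
  let ?e = "op_exp \<Xi>"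
  let ?m = "op_exp (\<lambda>z. - \<Xi> z)"
  have op_D: "tensor_operator scale D" unfolding D by (rule tensor_operator_coder_series[OF \<delta>])
  have op_D': "tensor_operator scale D'" unfolding D' by (rule tensor_operator_coder_series[OF \<delta>'])
  have op_X: "tensor_operator scale \<Xi>" unfolding assms(9) by (rule tensor_operator_gauge_coder[OF \<xi>])
  have op_e: "tensor_operator scale ?e"
    by (intro tensor_operatorI X.lin_op_exp X.op_exp_mem subspace_words subspace_R
        tensor_operator_words[OF op_X] tensor_operator_relations[OF op_X])
  have op_m: "tensor_operator scale ?m"
    by (intro tensor_operatorI minus.lin_op_exp minus.op_exp_mem subspace_words subspace_R
        free.subspace_neg[OF subspace_words] free.subspace_neg[OF subspace_R]
        tensor_operator_words[OF op_X] tensor_operator_relations[OF op_X])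
  \<comment> \<open>This equality holds on representatives, so the conjugation formula in (II) is
    (I) rewritten.\<close>
  have ad_eq: "op_exp_ad \<Xi> D = (\<lambda>z. ?m (D (?e z)))"
  proof
    fix z :: "'v list \<Rightarrow>\<^sub>0 'k"
    obtain L where L: "z \<in> short_words L" using ex_short_words by blast
    show "op_exp_ad \<Xi> D z = ?m (D (?e z))"
      by (rule X.op_exp_ad(2)[OF tensor_operator_lin[OF op_D] _ L]) (simp add: D coder_series_short_words)
  qed
  have op_ad: "tensor_operator scale (op_exp_ad \<Xi> D)"
    unfolding ad_eq by (rule tensor_operator_compose[OF op_m tensor_operator_compose[OF op_D op_e]])
  have desc1: "descends words R words2 R2 (comult G)"
    by (auto simp: descends_def lin_comult comult_words2 comult_R)
  have desc2: "descends words2 R2 words2 R2 (op_tensor G 0 ?e ?e)"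
    using op_tensor_in_words2[OF op_e op_e] op_tensor_relations[OF op_e op_e]
    by (auto simp: descends_def lin_op_tensor)
  have main: "Q (D' z) = Q (op_exp_ad \<Xi> D z)" for z
    unfolding D D' assms(6,9) 
    by (rule op_exp_ad_coder_series[where \<xi> = \<xi> and A = \<delta> and p = 1, OF \<xi> assms(3) \<delta>, symmetric])
  have cod: "Q2 (comult G (\<Xi> z)) = Q2 (op_tensor G 0 \<Xi> id (comult G z)) + Q2 (op_tensor G 0 id \<Xi> (comult G z))" for z
    unfolding assms(9) by (rule gauge_coder_coderivation[OF \<xi>])
  have I: "\<forall>X \<in> tensor_space scale. qmap (tensor_rel scale) D' X = qmap (tensor_rel scale) (op_exp_ad \<Xi> D) X"
  proof
    fix X :: "('v list \<Rightarrow>\<^sub>0 'k) set" assume "X \<in> tensor_space scale"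
    then have X: "z \<in> words" if "z \<in> X" for z using that tensor_space_subset by blast
    show "qmap (tensor_rel scale) D' X = qmap (tensor_rel scale) (op_exp_ad \<Xi> D) X"
      unfolding tensor_rel_def
      by (rule qmap_cong[OF subspace_R tensor_operator_words[OF op_D' X] tensor_operator_words[OF op_ad X] main])
  qed
  have coderivation: "coderivation scale G 0 \<Xi>"
    unfolding coderivation_def tensor_rel2_def
  proof
    fix X :: "('v list \<Rightarrow>\<^sub>0 'k) set"
    show "qmap (modulo words2 R2) (\<lambda>z. comult G (\<Xi> z)) X =
      qmap (modulo words2 R2) (\<lambda>z. op_tensor G 0 \<Xi> id (comult G z) + op_tensor G 0 id \<Xi> (comult G z)) X"
    proof (rule qmap_cong[OF subspace_R2 comult_words2])
      fix z
      show "op_tensor G 0 \<Xi> id (comult G z) + op_tensor G 0 id \<Xi> (comult G z) \<in> words2"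
        by (intro free.subspace_add[OF subspace_words2] op_tensor_in_words2 op_X tensor_operator_id comult_words2)
    qed (simp add: cod Q2_simps)
  qed
  have II: "\<forall>X \<in> tensor_space scale.
        qmap (tensor_rel2 scale) (\<lambda>z. comult G (?e z)) X =
        qmap (tensor_rel2 scale) (\<lambda>z. op_tensor G 0 ?e ?e (comult G z)) X"
    unfolding tensor_rel2_def
    by (intro ballI qmap_cong[OF subspace_R2 comult_words2] op_tensor_in_words2[OF op_e op_e comult_words2]
        comult_op_exp[OF X.shortening_axioms op_X cod op_e])
  interpret e: tensor_automorphism scale ?e ?m
    by (rule tensor_automorphism.intro)
      (simp_all add: X.lin_op_exp minus.lin_op_exp tensor_operator_words[OF op_e] tensor_operator_words[OF op_m]
        tensor_operator_relations[OF op_e] tensor_operator_relations[OF op_m] X.op_exp_uminus X.op_exp_uminus')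
  have hom: "\<Xi> z \<in> homogeneous_tensors G n" if "z \<in> homogeneous_tensors G n" for z n
    using gauge_coder_homogeneous[OF \<xi> that] by (simp add: assms(9))
  have grade: "qmap (tensor_rel scale) ?e ` tensor_space_grade scale G n = tensor_space_grade scale G n" for n
    unfolding tensor_space_grade_def homogeneous_tensors_def[symmetric]
    by (rule e.qmap_image[OF homogeneous_tensors_words])
      (auto intro: X.op_exp_mem[OF subspace_homogeneous_tensors] minus.op_exp_mem[OF subspace_homogeneous_tensors]
        free.subspace_neg[OF subspace_homogeneous_tensors] hom)
  show ?thesis
    using op_D op_D' op_X op_ad op_e op_m desc1 desc2 coderivation I e.bij_betw_qmap grade I[unfolded ad_eq] II
    by (intro conjI allI) blast+
qed

end
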